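(* The following problem (general min-max edge $q$-coloring) is NP-hard. Input: a finite simple graph $G=(V,E)$ together with a positive integer $q_v$ for each vertex $v\in V$. A feasible solution is a coloring $\sigma$ of the edges of $G$ such that, for each vertex $v$, the edges incident to $v$ receive at most $q_v$ distinct colors. Goal: find a feasible coloring $\sigma$ minimizing $\max_c |\{e\in E : \sigma(e)=c\}|$, the size of the largest color group.
   Context: A color group of an edge coloring $\sigma$ is a set of the form $\{e\in E:\sigma(e)=c\}$ for a color $c$ used by $\sigma$. NP-hardness is meant for the associated decision problem: given $G$, the integers $q_v$ and an integer $L$, decide whether a feasible coloring with all color groups of size at most $L$ exists. *)

theory Defs
  imports Main "HOL-Computational_Algebra.Polynomial"
begin

section \<open>Multi-tape Turing machines\<close>

datatype move = MLeft | MStay | MRight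

text \<open>
  States and tape symbols are initial segments of the natural numbers. Symbol 0 is the blank;
  1 and 2 stand for the bits False and True. The transition function only matters on states
  below \<open>nstates\<close> and on words of length \<open>ntapes\<close> over symbols below \<open>nsyms\<close>.
\<close>

record tm =
  ntapes :: nat
  nstates :: nat
  nsyms :: nat
  start :: nat
  halt :: nat
  trans :: "nat \<Rightarrow> nat list \<Rightarrow> nat \<times> (nat \<times> move) list"

definition wf_tm :: "tm \<Rightarrow> bool" where
  "wf_tm M \<longleftrightarrow>
     1 \<le> ntapes M \<and> 3 \<le> nsyms M \<and> start M < nstates M \<and> halt M < nstates M \<and>
     (\<forall>s r. s < nstates M \<and> length r = ntapes M \<and> set r \<subseteq> {..<nsyms M} \<longrightarrow>
        fst (trans M s r) < nstates M \<and>
        length (snd (trans M s r)) = ntapes M \<and>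
        fst ` set (snd (trans M s r)) \<subseteq> {..<nsyms M})"

text \<open>A two-way infinite tape together with the position of its head.\<close>

type_synonym tape = "(int \<Rightarrow> nat) \<times> int"
type_synonym config = "nat \<times> tape list"

fun head_shift :: "move \<Rightarrow> int" where
  "head_shift MLeft = - 1"
| "head_shift MStay = 0"
| "head_shift MRight = 1"

definition act :: "nat \<times> move \<Rightarrow> tape \<Rightarrow> tape" where
  "act = (\<lambda>(a, m) (f, h). (f(h := a), h + head_shift m))"

definition step :: "tm \<Rightarrow> config \<Rightarrow> config" where
  "step M = (\<lambda>(s, ts).
     if s = halt M then (s, ts)
     else let (s', as) = trans M s (map (\<lambda>(f, h). f h) ts) in (s', map2 act as ts))"

definition tape_of :: "bool list \<Rightarrow> int \<Rightarrow> nat" where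
  "tape_of x i =
     (if 0 \<le> i \<and> i < int (length x) then (if x ! nat i then 2 else 1) else 0)"

text \<open>The input is on the first tape, the output on the last one.\<close>

definition init :: "tm \<Rightarrow> bool list \<Rightarrow> config" where
  "init M x = (start M, (tape_of x, 0) # replicate (ntapes M - 1) (\<lambda>_. 0, 0))"

definition computes_in_time ::
    "tm \<Rightarrow> (bool list \<Rightarrow> bool list) \<Rightarrow> (nat \<Rightarrow> nat) \<Rightarrow> bool" where
  "computes_in_time M f T \<longleftrightarrow>
     (\<forall>x. \<exists>t \<le> T (length x).
        fst ((step M ^^ t) (init M x)) = halt M \<and>
        fst (last (snd ((step M ^^ t) (init M x)))) = tape_of (f x))"


section \<open>NP and NP-hardness\<close>

definition polytime_computable :: "(bool list \<Rightarrow> bool list) \<Rightarrow> bool" where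
  "polytime_computable f \<longleftrightarrow>
     (\<exists>M (p :: nat poly). wf_tm M \<and> computes_in_time M f (poly p))"

definition polytime_decidable :: "bool list set \<Rightarrow> bool" where
  "polytime_decidable A \<longleftrightarrow> polytime_computable (\<lambda>x. [x \<in> A])"

text \<open>
  Self-delimiting pairing of words: every bit of the first word is preceded by True, and False
  marks its end.
\<close>

fun pair_enc :: "bool list \<Rightarrow> bool list \<Rightarrow> bool list" where
  "pair_enc [] u = False # u"
| "pair_enc (b # x) u = True # b # pair_enc x u"

definition NP :: "bool list set set" where
  "NP = {A. \<exists>R (p :: nat poly). polytime_decidable R \<and>
           (\<forall>x. x \<in> A \<longleftrightarrow> (\<exists>u. length u \<le> poly p (length x) \<and> pair_enc x u \<in> R))}"

definition polytime_reducible :: "bool list set \<Rightarrow> bool list set \<Rightarrow> bool" where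
  "polytime_reducible A B \<longleftrightarrow> (\<exists>f. polytime_computable f \<and> (\<forall>x. x \<in> A \<longleftrightarrow> f x \<in> B))"

definition NP_hard :: "bool list set \<Rightarrow> bool" where
  "NP_hard B \<longleftrightarrow> (\<forall>A \<in> NP. polytime_reducible A B)"


section \<open>Min-max edge q-coloring\<close>

definition simple_graph :: "'a set \<Rightarrow> 'a set set \<Rightarrow> bool" where
  "simple_graph V E \<longleftrightarrow> finite V \<and> (\<forall>e \<in> E. e \<subseteq> V \<and> card e = 2)"

definition feasible_coloring ::
    "'a set \<Rightarrow> 'a set set \<Rightarrow> ('a \<Rightarrow> nat) \<Rightarrow> ('a set \<Rightarrow> 'c) \<Rightarrow> bool" where
  "feasible_coloring V E q \<sigma> \<longleftrightarrow> (\<forall>v \<in> V. card (\<sigma> ` {e \<in> E. v \<in> e}) \<le> q v)"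

definition color_groups :: "'a set set \<Rightarrow> ('a set \<Rightarrow> 'c) \<Rightarrow> 'a set set set" where
  "color_groups E \<sigma> = {{e \<in> E. \<sigma> e = c} | c. c \<in> \<sigma> ` E}"

text \<open>Natural numbers serve as colors: finitely many edges never need more than countably many.\<close>

definition q_colorable ::
    "'a set \<Rightarrow> 'a set set \<Rightarrow> ('a \<Rightarrow> nat) \<Rightarrow> nat \<Rightarrow> bool" where
  "q_colorable V E q L \<longleftrightarrow>
     (\<exists>\<sigma> :: 'a set \<Rightarrow> nat.
        feasible_coloring V E q \<sigma> \<and> (\<forall>X \<in> color_groups E \<sigma>. card X \<le> L))"


section \<open>The decision problem as a language\<close>

text \<open>Binary representation, least significant bit first, without trailing zeros.\<close>

fun nat_bits :: "nat \<Rightarrow> bool list" where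
  "nat_bits n = (if n = 0 then [] else odd n # nat_bits (n div 2))"

declare nat_bits.simps [simp del]

definition enc_nats :: "nat list \<Rightarrow> bool list" where
  "enc_nats ns = foldr (\<lambda>n. pair_enc (nat_bits n)) ns []"

text \<open>
  An instance has vertex set \<open>{..<length qs}\<close>, the bound \<open>qs ! v\<close> at vertex \<open>v\<close>, and an edge set
  listed as pairs \<open>(u, v)\<close> with \<open>u < v\<close>, in any order but without repetition.
\<close>

definition edge_set :: "(nat \<times> nat) list \<Rightarrow> nat set set" where
  "edge_set es = (\<lambda>(u, v). {u, v}) ` set es"

definition valid_instance :: "nat list \<Rightarrow> (nat \<times> nat) list \<Rightarrow> bool" where
  "valid_instance qs es \<longleftrightarrow>
     (\<forall>q \<in> set qs. 0 < q) \<and> distinct es \<and> (\<forall>(u, v) \<in> set es. u < v \<and> v < length qs)"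

definition enc_instance :: "nat list \<Rightarrow> (nat \<times> nat) list \<Rightarrow> nat \<Rightarrow> bool list" where
  "enc_instance qs es L =
     enc_nats (L # length qs # qs @ concat (map (\<lambda>(u, v). [u, v]) es))"

definition min_max_edge_q_coloring :: "bool list set" where
  "min_max_edge_q_coloring =
     {enc_instance qs es L | qs es L.
        valid_instance qs es \<and> q_colorable {..<length qs} (edge_set es) (\<lambda>v. qs ! v) L}"

lemma valid_instance_simple_graph:
  assumes "valid_instance qs es"
  shows "simple_graph {..<length qs} (edge_set es)"
  using assms by (fastforce simp: valid_instance_def simple_graph_def edge_set_def)

lemma simple_graph_valid_instance:
  fixes q :: "nat \<Rightarrow> nat"
  assumes G: "simple_graph {..<n} E" and q: "\<And>v. v < n \<Longrightarrow> 0 < q v"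
  shows "\<exists>es. valid_instance (map q [0..<n]) es \<and> edge_set es = E"
proof -
  define S where "S = {(u, v). u < v \<and> v < n \<and> {u, v} \<in> E}"
  have "S \<subseteq> {..<n} \<times> {..<n}"
    unfolding S_def by auto
  then have "finite S"
    by (rule finite_subset) simp
  then obtain es where es: "set es = S" "distinct es"
    using finite_distinct_list by blast
  have "e \<in> edge_set es" if "e \<in> E" for e
  proof -
    have "e \<subseteq> {..<n}" "card e = 2"
      using G that unfolding simple_graph_def by blast+
    moreover from this obtain a b where "e = {a, b}" "a \<noteq> b"
      unfolding card_2_iff by blast
    moreover from this have "e = {min a b, max a b}" "min a b < max a b"
      by (auto simp: min_def max_def)
    ultimately obtain u v where uv: "e = {u, v}" "u < v" "v < n"
      by (metis insert_subset lessThan_iff)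
    then have "(u, v) \<in> set es"
      using that unfolding es S_def by simp
    then show ?thesis
      unfolding edge_set_def using uv(1) by (intro image_eqI[of _ _ "(u, v)"]) simp_all
  qed
  moreover have "edge_set es \<subseteq> E"
    unfolding edge_set_def es S_def by auto
  ultimately have "edge_set es = E"
    by blast
  moreover have "valid_instance (map q [0..<n]) es"
    unfolding valid_instance_def es(1) S_def using es(2) q by simp
  ultimately show ?thesis by blast
qed

lemma pair_enc_inj: "pair_enc x u = pair_enc y v \<longleftrightarrow> x = y \<and> u = v"
proof (induction x arbitrary: y)
  case Nil
  then show ?case by (cases y) auto
next
  case (Cons b x)
  then show ?case by (cases y) auto
qed

lemma nat_bits_0: "nat_bits 0 = []"
  by (subst nat_bits.simps) simp

lemma nat_bits_pos: "0 < n \<Longrightarrow> nat_bits n = odd n # nat_bits (n div 2)"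
  by (subst nat_bits.simps) simp

lemma nat_bits_inj: "nat_bits m = nat_bits n \<longleftrightarrow> m = n"
proof (induction m arbitrary: n rule: less_induct)
  case (less m)
  consider "m = 0" | "n = 0" | "0 < m" "0 < n" by blast
  then show ?case
  proof cases
    case 1
    then show ?thesis by (cases "n = 0") (simp_all add: nat_bits_0 nat_bits_pos)
  next
    case 2
    then show ?thesis by (cases "m = 0") (simp_all add: nat_bits_0 nat_bits_pos)
  next
    case 3
    have "nat_bits (m div 2) = nat_bits (n div 2) \<longleftrightarrow> m div 2 = n div 2"
      by (rule less) (use 3 in simp)
    then have "nat_bits m = nat_bits n \<longleftrightarrow> odd m = odd n \<and> m div 2 = n div 2"
      unfolding nat_bits_pos[OF 3(1)] nat_bits_pos[OF 3(2)] list.inject by (rule arg_cong)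
    also have "\<dots> \<longleftrightarrow> m = n"
      by (metis dvd_div_mult_self odd_two_times_div_two_succ mult.commute)
    finally show ?thesis .
  qed
qed

lemma pair_enc_not_Nil: "pair_enc x u \<noteq> []"
  by (cases x) simp_all

lemma enc_nats_inj: "enc_nats ms = enc_nats ns \<longleftrightarrow> ms = ns"
proof (induction ms arbitrary: ns)
  case Nil
  show ?case
    by (cases ns) (simp_all add: enc_nats_def pair_enc_not_Nil pair_enc_not_Nil[symmetric])
next
  case (Cons m ms)
  then show ?case
    by (cases ns) (simp_all add: enc_nats_def pair_enc_inj nat_bits_inj pair_enc_not_Nil)
qed

lemma concat_pairs_inj:
  "concat (map (\<lambda>(u, v). [u, v]) es) = concat (map (\<lambda>(u, v). [u, v]) es') \<longleftrightarrow> es = es'"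
proof (induction es arbitrary: es')
  case Nil
  show ?case by (cases es') (simp_all add: case_prod_beta)
next
  case (Cons e es)
  show ?case
    by (cases es') (simp_all add: Cons.IH[unfolded case_prod_beta] case_prod_beta prod_eq_iff)
qed

lemma enc_instance_inj:
  "enc_instance qs es L = enc_instance qs' es' L' \<longleftrightarrow> qs = qs' \<and> es = es' \<and> L = L'"
proof -
  have "length qs = length qs' \<and> qs @ concat (map (\<lambda>(u, v). [u, v]) es)
      = qs' @ concat (map (\<lambda>(u, v). [u, v]) es') \<longleftrightarrow> qs = qs' \<and> es = es'"
    using append_eq_append_conv concat_pairs_inj by metis
  then show ?thesis
    unfolding enc_instance_def enc_nats_inj list.inject by blast
qed

end

(*
  Every problem in NP is reduced directly. A tableau for the verifier turns acceptance into a set of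
  clauses, and these are encoded by forcing colors: a q = 1 vertex with more than L/2 edges fixes a
  color of its own, two anchors T and F joined to a q = 2 vertex restrict a third edge there to
  the colors of T and F, and a clause vertex of degree d with q = d - 1 forces two of its edges to
  agree, namely the value of some variable with the anchor of a literal of the clause.

  Since all instance parameters are polynomial, the reduction can keep its numbers in unary, as head
  positions on counter tapes. It is written as an arithmetic expression deciding adjacency,
  evaluated for all pairs of vertices; every such expression is computable in polynomial time.
*)
theory Submission
  imports Defs
begin

section \<open>Counter programs on Turing machines\<close>

text \<open>With q = 1 an anchor is only monochromatic; that different anchors get different colors
  has to come from the size bound L. It must leave room for the leaf edges of one anchor together
  with all edges between non-leaves, yet exclude the leaf edges of two anchors. Once all anchors
  differ, two edges that agree at a clause vertex cannot both come from anchors, nor both from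
  values, since each value is confined to the anchor pair of its own variable. So one vertex serves
  a clause of any width, and no passage to 3-SAT is needed.

  The other obstacle is that polynomial time refers to concrete Turing machines. The propositions
  and rule instances of the tableau are therefore numerals with five and six digits in a base B
  polynomial in the input length; their parameters are recovered by division. The fixed number of
  digits keeps every vertex number polynomial, so unary counters suffice, and the transition
  function of the fixed verifier enters as finite tables.\<close>

datatype com = Skip | Inc nat | Dec nat | Emit bool
  | Seq com com | If nat nat com com | While nat nat com

text \<open>Tape 0 holds the input. Every other tape is a counter: its value is the head position, and its
  only non-blank cell is a marker 1 in cell 0, so that reading a 1 means zero.\<close>

definition sym :: "bool list \<Rightarrow> nat \<Rightarrow> nat \<Rightarrow> nat" where
  "sym x j p = (if j = 0 then tape_of x (int p) else if p = 0 then 1 else 0)"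

text \<open>Times count machine steps exactly: \<open>Seq\<close>, \<open>If\<close> and
  \<open>While\<close> each spend one step on replacing the command by its continuation.
  Decrementing zero has no derivation, since the head would move left of the marker and its position
  would no longer be a natural number.\<close>

inductive exec :: "bool list \<Rightarrow> com \<Rightarrow> (nat \<Rightarrow> nat) \<Rightarrow> nat \<Rightarrow> bool list \<Rightarrow> (nat \<Rightarrow> nat) \<Rightarrow> bool" for x where
  Skip: "exec x Skip s 1 [] s"
| Inc: "exec x (Inc j) s 1 [] (s(j := Suc (s j)))"
| Dec: "s j = Suc n \<Longrightarrow> exec x (Dec j) s 1 [] (s(j := n))"
| Emit: "exec x (Emit b) s 1 [b] s"
| Seq: "exec x c s t w s' \<Longrightarrow> exec x d s' t' w' s'' \<Longrightarrow> exec x (Seq c d) s (Suc (t + t')) (w @ w') s''"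
| If_eq: "sym x j (s j) = a \<Longrightarrow> exec x c s t w s' \<Longrightarrow> exec x (If j a c d) s (Suc t) w s'"
| If_neq: "sym x j (s j) \<noteq> a \<Longrightarrow> exec x d s t w s' \<Longrightarrow> exec x (If j a c d) s (Suc t) w s'"
| While_end: "sym x j (s j) = a \<Longrightarrow> exec x (While j a c) s 1 [] s"
| While_step: "sym x j (s j) \<noteq> a \<Longrightarrow> exec x c s t w s' \<Longrightarrow> exec x (While j a c) s' t' w' s'' \<Longrightarrow>
    exec x (While j a c) s (Suc (t + t')) (w @ w') s''"

fun regs :: "com \<Rightarrow> nat set" where
  "regs Skip = {}" | "regs (Inc j) = {j}" | "regs (Dec j) = {j}" | "regs (Emit b) = {}"
| "regs (Seq c d) = regs c \<union> regs d"
| "regs (If j a c d) = insert j (regs c \<union> regs d)"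
| "regs (While j a c) = insert j (regs c)"

lemma finite_regs: "finite (regs c)"
  by (induction c) auto

text \<open>The control states of the machine running a command are its continuations, as lists of
  commands still to be executed.\<close>

fun next_cont :: "com \<Rightarrow> nat list \<Rightarrow> com list" where
  "next_cont (Seq c d) r = [c, d]"
| "next_cont (If j a c d) r = (if r ! j = a then [c] else [d])"
| "next_cont (While j a c) r = (if r ! j = a then [] else [c, While j a c])"
| "next_cont _ r = []"

fun act_of :: "nat \<Rightarrow> com \<Rightarrow> nat \<Rightarrow> nat \<Rightarrow> nat \<times> move" where
  "act_of k (Inc j) i y = (y, if i = j then MRight else MStay)"
| "act_of k (Dec j) i y = (y, if i = j then MLeft else MStay)"
| "act_of k (Emit b) i y = (if i = Suc k then (if b then 2 else 1, MRight) else (y, MStay))"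
| "act_of k _ i y = (y, MStay)"

text \<open>While \<open>c\<close> runs inside \<open>Seq c d\<close> or a loop, the rest is
  appended to each of its continuations. A loop body ends in \<open>[While j a c]\<close> again, so
  continuations do not grow with the number of iterations and the set is finite.\<close>

fun conts :: "com \<Rightarrow> com list set" where
  "conts (Seq c d) = insert [Seq c d] ((\<lambda>X. X @ [d]) ` conts c \<union> conts d)"
| "conts (If j a c d) = insert [If j a c d] (conts c \<union> conts d)"
| "conts (While j a c) = {[], [While j a c]} \<union> (\<lambda>X. X @ [While j a c]) ` conts c"
| "conts c = {[], [c]}"

lemma finite_conts: "finite (conts c)"
  by (induction c) auto

lemma conts_self: "[c] \<in> conts c" and conts_Nil: "[] \<in> conts c"
  by (induction c) auto

text \<open>Closure under one machine step, for arbitrary read symbols \<open>r\<close>, so that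
  every successor state has a number.\<close>

lemma conts_next: "d # X \<in> conts c \<Longrightarrow> next_cont d r @ X \<in> conts c"
proof (induction c arbitrary: d X)
  case (Seq c1 c2)
  from Seq.prems consider "d = Seq c1 c2" "X = []" | Y where "Y \<in> conts c1" "d # X = Y @ [c2]" | "d
      # X \<in> conts c2"
    by auto
  then show ?case
  proof cases
    case 1
    then show ?thesis using conts_self[of c1] by (auto intro!: image_eqI[of _ _ "[c1]"])
  next
    case (2 Y)
    show ?thesis
    proof (cases Y)
      case Nil
      then show ?thesis using 2 Seq.IH(2)[of d X] conts_self[of c2] by auto
    next
      case (Cons y Z)
      then show ?thesis using 2 Seq.IH(1)[of d Z] by auto
    qed
  next
    case 3
    then show ?thesis using Seq.IH(2) by auto
  qed
next
  case (If j a c1 c2)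
  then show ?case using conts_self[of c1] conts_self[of c2] by auto
next
  case (While j a c)
  from While.prems consider "d = While j a c" "X = []" | Y where "Y \<in> conts c" "d # X = Y @
      [While j a c]"
    by auto
  then show ?case
  proof cases
    case 1
    then show ?thesis using conts_self[of c] by (auto intro!: image_eqI[of _ _ "[c]"])
  next
    case (2 Y)
    show ?thesis
    proof (cases Y)
      case Nil
      then show ?thesis using 2 conts_self[of c] by (auto intro!: image_eqI[of _ _ "[c]"])
    next
      case (Cons y Z)
      then show ?thesis using 2 While.IH[of d Z] by auto
    qed
  qed
qed auto

text \<open>Running a command to its end removes it from the front; the chained runs of
  \<open>Seq\<close> need the remaining list to be a state as well.\<close>

lemma conts_tl: "d # X \<in> conts c \<Longrightarrow> X \<in> conts c"
proof (induction c arbitrary: d X)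
  case (Seq c1 c2)
  from Seq.prems consider "X = []" | Y where "Y \<in> conts c1" "d # X = Y @ [c2]" | "d # X \<in> conts c2"
    by auto
  then show ?case
  proof cases
    case 1
    then show ?thesis using conts_Nil by simp
  next
    case (2 Y)
    then show ?thesis using Seq.IH(1) conts_Nil[of c2] by (cases Y) auto
  next
    case 3
    then show ?thesis using Seq.IH(2) by auto
  qed
next
  case (While j a c)
  then show ?case by (auto simp: Cons_eq_append_conv)
qed (auto simp: conts_Nil)

text \<open>The extra state \<open>card (conts c)\<close> is the start state: a machine begins with
  blank tapes, so its first step writes the zero markers on the counter tapes \<open>1\<close> to
  \<open>k\<close>. Tape \<open>k + 1\<close> receives the emitted bits, and the empty continuation
  is the halting state.\<close>

definition com_tm :: "nat \<Rightarrow> com \<Rightarrow> (com list \<Rightarrow> nat) \<Rightarrow> tm" where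
  "com_tm k c \<phi> = \<lparr>ntapes = k + 2, nstates = Suc (card (conts c)), nsyms = 3, start = card
      (conts c), halt = \<phi> [],
     trans = (\<lambda>st r. if st = card (conts c)
        then (\<phi> [c], map (\<lambda>i. (if i \<in> {1..k} then 1 else r ! i, MStay)) [0..<k + 2])
        else case inv_into (conts c) \<phi> st of
           [] \<Rightarrow> (st, map (\<lambda>i. (r ! i, MStay)) [0..<k + 2])
         | d # X \<Rightarrow> (\<phi> (next_cont d r @ X), map (\<lambda>i. act_of k d i (r ! i)) [0..<k + 2]))\<rparr>"

definition tape_at :: "nat \<Rightarrow> bool list \<Rightarrow> (nat \<Rightarrow> nat) \<Rightarrow> bool list \<Rightarrow> nat \<Rightarrow> tape" where
  "tape_at k x s w i = (if i = 0 then (tape_of x, int (s 0))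
     else if i \<le> k then (\<lambda>p. if p = 0 then 1 else 0, int (s i))
     else (tape_of w, int (length w)))"

definition tapes_at :: "nat \<Rightarrow> bool list \<Rightarrow> (nat \<Rightarrow> nat) \<Rightarrow> bool list \<Rightarrow> tape list" where
  "tapes_at k x s w = map (tape_at k x s w) [0..<k + 2]"

lemma act_of_less_3: "y < 3 \<Longrightarrow> fst (act_of k c i y) < 3"
  by (cases c) auto

lemma tape_of_snoc: "(tape_of w)(int (length w) := if b then 2 else 1) = tape_of (w @ [b])"
  by (auto simp: tape_of_def fun_eq_iff nth_append nat_less_iff)

lemma act_same: "act (fst tp (snd tp), m) tp = (fst tp, snd tp + head_shift m)"
  by (cases tp) (simp add: act_def)

lemma act_pair: "act (a, m) (f, h) = (f(h := a), h + head_shift m)"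
  by (simp add: act_def)

section \<open>Correctness of the compiled machine\<close>

locale com_machine =
  fixes k :: nat and c0 :: com and \<phi> :: "com list \<Rightarrow> nat"
  assumes bij: "bij_betw \<phi> (conts c0) {..<card (conts c0)}" and regs: "regs c0 \<subseteq> {..k}"
begin

abbreviation "M \<equiv> com_tm k c0 \<phi>"

lemma \<phi>_less: "X \<in> conts c0 \<Longrightarrow> \<phi> X < card (conts c0)"
  using bij by (auto simp: bij_betw_def)

lemma inv_\<phi>: "X \<in> conts c0 \<Longrightarrow> inv_into (conts c0) \<phi> (\<phi> X) = X"
  using bij by (simp add: bij_betw_def)

lemma wf: "wf_tm M"
proof -
  have "fst (trans M st r) < nstates M \<and> length (snd (trans M st r)) = ntapes M \<and>
        fst ` set (snd (trans M st r)) \<subseteq> {..<nsyms M}"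
    if st: "st < nstates M" and r: "length r = ntapes M" "set r \<subseteq> {..<nsyms M}" for st r
  proof -
    have r3: "r ! i < 3" if "i < k + 2" for i
    proof -
      have "r ! i \<in> set r" using r that by (simp add: com_tm_def)
      then show ?thesis using r(2) by (auto simp: com_tm_def)
    qed
    have map3: "fst ` set (map g [0..<k + 2]) \<subseteq> {..<3}" if "\<And>i. i < k + 2 \<Longrightarrow> fst (g i) < 3" for g ::
        "nat \<Rightarrow> nat \<times> move"
      using that by (simp add: image_subset_iff del: upt_Suc)
    have states: "\<phi> X < Suc (card (conts c0))" if "X \<in> conts c0" for X
      using \<phi>_less[OF that] by simp
    show ?thesis
    proof (cases "st = card (conts c0)")
      case True
      have tr: "trans M st r = (\<phi> [c0], map (\<lambda>i. (if i \<in> {1..k} then 1 else r ! i, MStay))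
          [0..<k + 2])"
        using True by (simp add: com_tm_def)
      have "fst ` set (map (\<lambda>i. (if i \<in> {1..k} then 1 else r ! i, MStay)) [0..<k + 2]) \<subseteq> {..<3}"
        by (rule map3) (use r3 in simp)
      then show ?thesis
        unfolding tr using states[OF conts_self] by (simp add: com_tm_def del: upt_Suc)
    next
      case False
      then have "st \<in> \<phi> ` conts c0"
        using st bij by (simp add: com_tm_def bij_betw_def)
      then obtain X where X: "X \<in> conts c0" "st = \<phi> X" by blast
      show ?thesis
      proof (cases X)
        case Nil
        have tr: "trans M st r = (st, map (\<lambda>i. (r ! i, MStay)) [0..<k + 2])"
          using False X Nil inv_\<phi>[OF X(1)] by (simp add: com_tm_def)
        have "fst ` set (map (\<lambda>i. (r ! i, MStay)) [0..<k + 2]) \<subseteq> {..<3}"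
          by (rule map3) (use r3 in simp)
        then show ?thesis
          unfolding tr using states[OF X(1)] X(2) by (simp add: com_tm_def del: upt_Suc)
      next
        case (Cons d Y)
        then have "next_cont d r @ Y \<in> conts c0" using conts_next X by blast
        note * = states[OF this]
        have tr: "trans M st r = (\<phi> (next_cont d r @ Y), map (\<lambda>i. act_of k d i (r ! i))
            [0..<k + 2])"
          using False X Cons inv_\<phi>[OF X(1)] by (simp add: com_tm_def)
        have "fst ` set (map (\<lambda>i. act_of k d i (r ! i)) [0..<k + 2]) \<subseteq> {..<3}"
          by (rule map3) (use r3 act_of_less_3 in simp)
        then show ?thesis
          unfolding tr using * by (simp add: com_tm_def del: upt_Suc)
      qed
    qed
  qed
  then show ?thesis
    using \<phi>_less[OF conts_Nil] unfolding wf_tm_def by (simp add: com_tm_def)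
qed

lemma conts_Cons_not_halt: "d # X \<in> conts c0 \<Longrightarrow> \<phi> (d # X) \<noteq> \<phi> []"
  using bij conts_Nil[of c0] unfolding bij_betw_def inj_on_def by (metis list.distinct(1))

lemma step_com:
  assumes X: "d # X \<in> conts c0"
  shows "step M (\<phi> (d # X), map tp [0..<k + 2]) =
    (\<phi> (next_cont d (map (\<lambda>i. fst (tp i) (snd (tp i))) [0..<k + 2]) @ X),
     map (\<lambda>i. act (act_of k d i (fst (tp i) (snd (tp i)))) (tp i)) [0..<k + 2])"
proof -
  have "\<phi> (d # X) \<noteq> card (conts c0)" using \<phi>_less[OF X] by simp
  moreover have "map (\<lambda>(f, h). f h) (map tp [0..<k + 2]) = map (\<lambda>i. fst (tp i) (snd (tp i)))
      [0..<k + 2]"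
    by (simp add: case_prod_beta)
  ultimately show ?thesis
    unfolding step_def using conts_Cons_not_halt[OF X]
    by (simp add: com_tm_def inv_\<phi>[OF X] map2_map_map nth_append comp_def case_prod_beta)
qed

lemma read_tape_at:
  "j \<le> k \<Longrightarrow> map (\<lambda>i. fst (tape_at k x s w i) (snd (tape_at k x s w i))) [0..<k + 2] ! j = sym x j
      (s j)"
  by (auto simp: tape_at_def sym_def nth_append)

lemma fst_tape_at: "j \<le> k \<Longrightarrow> fst (tape_at k x s w j) (snd (tape_at k x s w j)) = sym x j (s j)"
  by (simp add: tape_at_def sym_def)

lemma step_tapes_at:
  assumes "d # X \<in> conts c0"
    and "\<And>i. i < k + 2 \<Longrightarrow> act (act_of k d i (fst (tape_at k x s w i) (snd (tape_at k x s w i))))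
        (tape_at k x s w i)
          = tape_at k x s' w' i"
  shows "step M (\<phi> (d # X), tapes_at k x s w) =
    (\<phi> (next_cont d (map (\<lambda>i. fst (tape_at k x s w i) (snd (tape_at k x s w i))) [0..<k + 2]) @ X),
        tapes_at k x s' w')"
  unfolding tapes_at_def step_com[OF assms(1)] using assms(2) by simp

lemma steps_Suc: "(step M ^^ n) (step M y) = z \<Longrightarrow> (step M ^^ Suc n) y = z"
  by (simp add: funpow_swap1)

lemma steps_add: "(step M ^^ m) y = y' \<Longrightarrow> (step M ^^ n) y' = z \<Longrightarrow> (step M ^^ (m + n)) y = z"
  by (subst add.commute) (simp add: funpow_add)

lemma step_silent:
  assumes "d # X \<in> conts c0" "\<And>i y. act_of k d i y = (y, MStay)"
  shows "step M (\<phi> (d # X), tapes_at k x s w) =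
    (\<phi> (next_cont d (map (\<lambda>i. fst (tape_at k x s w i) (snd (tape_at k x s w i))) [0..<k + 2]) @ X),
        tapes_at k x s w)"
  by (rule step_tapes_at[OF assms(1)]) (simp add: assms(2) act_same)

text \<open>With the continuation \<open>X\<close> and the already written word \<open>w\<close>
  left arbitrary, a run of \<open>c\<close> may end in the middle of a larger program; this lets the
  two runs of \<open>Seq\<close> or of a loop be concatenated.\<close>

lemma exec_steps:
  assumes "exec x c s t v s'" "c # X \<in> conts c0" "regs c \<subseteq> {..k}"
  shows "(step M ^^ t) (\<phi> (c # X), tapes_at k x s w) = (\<phi> X, tapes_at k x s' (w @ v))"
  using assms
proof (induction arbitrary: X w rule: exec.induct)
  case (Skip s)
  then show ?case by (simp add: step_silent)
next
  case (Inc j s)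
  have "step M (\<phi> (Inc j # X), tapes_at k x s w) = (\<phi> ([] @ X), tapes_at k x (s(j := Suc (s j))) w)"
    by (subst step_tapes_at[where s' = "s(j := Suc (s j))" and w' = w])
        (use Inc in \<open>auto simp: act_same tape_at_def\<close>)
  then show ?case by (simp del: fun_upd_apply)
next
  case (Dec s j n)
  have "step M (\<phi> (Dec j # X), tapes_at k x s w) = (\<phi> ([] @ X), tapes_at k x (s(j := n)) w)"
    by (subst step_tapes_at[where s' = "s(j := n)" and w' = w])
        (use Dec in \<open>auto simp: act_same tape_at_def\<close>)
  then show ?case by (simp del: fun_upd_apply)
next
  case (Emit b s)
  have "step M (\<phi> (Emit b # X), tapes_at k x s w) = (\<phi> ([] @ X), tapes_at k x s (w @ [b]))"
    by (subst step_tapes_at[where s' = s and w' = "w @ [b]"])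
      (use Emit in \<open>auto simp: act_same tape_at_def tape_of_snoc[symmetric] act_pair\<close>)
  then show ?case by simp
next
  case (Seq c s t v s' d t' v' s'')
  have X: "c # d # X \<in> conts c0" using conts_next[OF Seq.prems(1)] by simp
  show ?case unfolding append_assoc[symmetric]
  proof (rule steps_Suc, unfold step_silent[OF Seq.prems(1), simplified] next_cont.simps append_Cons
      append_Nil, rule steps_add)
    show "(step M ^^ t) (\<phi> (c # d # X), tapes_at k x s w) = (\<phi> (d # X), tapes_at k x s' (w @ v))"
      using Seq.IH(1) X Seq.prems(2) by simp
    show "(step M ^^ t') (\<phi> (d # X), tapes_at k x s' (w @ v)) =
        (\<phi> X, tapes_at k x s'' ((w @ v) @ v'))"
      using Seq.IH(2) conts_tl[OF X] Seq.prems(2) by simp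
  qed
next
  case (If_eq j s a c t v s' d)
  \<comment> \<open>\<open>conts_next\<close> holds for every list of read symbols, so a constant
    list that steers the test into the desired branch suffices.\<close>
  have X: "c # X \<in> conts c0" using conts_next[OF If_eq.prems(1), of "replicate (Suc j) a"] by
      (simp del: replicate_Suc)
  have "step M (\<phi> (If j a c d # X), tapes_at k x s w) = (\<phi> (c # X), tapes_at k x s w)"
    using If_eq by (subst step_silent) (simp_all add: read_tape_at fst_tape_at del: upt_Suc)
  then show ?case
    using If_eq X by (intro steps_Suc) simp
next
  case (If_neq j s a d t v s' c)
  have X: "d # X \<in> conts c0" using conts_next[OF If_neq.prems(1), of "replicate (Suc j) (Suc a)"] by
      (simp del: replicate_Suc)
  have "step M (\<phi> (If j a c d # X), tapes_at k x s w) = (\<phi> (d # X), tapes_at k x s w)"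
    using If_neq by (subst step_silent) (simp_all add: read_tape_at fst_tape_at del: upt_Suc)
  then show ?case
    using If_neq X by (intro steps_Suc) simp
next
  case (While_end j s a c)
  then have "step M (\<phi> (While j a c # X), tapes_at k x s w) = (\<phi> X, tapes_at k x s w)"
    by (subst step_silent) (simp_all add: read_tape_at fst_tape_at del: upt_Suc)
  then show ?case by simp
next
  case (While_step j s a c t v s' t' v' s'')
  have X: "c # While j a c # X \<in> conts c0"
    using conts_next[OF While_step.prems(1), of "replicate (Suc j) (Suc a)"] by
        (simp del: replicate_Suc)
  have *: "step M (\<phi> (While j a c # X), tapes_at k x s w) = (\<phi> (c # While j a c # X), tapes_at k x s
      w)"
    using While_step by (subst step_silent) (simp_all add: read_tape_at fst_tape_at del: upt_Suc)
  show ?case unfolding append_assoc[symmetric]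
  proof (rule steps_Suc, unfold *, rule steps_add)
    show "(step M ^^ t) (\<phi> (c # While j a c # X), tapes_at k x s w) =
        (\<phi> (While j a c # X), tapes_at k x s' (w @ v))"
      using While_step.IH(1) X While_step.prems(2) by simp
    show "(step M ^^ t') (\<phi> (While j a c # X), tapes_at k x s' (w @ v)) =
        (\<phi> X, tapes_at k x s'' ((w @ v) @ v'))"
      using While_step.IH(2) While_step.prems by simp
  qed
qed

lemma step_start: "step M (init M x) = (\<phi> [c0], tapes_at k x (\<lambda>_. 0) [])"
proof -
  have i: "init M x = (card (conts c0), map (\<lambda>i. if i = 0 then (tape_of x, 0) else (\<lambda>_. 0, 0))
      [0..<k + 2])"
    unfolding init_def by (simp add: com_tm_def list_eq_iff_nth_eq nth_Cons' nth_append)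
  define tp :: "nat \<Rightarrow> tape" where "tp = (\<lambda>i. if i = 0 then (tape_of x, 0) else (\<lambda>_. 0, 0))"
  have r: "map (\<lambda>(f, h). f h) (map tp [0..<k + 2]) ! i = fst (tp i) (snd (tp i))" if "i < k + 2" for
      i
    using that by (simp add: case_prod_beta del: upt_Suc)
  have "step M (card (conts c0), map tp [0..<k + 2]) = (\<phi> [c0],
      map2 act (map (\<lambda>i. (if i \<in> {1..k} then 1 else map (\<lambda>(f, h). f h) (map tp [0..<k + 2]) ! i,
          MStay)) [0..<k + 2]) (map tp [0..<k + 2]))"
    unfolding step_def using \<phi>_less[OF conts_Nil] by (simp add: com_tm_def del: upt_Suc cong del:
        if_weak_cong)
  also have "\<dots> = (\<phi> [c0], map (\<lambda>i. act (if i \<in> {1..k} then 1 else fst (tp i) (snd (tp i)), MStay)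
      (tp i)) [0..<k + 2])"
    unfolding map2_map_map using r by (simp del: upt_Suc atLeastAtMost_iff)
  also have "(\<lambda>i. act (if i \<in> {1..k} then 1 else fst (tp i) (snd (tp i)), MStay) (tp i)) = tape_at k
      x (\<lambda>_. 0) []"
    by (auto simp: fun_eq_iff tp_def tape_at_def act_pair tape_of_def)
  finally show ?thesis
    unfolding i tp_def[symmetric] tapes_at_def .
qed

lemma run:
  assumes "exec x c0 (\<lambda>_. 0) t w s"
  shows "fst ((step M ^^ Suc t) (init M x)) = halt M \<and> fst
      (last (snd ((step M ^^ Suc t) (init M x)))) = tape_of w"
proof -
  have "(step M ^^ Suc t) (init M x) = (\<phi> [], tapes_at k x s w)"
    using exec_steps[OF assms conts_self regs, of "[]"] by (intro steps_Suc) (simp add: step_start)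
  then show ?thesis by (simp add: com_tm_def tapes_at_def tape_at_def last_map)
qed

end

theorem exec_polytime_computable:
  fixes p :: "nat poly"
  assumes "\<And>x. \<exists>t \<le> poly p (length x). \<exists>s. exec x c (\<lambda>_. 0) t (f x) s"
  shows "polytime_computable f"
proof -
  obtain \<phi> where "bij_betw \<phi> (conts c) {0..<card (conts c)}"
    using ex_bij_betw_finite_nat[OF finite_conts] by blast
  moreover obtain k where "regs c \<subseteq> {..k}"
    using finite_regs[of c] by (auto simp: finite_nat_iff_bounded_le)
  ultimately interpret com_machine k c \<phi>
    by unfold_locales (simp_all add: atLeast0LessThan)
  \<comment> \<open>The additional step is the one that writes the zero markers.\<close>
  have "computes_in_time M f (poly (p + 1))"
    unfolding computes_in_time_def
  proof
    fix x
    obtain t s where "t \<le> poly p (length x)" "exec x c (\<lambda>_. 0) t (f x) s"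
      using assms by blast
    then show "\<exists>t \<le> poly (p + 1) (length x). fst ((step M ^^ t) (init M x)) = halt M \<and>
        fst (last (snd ((step M ^^ t) (init M x)))) = tape_of (f x)"
      by (intro exI[of _ "Suc t"] conjI) (use run in auto)
  qed
  then show ?thesis unfolding polytime_computable_def using wf by blast
qed

section \<open>Polynomially bounded programs\<close>

definition polyb :: "(nat \<Rightarrow> nat) \<Rightarrow> bool" where
  "polyb T \<longleftrightarrow> (\<exists>p. T = poly p)"

lemma polyb_const: "polyb (\<lambda>n. c)"
  unfolding polyb_def by (rule exI[of _ "[:c:]"]) auto

lemma polyb_id: "polyb (\<lambda>n. n)"
  unfolding polyb_def by (rule exI[of _ "[:0, 1:]"]) auto

lemma polyb_add: "polyb f \<Longrightarrow> polyb g \<Longrightarrow> polyb (\<lambda>n. f n + g n)"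
  unfolding polyb_def by (auto simp: fun_eq_iff simp flip: poly_add)

lemma polyb_mult: "polyb f \<Longrightarrow> polyb g \<Longrightarrow> polyb (\<lambda>n. f n * g n)"
  unfolding polyb_def by (auto simp: fun_eq_iff simp flip: poly_mult)

lemma polyb_Suc: "polyb f \<Longrightarrow> polyb (\<lambda>n. Suc (f n))"
  using polyb_add[of f "\<lambda>_. 1"] polyb_const by simp

lemma polyb_comp: "polyb f \<Longrightarrow> polyb g \<Longrightarrow> polyb (\<lambda>n. f (g n))"
  unfolding polyb_def by (auto simp: fun_eq_iff simp flip: poly_pcompose)

lemmas polyb_intros = polyb_const polyb_id polyb_add polyb_mult polyb_Suc

text \<open>Natural coefficients make every polynomial monotone, so a bound may be evaluated at any
  overestimate of the size.\<close>

lemma poly_nat_mono: "a \<le> b \<Longrightarrow> poly p a \<le> poly p (b :: nat)"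
  by (induction p) (auto intro!: add_mono mult_mono)

lemma polyb_mono: "polyb f \<Longrightarrow> a \<le> b \<Longrightarrow> f a \<le> f b"
  unfolding polyb_def using poly_nat_mono by blast

section \<open>Execution within a time bound\<close>

definition runs :: "bool list \<Rightarrow> com \<Rightarrow> (nat \<Rightarrow> nat) \<Rightarrow> nat \<Rightarrow> bool list \<Rightarrow> (nat \<Rightarrow> nat) \<Rightarrow> bool" where
  "runs x c s T w s' \<longleftrightarrow> (\<exists>t \<le> T. exec x c s t w s')"

lemma runs_mono: "runs x c s T w s' \<Longrightarrow> T \<le> T' \<Longrightarrow> runs x c s T' w s'"
  unfolding runs_def using le_trans by blast

lemma runs_Seq: "runs x c s T w s' \<Longrightarrow> runs x d s' T' w' s'' \<Longrightarrow> runs x (Seq c d) s (Suc (T + T'))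
    (w @ w') s''"
  unfolding runs_def using exec.Seq by (meson Suc_le_mono add_mono)

lemma runs_Seq_silent: "runs x c s T [] s' \<Longrightarrow> runs x d s' T' w' s'' \<Longrightarrow> runs x (Seq c d) s
    (Suc (T + T')) w' s''"
  using runs_Seq[of x c s T "[]"] by simp

lemma runs_Skip: "runs x Skip s 1 [] s"
  unfolding runs_def using exec.Skip by blast

lemma runs_Inc: "runs x (Inc j) s 1 [] (s(j := Suc (s j)))"
  unfolding runs_def using exec.Inc by blast

lemma runs_Dec: "0 < s j \<Longrightarrow> runs x (Dec j) s 1 [] (s(j := s j - 1))"
  unfolding runs_def using exec.Dec[of s j "s j - 1"] by auto

lemma runs_Emit: "runs x (Emit b) s 1 [b] s"
  unfolding runs_def using exec.Emit by blast

lemma runs_If_eq: "sym x j (s j) = a \<Longrightarrow> runs x c s T w s' \<Longrightarrow> runs x (If j a c d) s (Suc T) w s'"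
  unfolding runs_def using exec.If_eq by (meson Suc_le_mono)

lemma runs_If_neq: "sym x j (s j) \<noteq> a \<Longrightarrow> runs x d s T w s' \<Longrightarrow> runs x (If j a c d) s (Suc T) w s'"
  unfolding runs_def using exec.If_neq by (meson Suc_le_mono)

lemma runs_While:
  assumes "\<And>i. i < n \<Longrightarrow> sym x j (st i j) \<noteq> a" "sym x j (st n j) = a"
    and "\<And>i. i < n \<Longrightarrow> runs x c (st i) T (w i) (st (Suc i))"
  shows "runs x (While j a c) (st 0) (n * Suc T + 1) (concat (map w [0..<n])) (st n)"
  using assms
proof (induction n arbitrary: st w)
  case 0
  then show ?case using exec.While_end[of x j "st 0" a c] by (auto simp: runs_def)
next
  case (Suc n)
  have "runs x (While j a c) (st (Suc 0)) (n * Suc T + 1) (concat (map (\<lambda>i. w (Suc i)) [0..<n]))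
      (st (Suc n))"
    by (rule Suc.IH[of "\<lambda>i. st (Suc i)"]) (use Suc.prems in auto)
  then obtain t where t: "t \<le> n * Suc T + 1"
    "exec x (While j a c) (st (Suc 0)) t (concat (map (\<lambda>i. w (Suc i)) [0..<n])) (st (Suc n))"
    unfolding runs_def by blast
  obtain t' where t': "t' \<le> T" "exec x c (st 0) t' (w 0) (st (Suc 0))"
    using Suc.prems(3)[of 0] unfolding runs_def by auto
  have "map w [0..<Suc n] = w 0 # map (\<lambda>i. w (Suc i)) [0..<n]"
    by (simp add: upt_conv_Cons map_Suc_upt[symmetric] del: upt_Suc)
  then show ?case
    using exec.While_step[OF _ t'(2) t(2)] Suc.prems(1)[of 0] t(1) t'(1)
    unfolding runs_def by (intro exI[of _ "Suc (t' + t)"]) (simp del: upt_Suc)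
qed

text \<open>A countdown loop: \<open>st\<close> lists the register states between iterations, and
  register \<open>r\<close> shows the zero marker, symbol 1, exactly after \<open>n\<close> of them.
  Register 0 is excluded because symbol 1 on the input tape is a bit.\<close>

lemma runs_loop:
  assumes "0 < r" "\<And>i. i \<le> n \<Longrightarrow> st i r = n - i"
    and "\<And>i. i < n \<Longrightarrow> runs x c (st i) T (w i) (st (Suc i))"
    and "st 0 = s" "st n = s'" "n * Suc T + 1 \<le> T'" "concat (map w [0..<n]) = v"
  shows "runs x (While r 1 c) s T' v s'"
  using runs_mono[OF runs_While[of n x r st 1 c T w]] assms by (auto simp: sym_def)

lemma runs_loop_silent:
  assumes "0 < r" "\<And>i. i \<le> n \<Longrightarrow> st i r = n - i"
    and "\<And>i. i < n \<Longrightarrow> runs x c (st i) T [] (st (Suc i))"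
    and "st 0 = s" "st n = s'" "n * Suc T + 1 \<le> T'"
  shows "runs x (While r 1 c) s T' [] s'"
  by (rule runs_loop[OF assms]) (induction n, simp_all)

abbreviation "move a b \<equiv> While a 1 (Seq (Dec a) (Inc b))"
abbreviation "clear a \<equiv> While a 1 (Dec a)"

lemma runs_cong: "runs x c s T w s1 \<Longrightarrow> s1 = s2 \<Longrightarrow> runs x c s T w s2"
  by simp

lemma runs_move:
  assumes "0 < a" "a \<noteq> b"
  shows "runs x (move a b) s (4 * s a + 1) [] (s(a := 0, b := s b + s a))"
proof (rule runs_loop_silent[where st = "\<lambda>i. s(a := s a - i, b := s b + i)" and n = "s a" and T =
    3])
  fix i assume i: "i < s a"
  have "runs x (Seq (Dec a) (Inc b)) (s(a := s a - i, b := s b + i)) (Suc (1 + 1)) []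
      (s(a := s a - Suc i, b := s b + Suc i))"
    by (rule runs_Seq_silent[OF runs_Dec], use assms i in simp, rule runs_cong[OF runs_Inc], use
        assms in \<open>auto simp: fun_eq_iff\<close>)
  then show "runs x (Seq (Dec a) (Inc b)) (s(a := s a - i, b := s b + i)) 3 []
      (s(a := s a - Suc i, b := s b + Suc i))"
    by (rule runs_mono) simp
qed (use assms in auto)

lemma runs_clear:
  assumes "0 < a"
  shows "runs x (clear a) s (2 * s a + 1) [] (s(a := 0))"
proof (rule runs_loop_silent[where st = "\<lambda>i. s(a := s a - i)" and n = "s a" and T = 1])
  fix i assume i: "i < s a"
  show "runs x (Dec a) (s(a := s a - i)) 1 [] (s(a := s a - Suc i))"
    by (rule runs_cong[OF runs_Dec]) (use i in auto)
qed (use assms in auto)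

text \<open>Arguments are passed in the registers \<open>\<rho>\<close>. Register \<open>r\<close> and all later ones are free, and
  the value is delivered in \<open>r\<close>. Register \<open>0\<close> is the head of the input tape.\<close>

definition frame :: "nat \<Rightarrow> nat list \<Rightarrow> nat \<Rightarrow> bool" where
  "frame k \<rho> r \<longleftrightarrow> length \<rho> = k \<and> 0 < r \<and> (\<forall>q \<in> set \<rho>. 0 < q \<and> q < r)"

definition ready :: "nat \<Rightarrow> (nat \<Rightarrow> nat) \<Rightarrow> bool" where
  "ready r s \<longleftrightarrow> s 0 = 0 \<and> (\<forall>i \<ge> r. s i = 0)"

text \<open>Registers are unary, so arguments contribute their values and not their bit
  lengths.\<close>

abbreviation "isize x e \<equiv> length x + sum_list (e :: nat list)"

definition poly_valued :: "nat \<Rightarrow> (bool list \<Rightarrow> nat list \<Rightarrow> nat) \<Rightarrow> bool" where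
  "poly_valued k f \<longleftrightarrow> (\<exists>V. polyb V \<and> (\<forall>x e. length e = k \<longrightarrow> f x e \<le> V (isize x e)))"

text \<open>The final state differs from \<open>s\<close> at most in \<open>r\<close>: scratch
  registers are cleared, arguments restored and the input head returned, so that programs can follow
  one another.\<close>

definition computes :: "(bool list \<Rightarrow> nat list \<Rightarrow> nat) \<Rightarrow> nat list \<Rightarrow> nat \<Rightarrow> com \<Rightarrow> (nat \<Rightarrow> nat) \<Rightarrow> bool"
    where
  "computes f \<rho> r c T \<longleftrightarrow> (\<forall>x s. ready r s \<longrightarrow>
     runs x c s (T (isize x (map s \<rho>))) [] (s(r := f x (map s \<rho>))))"

text \<open>The value bound is carried along because values become loop counts and arguments of
  later programs.\<close>

definition computable :: "nat \<Rightarrow> (bool list \<Rightarrow> nat list \<Rightarrow> nat) \<Rightarrow> bool" where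
  "computable k f \<longleftrightarrow> poly_valued k f \<and>
     (\<forall>\<rho> r. frame k \<rho> r \<longrightarrow> (\<exists>c T. polyb T \<and> computes f \<rho> r c T))"

lemma computesI: "computes f \<rho> r c T \<Longrightarrow> polyb T \<Longrightarrow> \<exists>c T. polyb T \<and> computes f \<rho> r c T"
  by blast

lemma computableI:
  assumes "polyb V" "\<And>x e. length e = k \<Longrightarrow> f x e \<le> V (isize x e)"
    and "\<And>\<rho> r. frame k \<rho> r \<Longrightarrow> \<exists>c T. polyb T \<and> computes f \<rho> r c T"
  shows "computable k f"
  using assms unfolding computable_def poly_valued_def by blast

lemma computableE:
  assumes "computable k f"
  obtains V where "polyb V" "\<And>x e. length e = k \<Longrightarrow> f x e \<le> V (isize x e)"
  using assms unfolding computable_def poly_valued_def by blast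

lemma computable_progE:
  assumes "computable k f" "frame k \<rho> r"
  obtains c T where "polyb T" "computes f \<rho> r c T"
  using assms unfolding computable_def by blast

lemma map_upd_frame: "frame k \<rho> r \<Longrightarrow> r \<le> j \<Longrightarrow> map (s(j := v)) \<rho> = map s \<rho>"
  by (auto simp: frame_def)

lemma frame_Suc: "frame k \<rho> r \<Longrightarrow> frame k \<rho> (Suc r)"
  by (auto simp: frame_def)

section \<open>Arithmetic by counter programs\<close>

lemma computable_zero: "computable k (\<lambda>x e. 0)"
proof (rule computableI[where V = "\<lambda>_. 0"])
  show "\<exists>c T. polyb T \<and> computes (\<lambda>x e. 0) \<rho> r c T" if "frame k \<rho> r" for \<rho> r
  proof (intro exI conjI)
    show "computes (\<lambda>x e. 0) \<rho> r Skip (\<lambda>_. 1)"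
      unfolding computes_def by (auto simp: ready_def fun_upd_idem runs_Skip[unfolded One_nat_def])
  qed (intro polyb_intros)
qed (auto intro: polyb_intros)

lemma computable_Suc:
  assumes "computable k f"
  shows "computable k (\<lambda>x e. Suc (f x e))"
proof -
  obtain V where V: "polyb V" "\<And>x e. length e = k \<Longrightarrow> f x e \<le> V (isize x e)"
    using computableE[OF assms] by blast
  show ?thesis
  proof (rule computableI[where V = "\<lambda>n. Suc (V n)"])
    show "\<exists>c T. polyb T \<and> computes (\<lambda>x e. Suc (f x e)) \<rho> r c T" if fr: "frame k \<rho> r" for \<rho> r
    proof -
      obtain c T where c: "polyb T" "computes f \<rho> r c T" using computable_progE[OF assms fr] .
      show ?thesis
      proof (intro exI conjI)
        show "computes (\<lambda>x e. Suc (f x e)) \<rho> r (Seq c (Inc r)) (\<lambda>n. Suc (T n + 1))"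
          unfolding computes_def
          by (intro allI impI, rule runs_Seq_silent, rule c(2)[unfolded computes_def, rule_format],
              assumption,
              rule runs_cong[OF runs_Inc]) simp
      qed (intro polyb_intros c(1))
    qed
  qed (use V in \<open>auto intro: polyb_intros\<close>)
qed

lemma computable_const: "computable k (\<lambda>x e. n)"
  by (induction n) (auto intro: computable_zero computable_Suc)

text \<open>Counting down a register empties it, so its value is moved to \<open>r\<close> and
  \<open>Suc r\<close> at once and then restored from \<open>Suc r\<close>.\<close>

lemma computable_var:
  assumes "i < k"
  shows "computable k (\<lambda>x e. e ! i)"
proof (rule computableI[where V = "\<lambda>n. n"])
  show "e ! i \<le> isize x e" if "length e = k" for x e
    using member_le_sum_list[of "e ! i" e] assms that by (simp add: trans_le_add2)
  fix \<rho> r assume fr: "frame k \<rho> r"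
  define a where "a = \<rho> ! i"
  have a: "0 < a" "a < r" "a \<in> set \<rho>" using fr assms by (auto simp: frame_def a_def)
  have "computes (\<lambda>x e. e ! i) \<rho> r (Seq (While a 1 (Seq (Dec a) (Seq (Inc r) (Inc (Suc r)))))
      (move (Suc r) a))
     (\<lambda>n. 10 * n + 3)"
    unfolding computes_def
  proof (intro allI impI)
    fix x :: "bool list" and s assume rd: "ready r s"
    define s1 where "s1 = s(a := 0, r := s a, Suc r := s a)"
    have ri: "map s \<rho> ! i = s a" using fr assms by (simp add: frame_def a_def)
    have sa: "s a \<le> isize x (map s \<rho>)" using member_le_sum_list[of "s a" "map s \<rho>"] a(3) by simp
    have 1: "runs x (While a 1 (Seq (Dec a) (Seq (Inc r) (Inc (Suc r))))) s (6 * s a + 1) [] s1"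
    proof (rule runs_loop_silent[where st = "\<lambda>i. s(a := s a - i, r := i, Suc r := i)" and n = "s a"
        and T = 5])
      fix i assume i: "i < s a"
      have "runs x (Seq (Dec a) (Seq (Inc r) (Inc (Suc r)))) (s(a := s a - i, r := i, Suc r := i))
          (Suc (1 + Suc (1 + 1))) []
         (s(a := s a - Suc i, r := Suc i, Suc r := Suc i))"
        by (rule runs_Seq_silent[OF runs_Dec], use a i in simp, rule runs_Seq_silent[OF runs_Inc],
            rule runs_cong[OF runs_Inc]) (use a in \<open>auto simp: fun_eq_iff\<close>)
      then show "runs x (Seq (Dec a) (Seq (Inc r) (Inc (Suc r))))
          (s(a := s a - i, r := i, Suc r := i)) 5 []
         (s(a := s a - Suc i, r := Suc i, Suc r := Suc i))" by (rule runs_mono) simp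
    qed (use a rd in \<open>auto simp: s1_def ready_def fun_eq_iff\<close>)
    have 2: "runs x (move (Suc r) a) s1 (4 * s a + 1) [] (s(r := s a))"
      using runs_move[of "Suc r" a x s1] a rd by (auto simp: s1_def ready_def fun_upd_twist
          fun_upd_idem)
    show "runs x (Seq (While a 1 (Seq (Dec a) (Seq (Inc r) (Inc (Suc r))))) (move (Suc r) a)) s
       (10 * isize x (map s \<rho>) + 3) [] (s(r := map s \<rho> ! i))"
      unfolding ri by (rule runs_mono[OF runs_Seq_silent[OF 1 2]]) (use sa in simp)
  qed
  then show "\<exists>c T. polyb T \<and> computes (\<lambda>x e. e ! i) \<rho> r c T"
    by (rule computesI) (intro polyb_intros)
qed (rule polyb_intros)

text \<open>Bound variables are appended at the end, so an old function sees a prefix of the longer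
  environment.\<close>

lemma computable_weaken:
  assumes "computable k f"
  shows "computable (Suc k) (\<lambda>x e. f x (take k e))"
proof -
  obtain V where V: "polyb V" "\<And>x e. length e = k \<Longrightarrow> f x e \<le> V (isize x e)"
    using computableE[OF assms] by blast
  have le: "isize x (take k e) \<le> isize x e" for x :: "bool list" and e
    using sum_list_append[of "take k e" "drop k e"] by simp
  show ?thesis
  proof (rule computableI[OF V(1)])
    show "f x (take k e) \<le> V (isize x e)" if "length e = Suc k" for x e
      using V(2)[of "take k e"] polyb_mono[OF V(1) le] that by
          (metis le_trans length_take min.absorb2 le_SucI order_refl)
    fix \<rho> r assume "frame (Suc k) \<rho> r"
    then have "frame k (take k \<rho>) r" by (auto simp: frame_def dest: in_set_takeD)
    then obtain c T where c: "polyb T" "computes f (take k \<rho>) r c T" using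
        computable_progE[OF assms] by blast
    then have "computes (\<lambda>x e. f x (take k e)) \<rho> r c T"
      unfolding computes_def take_map[symmetric] using runs_mono polyb_mono[OF c(1) le] by blast
    then show "\<exists>c T. polyb T \<and> computes (\<lambda>x e. f x (take k e)) \<rho> r c T" using c(1) by blast
  qed
qed

text \<open>The program for \<open>g\<close> runs one register higher, where the value of
  \<open>f\<close> in \<open>r\<close> is protected.\<close>

lemma computable_add:
  assumes "computable k f" "computable k g"
  shows "computable k (\<lambda>x e. f x e + g x e)"
proof -
  obtain V where V: "polyb V" "\<And>x e. length e = k \<Longrightarrow> f x e \<le> V (isize x e)"
    using computableE[OF assms(1)] by blast
  obtain W where W: "polyb W" "\<And>x e. length e = k \<Longrightarrow> g x e \<le> W (isize x e)"
    using computableE[OF assms(2)] by blast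
  show ?thesis
  proof (rule computableI[where V = "\<lambda>n. V n + W n"])
    fix \<rho> r assume fr: "frame k \<rho> r"
    obtain c T where c: "polyb T" "computes f \<rho> r c T" using computable_progE[OF assms(1) fr] .
    obtain d U where d: "polyb U" "computes g \<rho> (Suc r) d U" using
        computable_progE[OF assms(2) frame_Suc[OF fr]] .
    have "computes (\<lambda>x e. f x e + g x e) \<rho> r (Seq c (Seq d (move (Suc r) r)))
        (\<lambda>n. Suc (T n + Suc (U n + (4 * W n + 1))))"
      unfolding computes_def
    proof (intro allI impI, rule runs_Seq_silent, rule c(2)[unfolded computes_def, rule_format],
        assumption)
      fix x s assume rd: "ready r s"
      let ?e = "map s \<rho>" let ?s = "s(r := f x ?e)"
      have len: "length ?e = k" using fr by (simp add: frame_def)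
      have "runs x d ?s (U (isize x ?e)) [] (?s(Suc r := g x ?e))"
        using d(2)[unfolded computes_def, rule_format, of ?s x] rd fr
        by (simp add: ready_def frame_def map_upd_frame[OF fr])
      moreover have "runs x (move (Suc r) r) (?s(Suc r := g x ?e)) (4 * g x ?e + 1) []
          (s(r := f x ?e + g x ?e))"
        using runs_move[of "Suc r" r x "?s(Suc r := g x ?e)"] rd by
            (auto simp: ready_def fun_upd_twist fun_upd_idem)
      then have "runs x (move (Suc r) r) (?s(Suc r := g x ?e)) (4 * W (isize x ?e) + 1) []
          (s(r := f x ?e + g x ?e))"
        by (rule runs_mono) (use W(2)[OF len, of x] in simp)
      ultimately show "runs x (Seq d (move (Suc r) r)) ?s
          (Suc (U (isize x ?e) + (4 * W (isize x ?e) + 1))) [] (s(r := f x ?e + g x ?e))"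
        by (rule runs_Seq_silent)
    qed
    then show "\<exists>c T. polyb T \<and> computes (\<lambda>x e. f x e + g x e) \<rho> r c T"
      by (rule computesI) (intro polyb_intros c d V W)
  qed (use V W in \<open>auto intro: polyb_intros add_mono\<close>)
qed

lemma computable_diff:
  assumes "computable k f" "computable k g"
  shows "computable k (\<lambda>x e. f x e - g x e)"
proof -
  obtain V where V: "polyb V" "\<And>x e. length e = k \<Longrightarrow> f x e \<le> V (isize x e)"
    using computableE[OF assms(1)] by blast
  obtain W where W: "polyb W" "\<And>x e. length e = k \<Longrightarrow> g x e \<le> W (isize x e)"
    using computableE[OF assms(2)] by blast
  show ?thesis
  proof (rule computableI[OF V(1)])
    show "f x e - g x e \<le> V (isize x e)" if "length e = k" for x e
      using V(2)[OF that] by (meson diff_le_self le_trans)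
    fix \<rho> r assume fr: "frame k \<rho> r"
    obtain c T where c: "polyb T" "computes f \<rho> r c T" using computable_progE[OF assms(1) fr] .
    obtain d U where d: "polyb U" "computes g \<rho> (Suc r) d U" using
        computable_progE[OF assms(2) frame_Suc[OF fr]] .
    \<comment> \<open>Skipping at zero makes the repeated decrement truncate, as subtraction of
      natural numbers does.\<close>
    define m where "m = While (Suc r) 1 (Seq (If r 1 Skip (Dec r)) (Dec (Suc r)))"
    have m: "runs x m s (5 * s (Suc r) + 1) [] (s(r := s r - s (Suc r), Suc r := 0))" for x s
      unfolding m_def
    proof (rule runs_loop_silent[where st = "\<lambda>i. s(r := s r - i, Suc r := s (Suc r) - i)" and n = "s
        (Suc r)" and T = 4])
      fix i assume i: "i < s (Suc r)"
      let ?s = "s(r := s r - i, Suc r := s (Suc r) - i)"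
      have "runs x (If r 1 Skip (Dec r)) ?s (Suc 1) [] (?s(r := s r - Suc i))"
      proof (cases "s r - i = 0")
        case True
        then show ?thesis using fr
          by (intro runs_If_eq) (auto simp: frame_def sym_def intro!:
              runs_cong[OF runs_Skip[unfolded One_nat_def]])
      next
        case False
        then show ?thesis using fr
          by (intro runs_If_neq) (auto simp: frame_def sym_def intro!:
              runs_cong[OF runs_Dec[unfolded One_nat_def]])
      qed
      then have "runs x (Seq (If r 1 Skip (Dec r)) (Dec (Suc r))) ?s (Suc (Suc 1 + 1)) []
         (s(r := s r - Suc i, Suc r := s (Suc r) - Suc i))"
        by (rule runs_Seq_silent) (rule runs_cong[OF runs_Dec], use i in \<open>auto simp: fun_eq_iff\<close>)
      then show "runs x (Seq (If r 1 Skip (Dec r)) (Dec (Suc r))) ?s 4 []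
         (s(r := s r - Suc i, Suc r := s (Suc r) - Suc i))" by (rule runs_mono) simp
    qed auto
    have "computes (\<lambda>x e. f x e - g x e) \<rho> r (Seq c (Seq d m))
        (\<lambda>n. Suc (T n + Suc (U n + (5 * W n + 1))))"
      unfolding computes_def
    proof (intro allI impI, rule runs_Seq_silent, rule c(2)[unfolded computes_def, rule_format],
        assumption)
      fix x s assume rd: "ready r s"
      let ?e = "map s \<rho>" let ?s = "s(r := f x ?e)"
      have len: "length ?e = k" using fr by (simp add: frame_def)
      have "runs x d ?s (U (isize x ?e)) [] (?s(Suc r := g x ?e))"
        using d(2)[unfolded computes_def, rule_format, of ?s x] rd fr
        by (simp add: ready_def frame_def map_upd_frame[OF fr])
      moreover have "runs x m (?s(Suc r := g x ?e)) (5 * g x ?e + 1) [] (s(r := f x ?e - g x ?e))"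
        using m[of x "?s(Suc r := g x ?e)"] rd by (auto simp: ready_def fun_upd_twist fun_upd_idem)
      then have "runs x m (?s(Suc r := g x ?e)) (5 * W (isize x ?e) + 1) []
          (s(r := f x ?e - g x ?e))"
        by (rule runs_mono) (use W(2)[OF len, of x] in simp)
      ultimately show "runs x (Seq d m) ?s (Suc (U (isize x ?e) + (5 * W (isize x ?e) + 1))) []
          (s(r := f x ?e - g x ?e))"
        by (rule runs_Seq_silent)
    qed
    then show "\<exists>c T. polyb T \<and> computes (\<lambda>x e. f x e - g x e) \<rho> r c T"
      by (rule computesI) (intro polyb_intros c d V W)
  qed
qed

text \<open>Products and quotients are obtained from this loop. The index stays below
  \<open>f x e\<close>, hence below the bound \<open>V n\<close>, so the body sees arguments of size
  at most \<open>n + V n\<close>, and polynomials are closed under this substitution.\<close>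

lemma computable_sum:
  assumes "computable k f" "computable (Suc k) g"
  shows "computable k (\<lambda>x e. \<Sum>i<f x e. g x (e @ [i]))"
proof -
  obtain V where V: "polyb V" "\<And>x e. length e = k \<Longrightarrow> f x e \<le> V (isize x e)"
    using computableE[OF assms(1)] by blast
  obtain W where W: "polyb W" "\<And>x e. length e = Suc k \<Longrightarrow> g x e \<le> W (isize x e)"
    using computableE[OF assms(2)] by blast
  have W': "g x (e @ [i]) \<le> W (isize x e + V (isize x e))" if "length e = k" "i < f x e" for x e i
  proof -
    have "isize x (e @ [i]) \<le> isize x e + V (isize x e)" using V(2)[OF that(1), of x] that(2) by
        simp
    moreover have "g x (e @ [i]) \<le> W (isize x (e @ [i]))" by (rule W(2)) (use that(1) in simp)
    ultimately show ?thesis using polyb_mono[OF W(1)] le_trans by blast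
  qed
  have sum_le: "(\<Sum>i<j. g x (e @ [i])) \<le> V (isize x e) * W (isize x e + V (isize x e))"
    if "length e = k" "j \<le> f x e" for x e j
  proof -
    have "(\<Sum>i<j. g x (e @ [i])) \<le> j * W (isize x e + V (isize x e))"
      using sum_bounded_above[of "{..<j}" "\<lambda>i. g x (e @ [i])" "W (isize x e + V (isize x e))"]
          W'[OF that(1)] that(2) by simp
    also have "\<dots> \<le> V (isize x e) * W (isize x e + V (isize x e))"
      using V(2)[OF that(1), of x] that(2) by simp
    finally show ?thesis .
  qed
  have polyW: "polyb (\<lambda>n. W (n + V n))" by (rule polyb_comp[OF W(1)]) (intro polyb_intros V)
  show ?thesis
  proof (rule computableI[where V = "\<lambda>n. V n * W (n + V n)"])
    show "polyb (\<lambda>n. V n * W (n + V n))" by (intro polyb_intros V polyW)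
    show "(\<Sum>i<f x e. g x (e @ [i])) \<le> V (isize x e) * W (isize x e + V (isize x e))" if "length e =
        k" for x e
      using sum_le[OF that] by blast
    fix \<rho> r assume fr: "frame k \<rho> r"
    \<comment> \<open>\<open>r\<close> counts the remaining rounds, \<open>?i\<close> is the
      summation index passed to \<open>g\<close>, \<open>?a\<close> accumulates, and
      \<open>?t\<close> receives the value of the body.\<close>
    let ?i = "Suc r" and ?a = "r + 2" and ?t = "r + 3"
    have fr': "frame (Suc k) (\<rho> @ [?i]) ?t" using fr by (auto simp: frame_def)
    obtain c T where c: "polyb T" "computes f \<rho> r c T" using computable_progE[OF assms(1) fr] .
    obtain d U where d: "polyb U" "computes g (\<rho> @ [?i]) ?t d U" using
        computable_progE[OF assms(2) fr'] .
    define body where "body = Seq d (Seq (move ?t ?a) (Seq (Inc ?i) (Dec r)))"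
    define tail where "tail = Seq (clear ?i) (move ?a r)"
    define B where "B n = Suc (U (n + V n) + Suc (4 * W (n + V n) + 1 + Suc (1 + 1)))" for n
    define T' where "T' n = Suc (T n + Suc (V n * Suc (B n) + 1 + Suc
        (2 * V n + 1 + (4 * (V n * W (n + V n)) + 1))))" for n
    have "computes (\<lambda>x e. \<Sum>i<f x e. g x (e @ [i])) \<rho> r (Seq c (Seq (While r 1 body) tail)) T'"
      unfolding computes_def T'_def
    proof (intro allI impI, rule runs_Seq_silent, rule c(2)[unfolded computes_def, rule_format],
        assumption, rule runs_Seq_silent)
      fix x :: "bool list" and s assume rd: "ready r s"
      define e where "e = map s \<rho>"
      define S where "S j = (\<Sum>i<j. g x (e @ [i]))" for j
      define st where "st i = s(r := f x e - i, ?i := i, ?a := S i)" for i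
      have len: "length e = k" using fr by (simp add: frame_def e_def)
      have st: "map (st i) \<rho> = e" for i
        using fr by (auto simp: st_def e_def frame_def)
      show "runs x (While r 1 body) (s(r := f x (map s \<rho>)))
          (V (isize x (map s \<rho>)) * Suc (B (isize x (map s \<rho>))) + 1) [] (st (f x e))"
        unfolding e_def[symmetric]
      proof (rule runs_loop_silent[where st = st and n = "f x e"])
        show "0 < r" using fr by (simp add: frame_def)
        show "st i r = f x e - i" for i by (simp add: st_def)
        show "st 0 = s(r := f x e)" using rd by (auto simp: st_def S_def ready_def fun_upd_idem
            fun_upd_twist)
        show "f x e * Suc (B (isize x e)) + 1 \<le> V (isize x e) * Suc (B (isize x e)) + 1"
          by (intro add_mono mult_le_mono order_refl V(2)[OF len])
        fix i assume i: "i < f x e"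
        have e': "map (st i) (\<rho> @ [?i]) = e @ [i]" using st by (simp add: st_def)
        have 1: "runs x d (st i) (U (isize x e + V (isize x e))) [] ((st i)(?t := g x (e @ [i])))"
        proof (rule runs_mono)
          show "runs x d (st i) (U (isize x (e @ [i]))) [] ((st i)(?t := g x (e @ [i])))"
            using d(2)[unfolded computes_def, rule_format, of "st i" x, unfolded e'] rd fr
            by (simp add: ready_def st_def frame_def)
          show "U (isize x (e @ [i])) \<le> U (isize x e + V (isize x e))"
            using V(2)[OF len, of x] i by (intro polyb_mono[OF d(1)]) simp
        qed
        have 2: "runs x (move ?t ?a) ((st i)(?t := g x (e @ [i])))
            (4 * W (isize x e + V (isize x e)) + 1) []
           (s(r := f x e - i, ?i := i, ?a := S (Suc i)))"
        proof (rule runs_mono)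
          show "runs x (move ?t ?a) ((st i)(?t := g x (e @ [i]))) (4 * g x (e @ [i]) + 1) []
            (s(r := f x e - i, ?i := i, ?a := S (Suc i)))"
            using runs_move[of ?t ?a x "(st i)(?t := g x (e @ [i]))"] rd
            by (auto simp: st_def ready_def S_def fun_upd_twist fun_upd_idem)
          show "4 * g x (e @ [i]) + 1 \<le> 4 * W (isize x e + V (isize x e)) + 1" using W'[OF len i] by
              simp
        qed
        have 3: "runs x (Seq (Inc ?i) (Dec r)) (s(r := f x e - i, ?i := i, ?a := S (Suc i)))
            (Suc (1 + 1)) [] (st (Suc i))"
          by (rule runs_Seq_silent[OF runs_Inc], rule runs_cong[OF runs_Dec])
              (use i in \<open>auto simp: st_def fun_eq_iff\<close>)
        show "runs x body (st i) (B (isize x e)) [] (st (Suc i))"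
          unfolding body_def B_def by (rule runs_Seq_silent[OF 1 runs_Seq_silent[OF 2 3]])
      qed simp
      have 1: "runs x (clear ?i) (st (f x e)) (2 * V (isize x e) + 1) []
          (s(r := 0, ?a := S (f x e)))"
      proof (rule runs_mono)
        show "runs x (clear ?i) (st (f x e)) (2 * f x e + 1) [] (s(r := 0, ?a := S (f x e)))"
          using runs_clear[of ?i x "st (f x e)"] rd by (auto simp: st_def ready_def fun_upd_twist
              fun_upd_idem)
      qed (use V(2)[OF len, of x] in simp)
      have 2: "runs x (move ?a r) (s(r := 0, ?a := S (f x e)))
          (4 * (V (isize x e) * W (isize x e + V (isize x e))) + 1) [] (s(r := S (f x e)))"
      proof (rule runs_mono)
        show "runs x (move ?a r) (s(r := 0, ?a := S (f x e))) (4 * S (f x e) + 1) []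
            (s(r := S (f x e)))"
          using runs_move[of ?a r x "s(r := 0, ?a := S (f x e))"] rd
          by (auto simp: ready_def fun_upd_twist fun_upd_idem)
        show "4 * S (f x e) + 1 \<le> 4 * (V (isize x e) * W (isize x e + V (isize x e))) + 1"
          using sum_le[OF len, of "f x e" x] by (simp add: S_def)
      qed
      show "runs x tail (st (f x e)) (Suc (2 * V (isize x (map s \<rho>)) + 1 +
          (4 * (V (isize x (map s \<rho>)) *
           W (isize x (map s \<rho>) + V (isize x (map s \<rho>)))) + 1))) []
               (s(r := \<Sum>i<f x (map s \<rho>). g x (map s \<rho> @ [i])))"
        unfolding e_def[symmetric] S_def[symmetric] tail_def by (rule runs_Seq_silent[OF 1 2])
    qed
    moreover have "polyb T'"
      unfolding T'_def B_def by (intro polyb_intros c V polyW polyb_comp[OF d(1)])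
    ultimately show "\<exists>c T. polyb T \<and> computes (\<lambda>x e. \<Sum>i<f x e. g x (e @ [i])) \<rho> r c T"
      by (rule computesI)
  qed
qed

lemma computable_cong:
  assumes "\<And>x e. length e = k \<Longrightarrow> f x e = g x e" and "computable k f"
  shows "computable k g"
proof -
  have "computes f \<rho> r c T \<longleftrightarrow> computes g \<rho> r c T" if "frame k \<rho> r" for \<rho> r c T
    using assms(1) that by (simp add: computes_def frame_def)
  moreover have "poly_valued k f \<longleftrightarrow> poly_valued k g"
    using assms(1) by (simp add: poly_valued_def)
  ultimately show ?thesis
    using assms(2) unfolding computable_def by simp
qed

lemma computable_mult:
  assumes "computable k f" "computable k g"
  shows "computable k (\<lambda>x e. f x e * g x e)"
  by (rule computable_cong[OF _ computable_sum[OF assms(1) computable_weaken[OF assms(2)]]]) simp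

text \<open>For positive \<open>b\<close> the sum counts the positive multiples of \<open>b\<close>
  up to \<open>a\<close>. The last factor is 0 exactly for \<open>b = 0\<close>, in agreement with
  division by zero.\<close>

lemma div_eq_sum: "(a::nat) div b = (\<Sum>i<a. 1 - (Suc i * b - a)) * (1 - (1 - b))"
proof (cases "b = 0")
  case False
  have "1 - (Suc i * b - a) = (if i < a div b then 1 else 0)" for i
  proof -
    have "i < a div b \<longleftrightarrow> Suc i * b \<le> a"
      using False less_eq_div_iff_mult_less_eq[of b "Suc i" a] by (simp add: Suc_le_eq)
    then show ?thesis by simp
  qed
  then have "(\<Sum>i<a. 1 - (Suc i * b - a)) = (\<Sum>i<a. if i < a div b then 1 else 0)" by presburger
  also have "\<dots> = card {i \<in> {..<a}. i < a div b}" by (simp add: sum.If_cases Int_def)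
  also have "{i \<in> {..<a}. i < a div b} = {..<a div b}"
    using div_le_dividend[of a b] by (auto intro: less_le_trans)
  finally show ?thesis using False by simp
qed simp

lemma computable_div:
  assumes "computable k f" "computable k g"
  shows "computable k (\<lambda>x e. f x e div g x e)"
proof -
  have "computable (Suc k) (\<lambda>x e. 1 - (Suc (e ! k) * g x (take k e) - f x (take k e)))"
    by (intro computable_diff computable_mult computable_const computable_Suc computable_var
        computable_weaken assms) simp
  from computable_mult[OF computable_sum[OF assms(1) this]
      computable_diff[OF computable_const[of k 1] computable_diff[OF computable_const[of k 1]
          assms(2)]]]
  show ?thesis
    by (rule computable_cong[rotated]) (auto simp: div_eq_sum nth_append)
qed

lemma computable_length: "computable k (\<lambda>x e. length x)"
proof (rule computableI[where V = "\<lambda>n. n"])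
  fix \<rho> r assume fr: "frame k \<rho> r"
  then have r: "0 < r" by (simp add: frame_def)
  \<comment> \<open>Symbol 0 is the blank behind the last input bit. The second copy of the
    distance, in \<open>Suc r\<close>, later brings the head back.\<close>
  define c where "c = While 0 0 (Seq (Inc 0) (Seq (Inc r) (Inc (Suc r))))"
  define d where "d = While (Suc r) 1 (Seq (Dec (Suc r)) (Dec 0))"
  have "computes (\<lambda>x e. length x) \<rho> r (Seq c d) (\<lambda>n. Suc (n * 6 + 1 + (n * 4 + 1)))"
    unfolding computes_def
  proof (intro allI impI)
    fix x :: "bool list" and s assume rd: "ready r s"
    let ?n = "length x"
    define st where "st i = s(0 := i, r := i, Suc r := i)" for i
    have "runs x (While 0 0 (Seq (Inc 0) (Seq (Inc r) (Inc (Suc r))))) (st 0) (?n * Suc 5 + 1)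
        (concat (map (\<lambda>_. []) [0..<?n])) (st ?n)"
    proof (rule runs_While)
      fix i
      have "runs x (Seq (Inc 0) (Seq (Inc r) (Inc (Suc r)))) (st i) (Suc (1 + Suc (1 + 1))) []
          (st (Suc i))"
        by (rule runs_Seq_silent[OF runs_Inc], rule runs_Seq_silent[OF runs_Inc], rule
            runs_cong[OF runs_Inc])
           (use r in \<open>auto simp: st_def fun_eq_iff\<close>)
      then show "runs x (Seq (Inc 0) (Seq (Inc r) (Inc (Suc r)))) (st i) 5 [] (st (Suc i))"
        by (rule runs_mono) simp
    qed (use r in \<open>auto simp: st_def sym_def tape_of_def\<close>)
    moreover have "st 0 = s" using rd by (auto simp: st_def ready_def fun_eq_iff)
    moreover have "concat (map (\<lambda>_. [] :: bool list) [0..<?n]) = []" by (induction ?n) auto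
    ultimately have 1: "runs x c s (?n * 6 + 1) [] (st ?n)" by (simp add: c_def)
    have 2: "runs x d (st ?n) (?n * 4 + 1) [] (s(r := ?n))"
      unfolding d_def
    proof (rule runs_loop_silent[where st = "\<lambda>i. s(0 := ?n - i, r := ?n, Suc r := ?n - i)" and n =
        ?n and T = 3])
      fix i assume i: "i < ?n"
      have "runs x (Seq (Dec (Suc r)) (Dec 0)) (s(0 := ?n - i, r := ?n, Suc r := ?n - i))
          (Suc (1 + 1)) []
          (s(0 := ?n - Suc i, r := ?n, Suc r := ?n - Suc i))"
        by (rule runs_Seq_silent[OF runs_Dec], use i in simp, rule runs_cong[OF runs_Dec])
           (use r i in \<open>auto simp: fun_eq_iff\<close>)
      then show "runs x (Seq (Dec (Suc r)) (Dec 0)) (s(0 := ?n - i, r := ?n, Suc r := ?n - i)) 3 []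
          (s(0 := ?n - Suc i, r := ?n, Suc r := ?n - Suc i))" by (rule runs_mono) simp
    qed (use rd in \<open>auto simp: st_def ready_def fun_eq_iff\<close>)
    show "runs x (Seq c d) s (Suc (isize x (map s \<rho>) * 6 + 1 + (isize x (map s \<rho>) * 4 + 1))) []
        (s(r := ?n))"
      by (rule runs_mono[OF runs_Seq_silent[OF 1 2]]) simp
  qed
  then show "\<exists>c T. polyb T \<and> computes (\<lambda>x e. length x) \<rho> r c T"
    by (rule computesI) (intro polyb_intros)
qed (auto intro: polyb_intros)

text \<open>The input head walks to the queried position, leaving a copy of the distance in
  \<open>Suc r\<close> for the way back; two nested tests store the symbol in \<open>r\<close>.
  Positions behind the input yield the blank 0.\<close>

lemma computable_symbol:
  assumes "computable k f"
  shows "computable k (\<lambda>x e. tape_of x (int (f x e)))"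
proof (rule computableI[where V = "\<lambda>n. 2"])
  obtain V where V: "polyb V" "\<And>x e. length e = k \<Longrightarrow> f x e \<le> V (isize x e)"
    using computableE[OF assms(1)] by blast
  show "tape_of x (int (f x e)) \<le> 2" for x e by (simp add: tape_of_def)
  fix \<rho> r assume fr: "frame k \<rho> r"
  then have r: "0 < r" by (simp add: frame_def)
  obtain c T where c: "polyb T" "computes f \<rho> r c T" using computable_progE[OF assms(1) fr] .
  define go where "go = While r 1 (Seq (Dec r) (Seq (Inc 0) (Inc (Suc r))))"
  define test where "test = If 0 0 Skip (Seq (Inc r) (If 0 1 Skip (Inc r)))"
  define ret where "ret = While (Suc r) 1 (Seq (Dec (Suc r)) (Dec 0))"
  have "computes (\<lambda>x e. tape_of x (int (f x e))) \<rho> r (Seq c (Seq go (Seq test ret)))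
    (\<lambda>n. Suc (T n + Suc (V n * 6 + 1 + Suc (5 + (V n * 4 + 1)))))"
    unfolding computes_def
  proof (intro allI impI, rule runs_Seq_silent, rule c(2)[unfolded computes_def, rule_format],
      assumption)
    fix x :: "bool list" and s assume rd: "ready r s"
    define e where "e = map s \<rho>"
    let ?n = "f x e" let ?y = "tape_of x (int ?n)"
    have len: "length e = k" using fr by (simp add: frame_def e_def)
    have n: "?n \<le> V (isize x e)" using V(2)[OF len] .
    have 1: "runs x go (s(r := ?n)) (V (isize x e) * 6 + 1) [] (s(0 := ?n, Suc r := ?n))"
      unfolding go_def
    proof (rule runs_loop_silent[where st = "\<lambda>i. s(0 := i, r := ?n - i, Suc r := i)" and n = ?n and
        T = 5])
      fix i assume i: "i < ?n"
      have "runs x (Seq (Dec r) (Seq (Inc 0) (Inc (Suc r)))) (s(0 := i, r := ?n - i, Suc r := i))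
          (Suc (1 + Suc (1 + 1))) []
         (s(0 := Suc i, r := ?n - Suc i, Suc r := Suc i))"
        by (rule runs_Seq_silent[OF runs_Dec], use i in simp, rule runs_Seq_silent[OF runs_Inc],
            rule runs_cong[OF runs_Inc])
           (use r in \<open>auto simp: fun_eq_iff\<close>)
      then show "runs x (Seq (Dec r) (Seq (Inc 0) (Inc (Suc r))))
          (s(0 := i, r := ?n - i, Suc r := i)) 5 []
         (s(0 := Suc i, r := ?n - Suc i, Suc r := Suc i))" by (rule runs_mono) simp
    qed (use rd r n in \<open>auto simp: ready_def fun_eq_iff\<close>)
    have y: "sym x 0 ?n = ?y" by (simp add: sym_def)
    let ?s = "s(0 := ?n, Suc r := ?n)"
    have 2: "runs x test ?s 5 [] (?s(r := ?y))"
    proof -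
      consider "?y = 0" | "?y = 1" | "?y = 2" unfolding tape_of_def by presburger
      then show ?thesis
      proof cases
        case 1
        have "runs x test ?s (Suc 1) [] ?s"
          unfolding test_def by (rule runs_If_eq[OF _ runs_Skip]) (use 1 y in simp)
        moreover have "?s(r := ?y) = ?s" using rd r 1 by (auto simp: ready_def fun_eq_iff)
        ultimately show ?thesis using runs_mono by fastforce
      next
        case 2
        have "runs x (Seq (Inc r) (If 0 1 Skip (Inc r))) ?s (Suc (1 + Suc 1)) [] (?s(r := ?y))"
          by (rule runs_Seq_silent[OF runs_Inc], rule runs_If_eq[OF _ runs_cong[OF runs_Skip]])
             (use 2 y r rd in \<open>auto simp: ready_def\<close>)
        then have "runs x test ?s (Suc (Suc (1 + Suc 1))) [] (?s(r := ?y))"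
          unfolding test_def by (intro runs_If_neq) (use 2 y in simp)
        then show ?thesis by (rule runs_mono) simp
      next
        case 3
        have "runs x (Seq (Inc r) (If 0 1 Skip (Inc r))) ?s (Suc (1 + Suc 1)) [] (?s(r := ?y))"
          by (rule runs_Seq_silent[OF runs_Inc], rule runs_If_neq[OF _ runs_cong[OF runs_Inc]])
             (use 3 y r rd in \<open>auto simp: ready_def\<close>)
        then have "runs x test ?s (Suc (Suc (1 + Suc 1))) [] (?s(r := ?y))"
          unfolding test_def by (intro runs_If_neq) (use 3 y in simp)
        then show ?thesis by (rule runs_mono) simp
      qed
    qed
    have 3: "runs x ret (?s(r := ?y)) (V (isize x e) * 4 + 1) [] (s(r := ?y))"
      unfolding ret_def
    proof (rule runs_loop_silent[where st = "\<lambda>i. s(0 := ?n - i, r := ?y, Suc r := ?n - i)" and n =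
        ?n and T = 3])
      fix i assume i: "i < ?n"
      have "runs x (Seq (Dec (Suc r)) (Dec 0)) (s(0 := ?n - i, r := ?y, Suc r := ?n - i))
          (Suc (1 + 1)) []
          (s(0 := ?n - Suc i, r := ?y, Suc r := ?n - Suc i))"
        by (rule runs_Seq_silent[OF runs_Dec], use i in simp, rule runs_cong[OF runs_Dec])
           (use r i in \<open>auto simp: fun_eq_iff\<close>)
      then show "runs x (Seq (Dec (Suc r)) (Dec 0)) (s(0 := ?n - i, r := ?y, Suc r := ?n - i)) 3 []
          (s(0 := ?n - Suc i, r := ?y, Suc r := ?n - Suc i))" by (rule runs_mono) simp
    qed (use rd r n in \<open>auto simp: ready_def fun_eq_iff\<close>)
    show "runs x (Seq go (Seq test ret)) (s(r := f x (map s \<rho>)))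
        (Suc (V (isize x (map s \<rho>)) * 6 + 1 +
       Suc (5 + (V (isize x (map s \<rho>)) * 4 + 1)))) [] (s(r := tape_of x (int (f x (map s \<rho>)))))"
      unfolding e_def[symmetric] by (rule runs_Seq_silent[OF 1 runs_Seq_silent[OF 2 3]])
  qed
  then show "\<exists>c T. polyb T \<and> computes (\<lambda>x e. tape_of x (int (f x e))) \<rho> r c T"
    by (rule computesI) (intro polyb_intros c V)
qed (intro polyb_intros)

section \<open>Programs that write output\<close>

definition emits :: "(bool list \<Rightarrow> nat list \<Rightarrow> bool list) \<Rightarrow> nat list \<Rightarrow> nat \<Rightarrow> com \<Rightarrow> (nat \<Rightarrow> nat) \<Rightarrow> bool"
    where
  "emits g \<rho> r c T \<longleftrightarrow> (\<forall>x s. ready r s \<longrightarrow> runs x c s (T (isize x (map s \<rho>))) (g x (map s \<rho>)) s)"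

definition emittable :: "nat \<Rightarrow> (bool list \<Rightarrow> nat list \<Rightarrow> bool list) \<Rightarrow> bool" where
  "emittable k g \<longleftrightarrow> (\<forall>\<rho> r. frame k \<rho> r \<longrightarrow> (\<exists>c T. polyb T \<and> emits g \<rho> r c T))"

lemma emittable_progE:
  assumes "emittable k g" "frame k \<rho> r"
  obtains c T where "polyb T" "emits g \<rho> r c T"
  using assms unfolding emittable_def by blast

lemma emittable_append:
  assumes "emittable k g" "emittable k h"
  shows "emittable k (\<lambda>x e. g x e @ h x e)"
  unfolding emittable_def
proof (intro allI impI)
  fix \<rho> r assume fr: "frame k \<rho> r"
  obtain c T where c: "polyb T" "emits g \<rho> r c T" using emittable_progE[OF assms(1) fr] .
  obtain d U where d: "polyb U" "emits h \<rho> r d U" using emittable_progE[OF assms(2) fr] .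
  have "emits (\<lambda>x e. g x e @ h x e) \<rho> r (Seq c d) (\<lambda>n. Suc (T n + U n))"
    using c(2) d(2) unfolding emits_def by (blast intro: runs_Seq)
  moreover have "polyb (\<lambda>n. Suc (T n + U n))" by (intro polyb_intros c d)
  ultimately show "\<exists>c T. polyb T \<and> emits (\<lambda>x e. g x e @ h x e) \<rho> r c T" by blast
qed

lemma emittable_for:
  assumes "computable k f" "emittable (Suc k) g"
  shows "emittable k (\<lambda>x e. concat (map (\<lambda>i. g x (e @ [i])) [0..<f x e]))"
  unfolding emittable_def
proof (intro allI impI)
  fix \<rho> r assume fr: "frame k \<rho> r"
  obtain V where V: "polyb V" "\<And>x e. length e = k \<Longrightarrow> f x e \<le> V (isize x e)"
    using computableE[OF assms(1)] by blast
  let ?i = "Suc r"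
  have fr': "frame (Suc k) (\<rho> @ [?i]) (r + 2)" using fr by (auto simp: frame_def)
  obtain c T where c: "polyb T" "computes f \<rho> r c T" using computable_progE[OF assms(1) fr] .
  obtain d U where d: "polyb U" "emits g (\<rho> @ [?i]) (r + 2) d U" using
      emittable_progE[OF assms(2) fr'] .
  define body where "body = Seq d (Seq (Inc ?i) (Dec r))"
  define B where "B n = Suc (U (n + V n) + Suc (1 + 1))" for n
  define T' where "T' n = Suc (T n + Suc (V n * Suc (B n) + 1 + (2 * V n + 1)))" for n
  have "emits (\<lambda>x e. concat (map (\<lambda>i. g x (e @ [i])) [0..<f x e])) \<rho> r
      (Seq c (Seq (While r 1 body) (clear ?i))) T'"
    unfolding emits_def T'_def
  proof (intro allI impI, rule runs_Seq_silent, rule c(2)[unfolded computes_def, rule_format],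
      assumption)
    fix x :: "bool list" and s assume rd: "ready r s"
    define e where "e = map s \<rho>"
    define st where "st i = s(r := f x e - i, ?i := i)" for i
    have len: "length e = k" using fr by (simp add: frame_def e_def)
    have st: "map (st i) \<rho> = e" for i
      using fr by (auto simp: st_def e_def frame_def)
    have 1: "runs x (While r 1 body) (s(r := f x e)) (V (isize x e) * Suc (B (isize x e)) + 1)
       (concat (map (\<lambda>i. g x (e @ [i])) [0..<f x e])) (st (f x e))"
    proof (rule runs_loop[where st = st and n = "f x e"])
      show "0 < r" using fr by (simp add: frame_def)
      show "st i r = f x e - i" for i by (simp add: st_def)
      show "st 0 = s(r := f x e)" using rd by (auto simp: st_def ready_def fun_upd_idem
          fun_upd_twist)
      show "f x e * Suc (B (isize x e)) + 1 \<le> V (isize x e) * Suc (B (isize x e)) + 1"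
        by (intro add_mono mult_le_mono order_refl V(2)[OF len])
      fix i assume i: "i < f x e"
      have e': "map (st i) (\<rho> @ [?i]) = e @ [i]" using st by (simp add: st_def)
      have 1: "runs x d (st i) (U (isize x e + V (isize x e))) (g x (e @ [i])) (st i)"
      proof (rule runs_mono)
        show "runs x d (st i) (U (isize x (e @ [i]))) (g x (e @ [i])) (st i)"
          using d(2)[unfolded emits_def, rule_format, of "st i" x, unfolded e'] rd fr
          by (simp add: ready_def st_def frame_def)
        show "U (isize x (e @ [i])) \<le> U (isize x e + V (isize x e))"
          using V(2)[OF len, of x] i by (intro polyb_mono[OF d(1)]) simp
      qed
      have 2: "runs x (Seq (Inc ?i) (Dec r)) (st i) (Suc (1 + 1)) [] (st (Suc i))"
        by (rule runs_Seq_silent[OF runs_Inc], rule runs_cong[OF runs_Dec])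
            (use i in \<open>auto simp: st_def fun_eq_iff\<close>)
      show "runs x body (st i) (B (isize x e)) (g x (e @ [i])) (st (Suc i))"
        using runs_Seq[OF 1 2] unfolding body_def B_def by simp
    qed auto
    have 2: "runs x (clear ?i) (st (f x e)) (2 * V (isize x e) + 1) [] s"
    proof (rule runs_mono)
      show "runs x (clear ?i) (st (f x e)) (2 * f x e + 1) [] s"
        using runs_clear[of ?i x "st (f x e)"] rd by (auto simp: st_def ready_def fun_upd_twist
            fun_upd_idem)
    qed (use V(2)[OF len, of x] in simp)
    show "runs x (Seq (While r 1 body) (clear ?i)) (s(r := f x (map s \<rho>)))
        (Suc (V (isize x (map s \<rho>)) * Suc (B (isize x (map s \<rho>))) + 1
        + (2 * V (isize x (map s \<rho>)) + 1))) (concat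
            (map (\<lambda>i. g x (map s \<rho> @ [i])) [0..<f x (map s \<rho>)])) s"
      using runs_Seq[OF 1 2] unfolding e_def[symmetric] by simp
  qed
  moreover have "polyb T'"
    unfolding T'_def B_def by (intro polyb_intros c V polyb_comp[OF d(1)])
  ultimately show "\<exists>c T. polyb T \<and> emits (\<lambda>x e. concat (map (\<lambda>i. g x (e @ [i])) [0..<f x e])) \<rho> r c
      T"
    by blast
qed

lemma pair_enc_eq: "pair_enc b u = concat (map (\<lambda>b. [True, b]) b) @ False # u"
  by (induction b) auto

text \<open>Halving until zero delivers the bits in the order of \<open>nat_bits\<close>. One pass
  down the counter toggles a parity bit in \<open>?b\<close> and increments the quotient
  \<open>?q\<close> at every second round; the parity is emitted behind the True that
  \<open>pair_enc\<close> puts before each bit.\<close>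

lemma emittable_nat_bits:
  assumes "computable k f"
  shows "emittable k (\<lambda>x e. pair_enc (nat_bits (f x e)) [])"
  unfolding emittable_def
proof (intro allI impI)
  fix \<rho> r assume fr: "frame k \<rho> r"
  then have r: "0 < r" by (simp add: frame_def)
  obtain V where V: "polyb V" "\<And>x e. length e = k \<Longrightarrow> f x e \<le> V (isize x e)"
    using computableE[OF assms(1)] by blast
  obtain c T where c: "polyb T" "computes f \<rho> r c T" using computable_progE[OF assms(1) fr] .
  let ?q = "Suc r" and ?b = "Suc (Suc r)"
  define toggle where "toggle = If ?b 1 (Inc ?b) (Seq (Dec ?b) (Inc ?q))"
  define halve where "halve = While r 1 (Seq (Dec r) toggle)"
  define out where "out = If ?b 1 (Emit False) (Seq (Dec ?b) (Emit True))"
  define body where "body = Seq (Emit True) (Seq halve (Seq out (move ?q r)))"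
  have body: "runs x body (s(r := n)) (20 * n + 20) [True, odd n] (s(r := n div 2))" if rd: "ready r
      s" for x n s
  proof -
    have s0: "s r = 0" "s ?q = 0" "s ?b = 0" using rd by (auto simp: ready_def)
    have 1: "runs x halve (s(r := n)) (n * Suc 6 + 1) [] (s(?q := n div 2, ?b := n mod 2))"
      unfolding halve_def
    proof (rule runs_loop_silent[where st = "\<lambda>i. s(r := n - i, ?q := i div 2, ?b := i mod 2)" and n
        = n and T = 6])
      fix i assume i: "i < n"
      let ?s = "s(r := n - i, ?q := i div 2, ?b := i mod 2)"
      have "runs x toggle (?s(r := n - Suc i)) 4 []
          (s(r := n - Suc i, ?q := Suc i div 2, ?b := Suc i mod 2))"
      proof (cases "even i")
        case True
        then have "Suc i div 2 = i div 2" "Suc i mod 2 = 1" "i mod 2 = 0" by (auto elim: evenE)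
        then have "runs x toggle (?s(r := n - Suc i)) (Suc 1) []
            (s(r := n - Suc i, ?q := Suc i div 2, ?b := Suc i mod 2))"
          unfolding toggle_def by (intro runs_If_eq runs_cong[OF runs_Inc])
              (auto simp: sym_def fun_eq_iff)
        then show ?thesis by (rule runs_mono) simp
      next
        case False
        then have *: "Suc i div 2 = Suc (i div 2)" "Suc i mod 2 = 0" "i mod 2 = 1" by
            (auto elim: oddE)
        then have "runs x (Seq (Dec ?b) (Inc ?q)) (?s(r := n - Suc i)) (Suc (1 + 1)) []
            (s(r := n - Suc i, ?q := Suc i div 2, ?b := Suc i mod 2))"
          by (intro runs_Seq_silent[OF runs_Dec] runs_cong[OF runs_Inc]) (auto simp: fun_eq_iff)
        then have "runs x toggle (?s(r := n - Suc i)) (Suc (Suc (1 + 1))) []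
            (s(r := n - Suc i, ?q := Suc i div 2, ?b := Suc i mod 2))"
          unfolding toggle_def by (intro runs_If_neq) (auto simp: sym_def *)
        then show ?thesis by (rule runs_mono) simp
      qed
      then have "runs x (Seq (Dec r) toggle) ?s (Suc (1 + 4)) []
          (s(r := n - Suc i, ?q := Suc i div 2, ?b := Suc i mod 2))"
        by (intro runs_Seq_silent[OF runs_cong[OF runs_Dec]]) (use i in \<open>auto simp: fun_eq_iff\<close>)
      then show "runs x (Seq (Dec r) toggle) ?s 6 []
          (s(r := n - Suc i, ?q := Suc i div 2, ?b := Suc i mod 2))"
        by (rule runs_mono) simp
    qed (use r s0 in \<open>auto simp: fun_eq_iff\<close>)
    have 2: "runs x out (s(?q := n div 2, ?b := n mod 2)) 4 [odd n] (s(?q := n div 2))"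
    proof (cases "even n")
      case True
      then have "runs x out (s(?q := n div 2, ?b := n mod 2)) (Suc 1) [odd n] (s(?q := n div 2))"
        unfolding out_def by (intro runs_If_eq runs_cong[OF runs_Emit[of _ False]])
          (use s0 runs_cong[OF runs_Emit[of x False]] in \<open>auto simp: sym_def fun_eq_iff\<close>)
      then show ?thesis by (rule runs_mono) simp
    next
      case False
      then have *: "n mod 2 = 1" by (auto elim: oddE)
      have "runs x (Seq (Dec ?b) (Emit True)) (s(?q := n div 2, ?b := n mod 2)) (Suc (1 + 1)) [True]
          (s(?q := n div 2))"
        by (rule runs_Seq_silent[OF runs_Dec], simp add: *, rule runs_cong[OF runs_Emit])
            (use s0 * in \<open>auto simp: fun_eq_iff\<close>)
      then have "runs x out (s(?q := n div 2, ?b := n mod 2)) (Suc (Suc (1 + 1))) [odd n]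
          (s(?q := n div 2))"
        unfolding out_def by (intro runs_If_neq) (use False in \<open>auto simp: sym_def *\<close>)
      then show ?thesis by (rule runs_mono) simp
    qed
    have 3: "runs x (move ?q r) (s(?q := n div 2)) (4 * (n div 2) + 1) [] (s(r := n div 2))"
      using runs_move[of ?q r x "s(?q := n div 2)"] s0 by (auto simp: fun_upd_twist fun_upd_idem)
    have "runs x body (s(r := n)) (Suc (1 + Suc (n * Suc 6 + 1 + Suc (4 + (4 * (n div 2) + 1)))))
        ([True] @ [odd n] @ []) (s(r := n div 2))"
      unfolding body_def by (rule runs_Seq[OF runs_Emit runs_Seq_silent[OF 1 runs_Seq[OF 2 3]]])
    then have "runs x body (s(r := n)) (20 * n + 20) ([True] @ [odd n] @ []) (s(r := n div 2))"
      by (rule runs_mono) simp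
    then show ?thesis by simp
  qed
  \<comment> \<open>\<open>N\<close> stays fixed while \<open>n\<close> is halved, so a single bound
    covers the cost of each round.\<close>
  have loop: "runs x (While r 1 body) (s(r := n)) (n * (20 * N + 21) + 1)
      (concat (map (\<lambda>b. [True, b]) (nat_bits n))) s"
    if rd: "ready r s" and "n \<le> N" for x n N s
    using that(2)
  proof (induction n rule: less_induct)
    case (less n)
    show ?case
    proof (cases "n = 0")
      case True
      have "s(r := 0) = s" using rd by (auto simp: ready_def)
      then show ?thesis
        using True exec.While_end[of x r s 1 body] rd r by (auto simp: nat_bits_0 runs_def sym_def
            ready_def)
    next
      case False
      obtain t where t: "t \<le> 20 * n + 20" "exec x body (s(r := n)) t [True, odd n]
          (s(r := n div 2))"
        using body[OF rd] unfolding runs_def by blast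
      obtain t' where t': "t' \<le> n div 2 * (20 * N + 21) + 1"
        "exec x (While r 1 body) (s(r := n div 2)) t'
            (concat (map (\<lambda>b. [True, b]) (nat_bits (n div 2)))) s"
        using less.IH[of "n div 2", OF div_less_dividend order_trans[OF div_le_dividend less.prems]]
            False
        unfolding runs_def by auto
      have "exec x (While r 1 body) (s(r := n)) (Suc (t + t'))
          ([True, odd n] @ concat (map (\<lambda>b. [True, b]) (nat_bits (n div 2)))) s"
        by (rule exec.While_step[OF _ t(2) t'(2)]) (use False r in \<open>simp add: sym_def\<close>)
      moreover have "Suc (t + t') \<le> n * (20 * N + 21) + 1"
      proof -
        \<comment> \<open>The rounds are counted crudely: one for the current halving and at most
          \<open>n div 2\<close> for the rest, together at most \<open>n\<close>.\<close>
        have "Suc (t + t') \<le> Suc (n div 2) * (20 * N + 21) + 1" using t(1) t'(1) less.prems by simp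
        also have "Suc (n div 2) \<le> n" using False by simp
        finally show ?thesis by (meson add_le_mono1 le_trans mult_le_mono1 order_refl)
      qed
      ultimately show ?thesis using False unfolding runs_def by (auto simp: nat_bits_pos)
    qed
  qed
  have "emits (\<lambda>x e. pair_enc (nat_bits (f x e)) []) \<rho> r (Seq c (Seq (While r 1 body) (Emit False)))
     (\<lambda>n. Suc (T n + Suc (V n * (20 * V n + 21) + 1 + 1)))"
    unfolding emits_def pair_enc_eq
  proof (intro allI impI, rule runs_Seq_silent, rule c(2)[unfolded computes_def, rule_format],
      assumption, rule runs_Seq)
    fix x :: "bool list" and s assume rd: "ready r s"
    have h: "f x (map s \<rho>) \<le> V (isize x (map s \<rho>))" using fr by (intro V(2)) (simp add: frame_def)
    show "runs x (While r 1 body) (s(r := f x (map s \<rho>)))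
        (V (isize x (map s \<rho>)) * (20 * V (isize x (map s \<rho>)) + 21) + 1)
        (concat (map (\<lambda>b. [True, b]) (nat_bits (f x (map s \<rho>))))) s"
      by (rule runs_mono[OF loop[OF rd h]]) (intro add_mono mult_le_mono1 order_refl h)
  qed (rule runs_Emit)
  moreover have "polyb (\<lambda>n. Suc (T n + Suc (V n * (20 * V n + 21) + 1 + 1)))" by
      (intro polyb_intros c V)
  ultimately show "\<exists>c T. polyb T \<and> emits (\<lambda>x e. pair_enc (nat_bits (f x e)) []) \<rho> r c T" by blast
qed

theorem emittable_polytime_computable:
  assumes "emittable 0 (\<lambda>x e. g x)"
  shows "polytime_computable g"
proof -
  have "frame 0 [] 1" by (simp add: frame_def)
  then obtain c T where c: "polyb T" "emits (\<lambda>x e. g x) [] 1 c T" using emittable_progE[OF assms] by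
      blast
  obtain p where p: "T = poly p" using c(1) unfolding polyb_def by blast
  have "ready 1 (\<lambda>_. 0)" by (simp add: ready_def)
  then have "runs x c (\<lambda>_. 0) (poly p (length x)) (g x) (\<lambda>_. 0)" for x
    using c(2) unfolding emits_def p by (metis add_0_right list.map_disc_iff list.simps(8)
        sum_list.Nil)
  then show ?thesis
    unfolding runs_def by (intro exec_polytime_computable[of p c]) blast
qed

section \<open>A language of polynomial-time expressions\<close>

text \<open>Reified expressions make polynomial-time computability a single induction; each formula
  of the reduction then needs only an equation for its value. Since \<open>Sum\<close> is bounded by
  the value of an expression, no expression leaves polynomial size.\<close>

datatype expr = Var nat | Num nat | Len | Symbol expr
  | Add expr expr | Sub expr expr | Mul expr expr | Div expr expr | Sum expr expr

text \<open>Variables are de Bruijn levels: a bound variable is appended at the end of the environment.\<close>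

primrec eval :: "bool list \<Rightarrow> nat list \<Rightarrow> expr \<Rightarrow> nat" where
  "eval x e (Var i) = (if i < length e then e ! i else 0)"
| "eval x e (Num n) = n"
| "eval x e Len = length x"
| "eval x e (Symbol a) = tape_of x (int (eval x e a))"
| "eval x e (Add a b) = eval x e a + eval x e b"
| "eval x e (Sub a b) = eval x e a - eval x e b"
| "eval x e (Mul a b) = eval x e a * eval x e b"
| "eval x e (Div a b) = eval x e a div eval x e b"
| "eval x e (Sum a b) = (\<Sum>i<eval x e a. eval x (e @ [i]) b)"

text \<open>The arity is arbitrary in the induction because the body of \<open>Sum\<close> lives in
  an environment longer by one.\<close>

lemma computable_eval: "computable k (\<lambda>x e. eval x e a)"
proof (induction a arbitrary: k)
  case (Var i)
  show ?case
  proof (cases "i < k")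
    case True
    then show ?thesis by (intro computable_cong[OF _ computable_var[OF True]]) simp
  next
    case False
    then show ?thesis by (intro computable_cong[OF _ computable_zero]) simp
  qed
next
  case (Sum a b)
  then show ?case using computable_sum[OF Sum.IH(1) Sum.IH(2)] by simp
qed (simp_all add: computable_const computable_length computable_symbol computable_add
    computable_diff
  computable_mult computable_div)

text \<open>A \<open>For\<close> whose bound is 0 or 1 acts as a conditional; this is how an edge is
  emitted only if it is present.\<close>

datatype gen = Out expr | Both gen gen | For expr gen

primrec outputs :: "bool list \<Rightarrow> nat list \<Rightarrow> gen \<Rightarrow> nat list" where
  "outputs x e (Out a) = [eval x e a]"
| "outputs x e (Both g h) = outputs x e g @ outputs x e h"
| "outputs x e (For a g) = concat (map (\<lambda>i. outputs x (e @ [i]) g) [0..<eval x e a])"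

lemma enc_nats_append: "enc_nats (ms @ ns) = enc_nats ms @ enc_nats ns"
  by (induction ms) (auto simp: enc_nats_def pair_enc_eq)

lemma enc_nats_concat: "enc_nats (concat xs) = concat (map enc_nats xs)"
  by (induction xs) (auto simp: enc_nats_append, simp add: enc_nats_def)

lemma emittable_outputs: "emittable k (\<lambda>x e. enc_nats (outputs x e g))"
proof (induction g arbitrary: k)
  case (Out a)
  then show ?case using emittable_nat_bits[OF computable_eval] by (simp add: enc_nats_def)
next
  case (Both g h)
  then show ?case by (simp add: enc_nats_append emittable_append)
next
  case (For a g)
  then show ?case using emittable_for[OF computable_eval For.IH] by
      (simp add: enc_nats_concat comp_def)
qed

theorem outputs_polytime_computable: "polytime_computable (\<lambda>x. enc_nats (outputs x [] g))"
proof (rule emittable_polytime_computable)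
  have "emittable 0 (\<lambda>x e. enc_nats (outputs x e g))" by (rule emittable_outputs)
  moreover have "emits (\<lambda>x e. enc_nats (outputs x e g)) \<rho> r c T \<longleftrightarrow> emits
      (\<lambda>x e. enc_nats (outputs x [] g)) \<rho> r c T"
    if "frame 0 \<rho> r" for \<rho> r c T using that by (simp add: emits_def frame_def)
  ultimately show "emittable 0 (\<lambda>x e. enc_nats (outputs x [] g))" unfolding emittable_def by simp
qed

section \<open>Logic, tables and polynomials as arithmetic\<close>

definition Sign :: "expr \<Rightarrow> expr" where "Sign a = Sub (Num 1) (Sub (Num 1) a)"
definition Neg :: "expr \<Rightarrow> expr" where "Neg a = Sub (Num 1) a"
definition And :: "expr \<Rightarrow> expr \<Rightarrow> expr" where "And a b = Sign (Mul a b)"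
definition Or :: "expr \<Rightarrow> expr \<Rightarrow> expr" where "Or a b = Sign (Add a b)"
definition Le :: "expr \<Rightarrow> expr \<Rightarrow> expr" where "Le a b = Neg (Sub a b)"
definition Less :: "expr \<Rightarrow> expr \<Rightarrow> expr" where "Less a b = Sign (Sub b a)"
definition Eq :: "expr \<Rightarrow> expr \<Rightarrow> expr" where "Eq a b = And (Le a b) (Le b a)"
definition Cond :: "expr \<Rightarrow> expr \<Rightarrow> expr \<Rightarrow> expr" where
  "Cond c a b = Add (Mul (Sign c) a) (Mul (Neg c) b)"
definition Mod :: "expr \<Rightarrow> expr \<Rightarrow> expr" where "Mod a b = Sub a (Mul (Div a b) b)"
definition Disj :: "expr list \<Rightarrow> expr" where "Disj as = foldr Or as (Num 0)"
definition Conj :: "expr list \<Rightarrow> expr" where "Conj as = foldr And as (Num 1)"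
text \<open>A finite function as nested case distinctions. With \<open>n\<close> depending only on
  the fixed machine, it is the means to write the transition function into the reduction.\<close>

definition Table :: "(nat \<Rightarrow> nat) \<Rightarrow> nat \<Rightarrow> expr \<Rightarrow> expr" where
  "Table f n a = foldr (\<lambda>i b. Cond (Eq a (Num i)) (Num (f i)) b) [0..<n] (Num 0)"
text \<open>Horner's scheme in the input length.\<close>

definition Poly :: "nat poly \<Rightarrow> expr" where
  "Poly p = fold_coeffs (\<lambda>c a. Add (Num c) (Mul Len a)) p (Num 0)"

lemma eval_Sign [simp]: "eval x e (Sign a) = of_bool (eval x e a \<noteq> 0)"
  by (simp add: Sign_def)

lemma eval_Neg [simp]: "eval x e (Neg a) = of_bool (eval x e a = 0)"
  by (simp add: Neg_def)

lemma eval_And [simp]: "eval x e (And a b) = of_bool (eval x e a \<noteq> 0 \<and> eval x e b \<noteq> 0)"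
  by (simp add: And_def)

lemma eval_Or [simp]: "eval x e (Or a b) = of_bool (eval x e a \<noteq> 0 \<or> eval x e b \<noteq> 0)"
  by (simp add: Or_def)

lemma eval_Le [simp]: "eval x e (Le a b) = of_bool (eval x e a \<le> eval x e b)"
  by (simp add: Le_def)

lemma eval_Less [simp]: "eval x e (Less a b) = of_bool (eval x e a < eval x e b)"
  by (simp add: Less_def)

lemma eval_Eq [simp]: "eval x e (Eq a b) = of_bool (eval x e a = eval x e b)"
  by (auto simp: Eq_def)

lemma eval_Cond [simp]: "eval x e (Cond c a b) = (if eval x e c \<noteq> 0 then eval x e a else eval x e
    b)"
  by (simp add: Cond_def)

lemma eval_Mod [simp]: "eval x e (Mod a b) = eval x e a mod eval x e b"
  by (simp add: Mod_def minus_div_mult_eq_mod)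

lemma eval_Disj: "eval x e (Disj as) = of_bool (\<exists>a \<in> set as. eval x e a \<noteq> 0)"
  unfolding Disj_def by (induction as) auto

lemma eval_Disj_Cons [simp]: "eval x e (Disj []) = 0"
  "eval x e (Disj (a # as)) = of_bool (eval x e a \<noteq> 0 \<or> eval x e (Disj as) \<noteq> 0)"
  by (simp_all add: Disj_def)

lemma eval_Conj_Cons [simp]: "eval x e (Conj []) = 1"
  "eval x e (Conj (a # as)) = of_bool (eval x e a \<noteq> 0 \<and> eval x e (Conj as) \<noteq> 0)"
  by (simp_all add: Conj_def)

lemma eval_Table: "eval x e a < n \<Longrightarrow> eval x e (Table f n a) = f (eval x e a)"
proof -
  have "eval x e (foldr (\<lambda>i b. Cond (Eq a (Num i)) (Num (f i)) b) is (Num 0)) = f (eval x e a)"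
    if "eval x e a \<in> set is" for "is" using that by (induction "is") auto
  then show "eval x e a < n \<Longrightarrow> ?thesis" by (simp add: Table_def)
qed

lemma eval_Poly [simp]: "eval x e (Poly p) = poly p (length x)"
  unfolding Poly_def by (induction p) auto

section \<open>From clauses to edge colorings\<close>

text \<open>A clause without literals imposes no condition.\<close>

definition satisfiable :: "nat \<Rightarrow> nat \<Rightarrow> (nat \<Rightarrow> nat \<Rightarrow> bool) \<Rightarrow> (nat \<Rightarrow> nat \<Rightarrow> bool) \<Rightarrow> bool" where
  "satisfiable m C pos neg \<longleftrightarrow> (\<exists>\<alpha>. \<forall>c<C. (\<exists>i<m. pos c i \<or> neg c i) \<longrightarrow>
      (\<exists>i<m. pos c i \<and> \<alpha> i \<or> neg c i \<and> \<not> \<alpha> i))"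

locale gadget =
  fixes m C :: nat and pos neg :: "nat \<Rightarrow> nat \<Rightarrow> bool"
begin

definition core :: nat where "core = 4 * m + C"
text \<open>\<open>core * core\<close> bounds the number of edges between vertices that are not
  leaves; the leaves of a single anchor outnumber them all.\<close>

definition pendants :: nat where "pendants = core * core + 1"
definition order :: nat where "order = core + 2 * m * pendants"
text \<open>Two anchors have \<open>2 * pendants = cap + 1\<close> leaf edges together, just too
  many for one color group.\<close>

definition cap :: nat where "cap = pendants + core * core"

text \<open>Vertices \<open>i\<close>, \<open>m + i\<close>, \<open>2m + i\<close>, \<open>3m + i\<close> are the true anchor, the false anchor, the value
  and the selector of variable \<open>i < m\<close>; vertex \<open>4m + c\<close> is clause \<open>c < C\<close>; the remaining ones are
  leaves attached to the anchors.\<close>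

definition occurs :: "nat \<Rightarrow> nat \<Rightarrow> bool" where
  "occurs c u \<longleftrightarrow> (u < m \<and> pos c u) \<or> (m \<le> u \<and> u < 2 * m \<and> neg c (u - m)) \<or>
     (2 * m \<le> u \<and> u < 3 * m \<and> (pos c (u - 2 * m) \<or> neg c (u - 2 * m)))"

text \<open>The smaller end of each pair is an anchor or a value, the larger one a selector, a
  clause or a leaf. So the graph is bipartite, and since the smaller ends have bound 1, a feasible
  coloring amounts to one color for each of them. Each anchor owns a block of
  \<open>pendants\<close> consecutive leaves.\<close>

definition adj :: "nat \<Rightarrow> nat \<Rightarrow> bool" where
  "adj u v \<longleftrightarrow> (3 * m \<le> v \<and> v < 4 * m \<and> (v = u + 3 * m \<or> v = u + 2 * m \<or> v = u + m)) \<or>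
     (4 * m \<le> v \<and> v < core \<and> occurs (v - 4 * m) u) \<or>
     (core \<le> v \<and> v < order \<and> u = (v - core) div pendants)"

text \<open>A clause with a literal touches an anchor and a value, so its degree is at least 2 and
  the bound is the degree minus one. The maximum keeps the bound positive for clauses without
  literals.\<close>

definition quota :: "nat \<Rightarrow> nat" where
  "quota v = (if 3 * m \<le> v \<and> v < 4 * m then 2
     else if 4 * m \<le> v \<and> v < core then max 1 ((\<Sum>u<3 * m. of_bool (occurs (v - 4 * m) u)) - 1) else
         1)"

definition edges :: "nat set set" where
  "edges = {{u, v} | u v. adj u v}"

lemma pendants_pos: "0 < pendants"
  by (simp add: pendants_def)

lemma adj_bounds:
  assumes "adj u v"
  shows "u < 3 * m" "3 * m \<le> v" "v < order" "u < v"
proof -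
  have "core \<le> order" by (simp add: order_def)
  have "(v - core) div pendants < 2 * m" if "core \<le> v" "v < order"
    using that pendants_pos by (simp add: order_def less_mult_imp_div_less)
  then show *: "u < 3 * m" "3 * m \<le> v" "v < order"
    using assms \<open>core \<le> order\<close> by (auto simp: adj_def occurs_def core_def)
  then show "u < v" by simp
qed

lemma adj_pendant: "core \<le> v \<Longrightarrow> adj u v \<longleftrightarrow> v < order \<and> u = (v - core) div pendants"
  by (auto simp: adj_def core_def)

lemma adj_clause: "4 * m \<le> v \<Longrightarrow> v < core \<Longrightarrow> adj u v \<longleftrightarrow> occurs (v - 4 * m) u"
  by (auto simp: adj_def)

lemma adj_selector: "i < m \<Longrightarrow> adj u (3 * m + i) \<longleftrightarrow> u = i \<or> u = m + i \<or> u = 2 * m + i"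
  by (auto simp: adj_def core_def)

lemma edge_low: "u < 3 * m \<Longrightarrow> {e \<in> edges. u \<in> e} = (\<lambda>v. {u, v}) ` {v. adj u v}"
  using adj_bounds by (fastforce simp: edges_def)

lemma edge_high: "3 * m \<le> v \<Longrightarrow> {e \<in> edges. v \<in> e} = (\<lambda>u. {u, v}) ` {u. adj u v}"
  using adj_bounds by (fastforce simp: edges_def)

lemma finite_edges: "finite edges"
proof -
  have "edges \<subseteq> (\<lambda>(u, v). {u, v}) ` ({..<order} \<times> {..<order})"
    using adj_bounds by (fastforce simp: edges_def)
  then show ?thesis by (rule finite_subset) simp
qed

lemma pendant_adj:
  assumes "u < 2 * m" "p < pendants"
  shows "adj u (core + (u * pendants + p))"
proof -
  have "u * pendants + p < Suc u * pendants" using assms(2) by simp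
  also have "\<dots> \<le> 2 * m * pendants" using assms(1) by (intro mult_le_mono1) simp
  finally show ?thesis using assms(2) by (simp add: adj_pendant order_def)
qed

lemma occurs_count: "(\<Sum>u<3 * m. of_bool (occurs c u)) = card {u. occurs c u}"
proof -
  have "{u. occurs c u} \<subseteq> {..<3 * m}" by (auto simp: occurs_def)
  then have "{..<3 * m} \<inter> {u. occurs c u} = {u. occurs c u}" by blast
  then show ?thesis by (simp add: of_bool_def sum.If_cases)
qed

lemma finite_occurs: "finite {u. occurs c u}"
  by (rule finite_subset[of _ "{..<3 * m}"]) (auto simp: occurs_def)

text \<open>Every edge takes the color of its smaller end: an anchor has its own number as color, a
  value the number of the anchor that the assignment selects. At a satisfied clause the value of a
  true literal repeats the color of an anchor present there, which saves the one color that the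
  bound demands.\<close>

lemma colorable_if_satisfiable:
  assumes "satisfiable m C pos neg"
  shows "q_colorable {..<order} edges quota cap"
proof -
  obtain \<alpha> where \<alpha>: "\<And>c. c < C \<Longrightarrow> (\<exists>i<m. pos c i \<or> neg c i) \<Longrightarrow> (\<exists>i<m. pos c i \<and> \<alpha> i \<or> neg c i \<and> \<not> \<alpha>
      i)"
    using assms unfolding satisfiable_def by blast
  define col where "col u = (if u < 2 * m then u else if \<alpha> (u - 2 * m) then u - 2 * m else u - m)"
      for u
  define \<sigma> :: "nat set \<Rightarrow> nat" where "\<sigma> e = col (Min e)" for e
  have \<sigma>: "\<sigma> {u, v} = col u" if "adj u v" for u v
    using adj_bounds(4)[OF that] by (simp add: \<sigma>_def min_def)
  have low: "\<sigma> ` {e \<in> edges. u \<in> e} \<subseteq> {col u}" if "u < 3 * m" for u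
    unfolding edge_low[OF that] using \<sigma> by auto
  have high: "\<sigma> ` {e \<in> edges. v \<in> e} = col ` {u. adj u v}" if "3 * m \<le> v" for v
    unfolding edge_high[OF that] image_image using \<sigma> by (intro image_cong) auto
  have "card (\<sigma> ` {e \<in> edges. v \<in> e}) \<le> quota v" if v: "v < order" for v
  proof -
    consider "v < 3 * m" | "3 * m \<le> v" "v < 4 * m" | "4 * m \<le> v" "v < core" | "core \<le> v" by linarith
    then show ?thesis
    proof cases
      case 1
      then have "card (\<sigma> ` {e \<in> edges. v \<in> e}) \<le> card {col v}" by (intro card_mono low) auto
      then show ?thesis using 1 by (simp add: quota_def)
    next
      case 2
      define i where "i = v - 3 * m"
      have i: "v = 3 * m + i" "i < m" using 2 by (auto simp: i_def)
      have "\<sigma> ` {e \<in> edges. v \<in> e} \<subseteq> {i, m + i}"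
        unfolding high[OF 2(1)] unfolding i(1) adj_selector[OF i(2)] using i(2) by
            (auto simp: col_def)
      then have "card (\<sigma> ` {e \<in> edges. v \<in> e}) \<le> card {i, m + i}" by (intro card_mono) auto
      also have "\<dots> \<le> 2" by (simp add: card_insert_if)
      finally show ?thesis using 2 by (simp add: quota_def)
    next
      case 3
      define c where "c = v - 4 * m"
      have c: "c < C" using 3 by (auto simp: c_def core_def)
      have N: "\<sigma> ` {e \<in> edges. v \<in> e} = col ` {u. occurs c u}"
        using 3 by (subst high) (simp_all add: adj_clause c_def)
      have q: "quota v = max 1 (card {u. occurs c u} - 1)"
        using 3 by (simp add: quota_def c_def occurs_count)
      show ?thesis
      proof (cases "{u. occurs c u} = {}")
        case True
        show ?thesis unfolding N q True by simp
      next
        case False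
        then have "\<exists>i<m. pos c i \<or> neg c i"
          by (auto simp: occurs_def) (use less_diff_conv2 in fastforce)+
        then obtain i where i: "i < m" "pos c i \<and> \<alpha> i \<or> neg c i \<and> \<not> \<alpha> i" using \<alpha>[OF c] by blast
        \<comment> \<open>\<open>w\<close> is the anchor of the true literal; it has the color of
          the value \<open>2 * m + i\<close>, so dropping that value from the neighbors loses no
          color.\<close>
        define w where "w = (if \<alpha> i then i else m + i)"
        have w: "w \<noteq> 2 * m + i" "occurs c w" "col w = col (2 * m + i)"
          using i by (auto simp: w_def occurs_def col_def)
        have b: "occurs c (2 * m + i)" using i by (auto simp: occurs_def)
        have "col ` {u. occurs c u} = col ` ({u. occurs c u} - {2 * m + i})"
        proof -
          have "w \<in> {u. occurs c u} - {2 * m + i}" using w by simp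
          then have "col (2 * m + i) \<in> col ` ({u. occurs c u} - {2 * m + i})" unfolding
              w(3)[symmetric] by (rule imageI)
          moreover have "{u. occurs c u} = insert (2 * m + i) ({u. occurs c u} - {2 * m + i})" using
              b by blast
          ultimately show ?thesis by (metis image_insert insert_absorb)
        qed
        then have "card (col ` {u. occurs c u}) \<le> card ({u. occurs c u} - {2 * m + i})"
          using card_image_le[of "{u. occurs c u} - {2 * m + i}" col] finite_occurs by simp
        also have "\<dots> = card {u. occurs c u} - 1" using b by (simp add: finite_occurs)
        finally show ?thesis unfolding N q by simp
      qed
    next
      case 4
      have "3 * m \<le> v" using 4 by (simp add: core_def)
      then have "\<sigma> ` {e \<in> edges. v \<in> e} \<subseteq> {col ((v - core) div pendants)}"
        using 4 by (auto simp: high adj_pendant)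
      then have "card (\<sigma> ` {e \<in> edges. v \<in> e}) \<le> card {col ((v - core) div pendants)}" by
          (intro card_mono) auto
      then show ?thesis using 4 by (simp add: quota_def core_def)
    qed
  qed
  moreover have "card X \<le> cap" if group: "X \<in> color_groups edges \<sigma>" for X
  proof -
    obtain c where X: "X = {e \<in> edges. \<sigma> e = c}" using group unfolding color_groups_def by blast
    \<comment> \<open>A color is the number of at most one anchor, so a group consists of leaf edges
      of that anchor and of edges inside the core.\<close>
    let ?A = "(\<lambda>p. {c, core + (c * pendants + p)}) ` {..<pendants}"
    let ?B = "(\<lambda>(u, v). {u, v}) ` ({..<core} \<times> {..<core})"
    have "X \<subseteq> ?A \<union> ?B"
    proof
      fix e assume "e \<in> X"
      then obtain u v where e: "e = {u, v}" "adj u v" "col u = c" unfolding X edges_def using \<sigma> by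
          auto
      show "e \<in> ?A \<union> ?B"
      proof (cases "v < core")
        case True
        then show ?thesis using e adj_bounds[OF e(2)] by (auto intro!: image_eqI[of _ _ "(u, v)"])
      next
        case False
        then have u: "u = (v - core) div pendants" "v < order" using e(2) adj_pendant by auto
        then have "u < 2 * m" using False pendants_pos by
            (simp add: order_def less_mult_imp_div_less)
        then have "u = c" using e(3) by (simp add: col_def)
        moreover have "v = core + (u * pendants + (v - core) mod pendants)"
          using False u(1) by (simp add: div_mult_mod_eq)
        ultimately show ?thesis using e(1) pendants_pos by
            (auto intro!: image_eqI[of _ _ "(v - core) mod pendants"])
      qed
    qed
    then have "card X \<le> card (?A \<union> ?B)" by (intro card_mono) auto
    also have "\<dots> \<le> card ?A + card ?B" by (rule card_Un_le)
    also have "\<dots> \<le> card {..<pendants} + card ({..<core} \<times> {..<core})" by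
        (intro add_mono card_image_le) auto
    finally show ?thesis by (simp add: cap_def)
  qed
  ultimately show ?thesis
    unfolding q_colorable_def feasible_coloring_def by blast
qed

text \<open>Each small vertex \<open>u\<close> has a single color \<open>\<gamma> u\<close>. Equal
  colors on two anchors would overfill a group, and the selectors then confine each value to the
  colors of its two anchors. A variable is read as true when its value has the color of its true
  anchor; the pigeonhole principle at a clause vertex yields a satisfied literal.\<close>

lemma satisfiable_if_colorable:
  assumes "q_colorable {..<order} edges quota cap"
  shows "satisfiable m C pos neg"
proof -
  obtain \<sigma> :: "nat set \<Rightarrow> nat" where feas: "\<And>v. v < order \<Longrightarrow> card (\<sigma> ` {e \<in> edges. v \<in> e}) \<le> quota v"
    and size: "\<And>X. X \<in> color_groups edges \<sigma> \<Longrightarrow> card X \<le> cap"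
    using assms unfolding q_colorable_def feasible_coloring_def by auto
  have core_le: "core \<le> order" "4 * m \<le> core" by (simp_all add: order_def core_def)
  have "\<exists>\<gamma>. \<forall>v. adj u v \<longrightarrow> \<sigma> {u, v} = \<gamma>" if u: "u < 3 * m" for u
  proof -
    have "card (\<sigma> ` {e \<in> edges. u \<in> e}) \<le> 1" using feas[of u] u core_le by (simp add: quota_def)
    then have "is_singleton (\<sigma> ` {e \<in> edges. u \<in> e}) \<or> \<sigma> ` {e \<in> edges. u \<in> e} = {}"
      using finite_edges by (auto simp: is_singleton_altdef le_Suc_eq)
    then obtain \<gamma> where "\<sigma> ` {e \<in> edges. u \<in> e} \<subseteq> {\<gamma>}" by (auto elim!: is_singletonE)
    then show ?thesis unfolding edge_low[OF u] by (intro exI[of _ \<gamma>]) auto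
  qed
  then obtain \<gamma> where \<gamma>: "\<And>u v. u < 3 * m \<Longrightarrow> adj u v \<Longrightarrow> \<sigma> {u, v} = \<gamma> u" by metis
  have \<gamma>': "\<sigma> {u, v} = \<gamma> u" if "adj u v" for u v using \<gamma> adj_bounds that by blast
  have anchors: "u = u'" if u: "u < 2 * m" "u' < 2 * m" "\<gamma> u = \<gamma> u'" for u u'
  proof (rule ccontr)
    assume ne: "u \<noteq> u'"
    let ?leaf = "\<lambda>u p. {u, core + (u * pendants + p)}"
    let ?X = "{e \<in> edges. \<sigma> e = \<gamma> u}"
    have sub: "?leaf w ` {..<pendants} \<subseteq> ?X" if "w < 2 * m" "\<gamma> w = \<gamma> u" for w
      using that pendant_adj \<gamma>' by (fastforce simp: edges_def)
    have "?leaf u 0 \<in> ?X" using sub[OF u(1) refl] pendants_pos by blast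
    then have "\<gamma> u \<in> \<sigma> ` edges" by (metis (mono_tags, lifting) image_eqI mem_Collect_eq)
    then have "?X \<in> color_groups edges \<sigma>" unfolding color_groups_def by blast
    then have "card ?X \<le> cap" by (rule size)
    have small: "w < core" if "w < 2 * m" for w using that core_le(2) by linarith
    have card: "card (?leaf w ` {..<pendants}) = pendants" if "w < 2 * m" for w
      using small[OF that] by (subst card_image) (auto simp: inj_on_def doubleton_eq_iff)
    have "?leaf u ` {..<pendants} \<inter> ?leaf u' ` {..<pendants} = {}"
      using small[OF u(1)] small[OF u(2)] ne by (auto simp: doubleton_eq_iff)
    then have "2 * pendants = card (?leaf u ` {..<pendants} \<union> ?leaf u' ` {..<pendants})"
      using card u by (subst card_Un_disjoint) auto
    also have "\<dots> \<le> card ?X" using sub u finite_edges by (intro card_mono) auto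
    finally show False using \<open>card ?X \<le> cap\<close> by (simp add: cap_def pendants_def)
  qed
  have high: "\<sigma> ` {e \<in> edges. v \<in> e} = \<gamma> ` {u. adj u v}" if "3 * m \<le> v" for v
    unfolding edge_high[OF that] image_image using \<gamma>' by (intro image_cong) auto
  have val: "\<gamma> (2 * m + i) = \<gamma> i \<or> \<gamma> (2 * m + i) = \<gamma> (m + i)" if i: "i < m" for i
  proof (rule ccontr)
    assume "\<not> ?thesis"
    then have "card {\<gamma> i, \<gamma> (m + i), \<gamma> (2 * m + i)} = 3"
      using anchors[of i "m + i"] i by (auto simp: card_insert_if)
    moreover have "{u. adj u (3 * m + i)} = {i, m + i, 2 * m + i}" using adj_selector[OF i] by auto
    moreover have "card (\<sigma> ` {e \<in> edges. 3 * m + i \<in> e}) \<le> 2"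
      using feas[of "3 * m + i"] i core_le by (simp add: quota_def)
    ultimately show False by (simp add: high)
  qed
  show ?thesis
    unfolding satisfiable_def
  proof (intro exI[of _ "\<lambda>i. \<gamma> (2 * m + i) = \<gamma> i"] allI impI)
    fix c assume c: "c < C" and "\<exists>i<m. pos c i \<or> neg c i"
    then obtain i where i: "i < m" "pos c i \<or> neg c i" by blast
    let ?N = "{u. occurs c u}"
    define w where "w = (if pos c i then i else m + i)"
    have "{w, 2 * m + i} \<subseteq> ?N" "w \<noteq> 2 * m + i" using i by (auto simp: w_def occurs_def)
    \<comment> \<open>Degree at least 2 makes \<open>max 1 (card ?N - 1)\<close> strictly smaller
      than the degree, so \<open>\<gamma>\<close> repeats a color on \<open>?N\<close>.\<close>
    then have two: "2 \<le> card ?N" using card_mono[OF finite_occurs, of "{w, 2 * m + i}" c] by simp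
    have "card (\<gamma> ` ?N) \<le> max 1 (card ?N - 1)"
    proof -
      let ?v = "4 * m + c"
      have v: "?v < core" "?v < order" using c core_le by (auto simp: core_def)
      have "\<sigma> ` {e \<in> edges. ?v \<in> e} = \<gamma> ` ?N" using v by (subst high) (simp_all add: adj_clause)
      moreover have "quota ?v = max 1 (card ?N - 1)" using v by (simp add: quota_def occurs_count)
      ultimately show ?thesis using feas[OF v(2)] by simp
    qed
    then have "\<not> inj_on \<gamma> ?N" using two by (auto dest!: card_image)
    then obtain u u' where u: "occurs c u" "occurs c u'" "\<gamma> u = \<gamma> u'" "u < u'"
      unfolding inj_on_def by (metis linorder_neqE_nat mem_Collect_eq)
    have val': "\<exists>z. (z = i \<or> z = m + i) \<and> \<gamma> (2 * m + i) = \<gamma> z" if "i < m" for i using val[OF that]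
        by blast
    \<comment> \<open>If the larger vertex were an anchor, so would be the smaller one, and distinct
      anchors have distinct colors.\<close>
    have "2 * m \<le> u'"
      using anchors[of u u'] u by fastforce
    define j where "j = u' - 2 * m"
    have j: "u' = 2 * m + j" "j < m" using \<open>2 * m \<le> u'\<close> u(2) by (auto simp: j_def occurs_def)
    obtain z where z: "z = j \<or> z = m + j" "\<gamma> u' = \<gamma> z" using val' j by blast
    show "\<exists>i<m. pos c i \<and> \<gamma> (2 * m + i) = \<gamma> i \<or> neg c i \<and> \<gamma> (2 * m + i) \<noteq> \<gamma> i"
    proof (cases "u < 2 * m")
      case True
      then have uz: "u = z" using anchors[of u z] z u(3) j(2) by auto
      show ?thesis
      proof (cases "z = j")
        case True
        then have "pos c j" using u(1) uz j(2) by (simp add: occurs_def)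
        then show ?thesis using z j True by auto
      next
        case False
        then have "neg c j" using u(1) uz j(2) z(1) by (auto simp: occurs_def)
        moreover have "\<gamma> (m + j) \<noteq> \<gamma> j" using anchors[of "m + j" j] j(2) by auto
        ultimately show ?thesis using z j False by auto
      qed
    next
      case False
      \<comment> \<open>Two values of equal color share an anchor, hence belong to the same
        variable, against \<open>u < u'\<close>.\<close>
      define i where "i = u - 2 * m"
      have i: "u = 2 * m + i" "i < m" using False u(1) by (auto simp: i_def occurs_def)
      obtain y where y: "y = i \<or> y = m + i" "\<gamma> u = \<gamma> y" using val' i by blast
      have "y = z" using anchors[of y z] y z u(3) i(2) j(2) by auto
      then show ?thesis using y z i j u(4) by auto
    qed
  qed
qed

theorem q_colorable_iff_satisfiable:
  "q_colorable {..<order} edges quota cap \<longleftrightarrow> satisfiable m C pos neg"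
  using colorable_if_satisfiable satisfiable_if_colorable by blast

text \<open>Row by row, in the order in which the nested loops of the reduction emit the
  pairs.\<close>

definition edge_list :: "(nat \<times> nat) list" where
  "edge_list = concat (map (\<lambda>u. concat (map (\<lambda>v. if adj u v then [(u, v)] else []) [0..<order]))
      [0..<order])"

lemma set_edge_list: "set edge_list = {(u, v). adj u v}"
  using adj_bounds by (fastforce simp: edge_list_def)

lemma edge_set_edge_list: "edge_set edge_list = edges"
  unfolding edge_set_def set_edge_list edges_def by auto

lemma valid_instance: "valid_instance (map quota [0..<order]) edge_list"
proof -
  have row: "concat (map (\<lambda>v. if adj u v then [(u, v)] else []) vs) = map (Pair u)
      (filter (adj u) vs)" for u vs
    by (induction vs) auto
  have "distinct (concat (map (\<lambda>u. map (Pair u) (filter (adj u) [0..<order])) us))" if "distinct us"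
      for us
    using that by (induction us) (auto simp: distinct_map inj_on_def)
  then have "distinct edge_list" unfolding edge_list_def row by simp
  moreover have "0 < quota v" for v by (simp add: quota_def less_max_iff_disj)
  moreover have "u < v \<and> v < order" if "(u, v) \<in> set edge_list" for u v
    using that adj_bounds unfolding set_edge_list by blast
  ultimately show ?thesis unfolding valid_instance_def by auto
qed

lemma enc_instance_in_iff:
  "enc_instance (map quota [0..<order]) edge_list cap \<in> min_max_edge_q_coloring \<longleftrightarrow> satisfiable m C
      pos neg"
proof -
  have "q_colorable {..<order} edges (\<lambda>v. map quota [0..<order] ! v) cap \<longleftrightarrow> q_colorable {..<order}
      edges quota cap"
    by (simp add: q_colorable_def feasible_coloring_def)
  moreover have "enc_instance (map quota [0..<order]) edge_list cap \<in> min_max_edge_q_coloring \<longleftrightarrow>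
      q_colorable {..<order} edges (\<lambda>v. map quota [0..<order] ! v) cap"
    using valid_instance by (auto simp: min_max_edge_q_coloring_def enc_instance_inj
        edge_set_edge_list)
  ultimately show ?thesis using q_colorable_iff_satisfiable by simp
qed

end

section \<open>The computation tableau\<close>

text \<open>This packs the symbols under \<open>k\<close> heads into one number below
  \<open>G ^ k\<close>.\<close>

lemma ex_digits:
  fixes r :: "nat \<Rightarrow> nat"
  assumes "\<And>j. j < k \<Longrightarrow> r j < G"
  shows "\<exists>w < G ^ k. \<forall>j<k. w div G ^ j mod G = r j"
  using assms
proof (induction k arbitrary: r)
  case (Suc k)
  obtain w where w: "w < G ^ k" "\<And>j. j < k \<Longrightarrow> w div G ^ j mod G = r (Suc j)"
    using Suc.IH[of "\<lambda>j. r (Suc j)"] Suc.prems by auto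
  have r0: "r 0 < G" using Suc.prems by simp
  have "r 0 + G * w < G ^ Suc k"
  proof -
    have "r 0 + G * w < G * Suc w" using r0 by simp
    also have "\<dots> \<le> G * G ^ k" using w(1) by (intro mult_le_mono2) simp
    finally show ?thesis by simp
  qed
  moreover have "(r 0 + G * w) div G ^ j mod G = r j" if "j < Suc k" for j
    using that r0 w(2) by (cases j) (simp_all add: div_mult2_eq)
  ultimately show ?case by blast
qed simp

section \<open>One machine step as a local rule\<close>

definition reading :: "tape \<Rightarrow> nat" where
  "reading tp = fst tp (snd tp)"

definition wf_config :: "tm \<Rightarrow> config \<Rightarrow> bool" where
  "wf_config M c \<longleftrightarrow> fst c < nstates M \<and> length (snd c) = ntapes M \<and>
      (\<forall>j<ntapes M. \<forall>z. fst (snd c ! j) z < nsyms M)"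

text \<open>Halting is recast as a transition that rewrites the symbols read and stays, so a step
  has the same form in every state and the tableau can run up to a fixed time.\<close>

definition moves :: "tm \<Rightarrow> nat \<Rightarrow> nat list \<Rightarrow> nat \<times> (nat \<times> move) list" where
  "moves M s r = (if s = halt M then (s, map (\<lambda>a. (a, MStay)) r) else trans M s r)"

lemma moves_wf:
  assumes "wf_tm M" "s < nstates M" "length r = ntapes M" "set r \<subseteq> {..<nsyms M}"
  shows "fst (moves M s r) < nstates M" "length (snd (moves M s r)) = ntapes M"
    "j < ntapes M \<Longrightarrow> fst (snd (moves M s r) ! j) < nsyms M"
proof -
  have "fst (moves M s r) < nstates M \<and> length (snd (moves M s r)) = ntapes M \<and>
      fst ` set (snd (moves M s r)) \<subseteq> {..<nsyms M}"
    using assms unfolding wf_tm_def moves_def by auto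
  then show "fst (moves M s r) < nstates M" "length (snd (moves M s r)) = ntapes M"
    "j < ntapes M \<Longrightarrow> fst (snd (moves M s r) ! j) < nsyms M" by (auto simp: image_subset_iff)
qed

lemma step_moves:
  assumes "length (snd c) = ntapes M"
  shows "step M c = (let (s', as) = moves M (fst c) (map reading (snd c)) in
      (s', map2 act as (snd c)))"
proof (cases c)
  case (Pair s ts)
  have "map2 act (map ((\<lambda>a. (a, MStay)) \<circ> reading) ts) ts = ts" for ts
    by (induction ts) (auto simp: act_def reading_def)
  moreover have "(\<lambda>(f, h). f h) = reading"
    by (simp add: fun_eq_iff reading_def)
  ultimately show ?thesis using Pair by (simp add: step_def moves_def)
qed

lemma reading_subset: "wf_config M c \<Longrightarrow> set (map reading (snd c)) \<subseteq> {..<nsyms M}"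
proof
  fix y assume wf: "wf_config M c" and "y \<in> set (map reading (snd c))"
  then obtain i where "i < length (snd c)" "y = reading (snd c ! i)" by
      (auto simp: in_set_conv_nth simp del: split_paired_Ex)
  then show "y \<in> {..<nsyms M}" using wf by (simp add: wf_config_def reading_def)
qed

lemma wf_config_step:
  assumes "wf_tm M" "wf_config M c"
  shows "wf_config M (step M c)"
proof -
  have len: "length (snd c) = ntapes M" using assms(2) by (simp add: wf_config_def)
  obtain s' as where sa: "moves M (fst c) (map reading (snd c)) = (s', as)" by fastforce
  note w = moves_wf[OF assms(1) _ _ reading_subset[OF assms(2)], of "fst c", unfolded sa]
  have s: "fst c < nstates M" using assms(2) by (simp add: wf_config_def)
  have "fst (act a tp) z < nsyms M" if "fst a < nsyms M" "\<And>z. fst tp z < nsyms M" for a tp z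
    using that by (auto simp: act_def split: prod.splits)
  then show ?thesis
    using w s assms(2) len unfolding step_moves[OF len] sa by (auto simp: wf_config_def)
qed

lemma tape_of_le: "tape_of x z \<le> 2"
  by (simp add: tape_of_def)

lemma wf_config_init: "wf_tm M \<Longrightarrow> wf_config M (init M x)"
  by (auto simp: wf_tm_def wf_config_def init_def nth_Cons' intro: le_less_trans[OF tape_of_le])

section \<open>The tape holding input and certificate\<close>

lemma pair_enc_length: "length (pair_enc x u) = 2 * length x + 1 + length u"
  by (induction x) auto

lemma pair_enc_nth:
  "i < length x \<Longrightarrow> pair_enc x u ! (2 * i)" "i < length x \<Longrightarrow> pair_enc x u ! Suc (2 * i) = x ! i"
  "\<not> pair_enc x u ! (2 * length x)" "pair_enc x u ! Suc (2 * length x + i) = u ! i"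
proof (induction x arbitrary: i)
  case (Cons b x)
  {
    case 1
    then show ?case using Cons(1) by (cases i) auto
  next
    case 2
    then show ?case using Cons(2) by (cases i) auto
  next
    case 3
    then show ?case using Cons(3) by auto
  next
    case 4
    then show ?case using Cons(4) by auto
  }
qed auto

text \<open>The part of \<open>pair_enc x u\<close> that is independent of \<open>u\<close>: True
  before each bit at the even cells, the bits of \<open>x\<close> at the odd cells, and the end mark
  False at cell \<open>2 * length x\<close>.\<close>

definition fixed_symbol :: "bool list \<Rightarrow> nat \<Rightarrow> nat" where
  "fixed_symbol x z = (if z < 2 * length x then (if even z then 2 else tape_of x (int (z div 2)))
     else of_bool (z = 2 * length x))"

lemma tape_of_pair_enc:
  "z \<le> 2 * length x \<Longrightarrow> tape_of (pair_enc x u) (int z) = fixed_symbol x z"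
  "tape_of (pair_enc x u) (int (Suc (2 * length x + i))) = tape_of u (int i)"
proof -
  assume z: "z \<le> 2 * length x"
  consider "z = 2 * length x" | i where "z = 2 * i" "i < length x" | i where "z = Suc (2 * i)" "i <
      length x"
    using z by (cases "even z") (auto elim!: evenE oddE simp: le_less)
  then show "tape_of (pair_enc x u) (int z) = fixed_symbol x z"
    by cases (auto simp: tape_of_def fixed_symbol_def pair_enc_length pair_enc_nth nat_add_distrib
        nat_mult_distrib)
next
  have "nat (1 + (2 * int (length x) + int i)) = Suc (2 * length x + i)" by simp
  then show "tape_of (pair_enc x u) (int (Suc (2 * length x + i))) = tape_of u (int i)"
    by (simp add: tape_of_def pair_enc_length pair_enc_nth)
qed

locale tableau =
  fixes M :: tm and x :: "bool list" and P T :: nat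
  assumes wf: "wf_tm M"
begin

abbreviation "k \<equiv> ntapes M"
abbreviation "S \<equiv> nstates M"
abbreviation "G \<equiv> nsyms M"
definition W :: nat where "W = S * G ^ k"
text \<open>A base above all digits: rule numbers up to 10, times, tapes, cells up to
  \<open>2 * T + 1\<close>, and states, symbols and codes, which are all below
  \<open>W\<close>.\<close>

definition B :: nat where "B = 2 * T + (W + k + 12)"

lemma sizes: "0 < k" "0 < S" "3 \<le> G" "S \<le> W" "G \<le> W"
proof -
  show *: "0 < k" "0 < S" "3 \<le> G" using wf by (auto simp: wf_tm_def)
  then show "S \<le> W" by (simp add: W_def)
  have "G ^ 1 \<le> G ^ k" using * by (intro power_increasing) auto
  then show "G \<le> W" using * mult_le_mono[of 1 S G "G ^ k"] by (simp add: W_def)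
qed

text \<open>A number \<open>v < W\<close> codes a state together with the symbols under the heads.\<close>

definition state_of :: "nat \<Rightarrow> nat" where "state_of v = v mod S"
definition read_of :: "nat \<Rightarrow> nat \<Rightarrow> nat" where "read_of v j = v div S div G ^ j mod G"
definition moves_of :: "nat \<Rightarrow> nat \<times> (nat \<times> move) list" where
  "moves_of v = moves M (state_of v) (map (read_of v) [0..<k])"
definition next_of :: "nat \<Rightarrow> nat" where "next_of v = fst (moves_of v)"
definition write_of :: "nat \<Rightarrow> nat \<Rightarrow> nat" where "write_of v j = fst (snd (moves_of v) ! j)"
text \<open>The displacement plus one, to stay within the natural numbers; the new cell is
  \<open>p + shift_of v j - 1\<close>.\<close>

definition shift_of :: "nat \<Rightarrow> nat \<Rightarrow> nat" where
  "shift_of v j = (case snd (snd (moves_of v) ! j) of MLeft \<Rightarrow> 0 | MStay \<Rightarrow> 1 | MRight \<Rightarrow> 2)"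

lemma of_bounds: "state_of v < S" "read_of v j < G" "next_of v < S" "j < k \<Longrightarrow> write_of v j < G"
proof -
  show *: "state_of v < S" "read_of v j < G" for j using sizes by
      (simp_all add: state_of_def read_of_def)
  have "set (map (read_of v) [0..<k]) \<subseteq> {..<G}" using * by auto
  from moves_wf[OF wf *(1) _ this] show "next_of v < S" "j < k \<Longrightarrow> write_of v j < G"
    by (simp_all add: next_of_def write_of_def moves_of_def)
qed

lemma ex_code:
  assumes "wf_config M c"
  shows "\<exists>v<W. fst c = state_of v \<and> (\<forall>j<k. reading (snd c ! j) = read_of v j)"
proof -
  obtain w where w: "w < G ^ k" "\<And>j. j < k \<Longrightarrow> w div G ^ j mod G = reading (snd c ! j)"
    using ex_digits[of k "\<lambda>j. reading (snd c ! j)" G] assms by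
        (auto simp: wf_config_def reading_def)
  have s: "fst c < S" using assms by (simp add: wf_config_def)
  have "fst c + S * w < S * Suc w" using s by simp
  also have "\<dots> \<le> W" unfolding W_def using w(1) by (intro mult_le_mono2) simp
  finally have "fst c + S * w < W" .
  then show ?thesis using s w(2) by (intro exI[of _ "fst c + S * w"])
      (simp add: state_of_def read_of_def)
qed

text \<open>The code \<open>v\<close> alone determines the next state, the written symbols and the
  moves. This is the locality on which the tableau rests.\<close>

lemma step_code:
  assumes "wf_config M c" "fst c = state_of v" "\<forall>j<k. reading (snd c ! j) = read_of v j"
  shows "fst (step M c) = next_of v"
    and "j < k \<Longrightarrow> fst (snd (step M c) ! j) = (fst (snd c ! j))(snd (snd c ! j) := write_of v j)"
    and "j < k \<Longrightarrow> snd (snd (step M c) ! j) = snd (snd c ! j) + int (shift_of v j) - 1"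
proof -
  have len: "length (snd c) = k" using assms(1) by (simp add: wf_config_def)
  have r: "map reading (snd c) = map (read_of v) [0..<k]"
    using assms(3) len by (auto simp: list_eq_iff_nth_eq)
  have m: "moves M (fst c) (map reading (snd c)) = moves_of v" unfolding r assms(2) moves_of_def ..
  have l: "length (snd (moves_of v)) = k"
    using moves_wf(2)[OF wf _ _ reading_subset[OF assms(1)], of "fst c"] assms(1) len unfolding m by
        (simp add: wf_config_def)
  show "fst (step M c) = next_of v"
    unfolding step_moves[OF len] m next_of_def by (simp add: case_prod_beta Let_def)
  assume j: "j < k"
  have *: "snd (step M c) ! j = act (snd (moves_of v) ! j) (snd c ! j)"
    unfolding step_moves[OF len] m using j l len by (simp add: case_prod_beta Let_def)
  show "fst (snd (step M c) ! j) = (fst (snd c ! j))(snd (snd c ! j) := write_of v j)"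
    unfolding * write_of_def act_def by (simp add: case_prod_beta)
  show "snd (snd (step M c) ! j) = snd (snd c ! j) + int (shift_of v j) - 1"
    unfolding * shift_of_def act_def by (simp add: case_prod_beta split: move.split)
qed

text \<open>The propositions of the tableau, \<open>\<tau> \<kappa> t j p a\<close>, for time \<open>t\<close>, tape \<open>j\<close> and cell \<open>p\<close> (shifted
  by \<open>T\<close>): \<open>\<kappa> = 0\<close>: the state is \<open>a\<close>; \<open>\<kappa> = 1\<close>: the head is on the cell; \<open>\<kappa> = 2\<close>: the cell
  contains \<open>a\<close>; \<open>\<kappa> = 3\<close>: the head reads \<open>a\<close>; \<open>\<kappa> = 4\<close>: \<open>a\<close> codes the state and the symbols read.
  All rules except the choice of the certificate are Horn clauses, so that no uniqueness
  conditions are needed.\<close>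

definition cert :: "nat \<Rightarrow> nat \<Rightarrow> bool" where
  "cert j p \<longleftrightarrow> j = 0 \<and> T + 2 * length x < p \<and> p \<le> T + 2 * length x + P"

text \<open>On a certificate cell the choices \<open>a = 0, 1, 2\<close> differ; elsewhere they
  coincide, so the disjunction over them in \<open>rules\<close> forces the known symbol.\<close>

definition init_symbol :: "nat \<Rightarrow> nat \<Rightarrow> nat \<Rightarrow> nat" where
  "init_symbol j p a = (if cert j p then a else if j = 0 \<and> T \<le> p then fixed_symbol x (p - T) else
      0)"

text \<open>The fourth conjunct propagates blanks to the right within the certificate area, so that
  its content is a word followed by blanks. The last one states acceptance negatively: symbol 1 in
  cell 0 of the output tape would be the answer False.\<close>

definition rules :: "(nat \<Rightarrow> nat \<Rightarrow> nat \<Rightarrow> nat \<Rightarrow> nat \<Rightarrow> bool) \<Rightarrow> bool" where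
  "rules \<tau> \<longleftrightarrow> \<tau> 0 0 0 0 (start M) \<and>
    (\<forall>j<k. \<tau> 1 0 j T 0) \<and>
    (\<forall>j<k. \<forall>p\<le>2 * T. \<tau> 2 0 j p (init_symbol j p 0) \<or> \<tau> 2 0 j p (init_symbol j p 1) \<or> \<tau> 2 0 j p
        (init_symbol j p 2)) \<and>
    (\<forall>p<2 * T. cert 0 p \<longrightarrow> \<tau> 2 0 0 p 0 \<longrightarrow> \<tau> 2 0 0 (p + 1) 0) \<and>
    (\<forall>t<T. \<forall>j<k. \<forall>p\<le>2 * T. \<forall>v<W. \<tau> 1 t j p 0 \<longrightarrow> \<tau> 2 t j p v \<longrightarrow> \<tau> 3 t j 0 v) \<and>
    (\<forall>t<T. \<forall>v<W. \<tau> 0 t 0 0 (state_of v) \<longrightarrow> (\<forall>j<k. \<tau> 3 t j 0 (read_of v j)) \<longrightarrow> \<tau> 4 t 0 0 v) \<and>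
    (\<forall>t<T. \<forall>v<W. \<tau> 4 t 0 0 v \<longrightarrow> \<tau> 0 (t + 1) 0 0 (next_of v)) \<and>
    (\<forall>t<T. \<forall>j<k. \<forall>p\<le>2 * T. \<forall>v<W. \<tau> 4 t 0 0 v \<longrightarrow> \<tau> 1 t j p 0 \<longrightarrow> \<tau> 1 (t + 1) j (p + shift_of v j - 1) 0)
        \<and>
    (\<forall>t<T. \<forall>j<k. \<forall>p\<le>2 * T. \<forall>v<W. \<tau> 4 t 0 0 v \<longrightarrow> \<tau> 1 t j p 0 \<longrightarrow> \<tau> 2 (t + 1) j p (write_of v j)) \<and>
    (\<forall>t<T. \<forall>j<k. \<forall>p\<le>2 * T. \<forall>q\<le>2 * T. \<forall>v<W. p \<noteq> q \<longrightarrow> \<tau> 1 t j q 0 \<longrightarrow> \<tau> 2 t j p v \<longrightarrow> \<tau> 2 (t + 1) j p v) \<and>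
    \<not> \<tau> 2 T (k - 1) T 1"

definition conf :: "bool list \<Rightarrow> nat \<Rightarrow> config" where
  "conf u t = (step M ^^ t) (init M (pair_enc x u))"

lemma conf_Suc: "conf u (Suc t) = step M (conf u t)"
  by (simp add: conf_def)

lemma wf_conf: "wf_config M (conf u t)"
  by (induction t) (simp_all add: conf_def wf_config_init[OF wf] wf_config_step[OF wf])

text \<open>A head moves one cell per step at most, so up to time \<open>T\<close> it stays among
  the \<open>2 * T + 1\<close> cells of the window.\<close>

lemma head_bound:
  assumes "j < k"
  shows "\<bar>snd (snd (conf u t) ! j)\<bar> \<le> int t"
proof (induction t)
  case 0
  then show ?case using assms by (simp add: conf_def init_def nth_Cons')
next
  case (Suc t)
  obtain v where v: "fst (conf u t) = state_of v" "\<forall>j<k. reading (snd (conf u t) ! j) = read_of v j"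
    using ex_code[OF wf_conf] by blast
  have "shift_of v j \<le> 2" by (simp add: shift_of_def split: move.split)
  then show ?case using Suc step_code(3)[OF wf_conf v assms] by (simp add: conf_Suc)
qed

definition truth :: "bool list \<Rightarrow> nat \<Rightarrow> nat \<Rightarrow> nat \<Rightarrow> nat \<Rightarrow> nat \<Rightarrow> bool" where
  "truth u \<kappa> t j p a = (let (s, ts) = conf u t in
     if \<kappa> = 0 then s = a else if \<kappa> = 1 then int p = int T + snd (ts ! j)
     else if \<kappa> = 2 then fst (ts ! j) (int p - int T) = a
     else if \<kappa> = 3 then reading (ts ! j) = a
     else s = state_of a \<and> (\<forall>j<k. reading (ts ! j) = read_of a j))"

lemma init_cell:
  assumes "j < k" "length u \<le> P"
  shows "fst (snd (conf u 0) ! j) (int p - int T) =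
    (if cert j p then tape_of u (int (p - Suc (T + 2 * length x))) else init_symbol j p 0)"
proof (cases "j = 0 \<and> T \<le> p")
  case True
  then have 0: "fst (snd (conf u 0) ! j) (int p - int T) = tape_of (pair_enc x u) (int (p - T))"
    by (simp add: conf_def init_def of_nat_diff)
  show ?thesis
  proof (cases "p \<le> T + 2 * length x")
    case le: True
    then show ?thesis unfolding 0 using True
      by (simp add: tape_of_pair_enc(1) cert_def init_symbol_def del: of_nat_diff)
  next
    case False
    define i where "i = p - Suc (T + 2 * length x)"
    have p: "p = Suc (T + 2 * length x + i)" using False by (simp add: i_def)
    have "tape_of (pair_enc x u) (int (p - T)) = tape_of u (int i)"
      using tape_of_pair_enc(2)[of x u i] by (simp add: p)
    moreover have "tape_of u (int i) = 0" if "\<not> cert j p"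
      using that True assms(2) by (auto simp: cert_def p tape_of_def)
    ultimately show ?thesis unfolding 0 using True
      by (auto simp: init_symbol_def p fixed_symbol_def)
  qed
next
  case False
  then show ?thesis using assms(1)
    by (auto simp: conf_def init_def nth_Cons' tape_of_def cert_def init_symbol_def)
qed

lemma rules_truth:
  assumes u: "length u \<le> P" and acc: "fst (snd (conf u T) ! (k - 1)) 0 \<noteq> 1"
  shows "rules (truth u)"
proof -
  have I: "truth u 2 0 j p (init_symbol j p 0) \<or> truth u 2 0 j p (init_symbol j p 1) \<or> truth u 2 0 j
      p (init_symbol j p 2)"
    if "j < k" for j p
  proof -
    have "tape_of u z = 0 \<or> tape_of u z = 1 \<or> tape_of u z = 2" for z by (simp add: tape_of_def)
    then show ?thesis using init_cell[OF that u, of p]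
      by (auto simp: truth_def init_symbol_def case_prod_beta)
  qed
  have C: "truth u 2 0 0 (p + 1) 0" if "cert 0 p" "truth u 2 0 0 p 0" for p
  proof -
    let ?i = "p - Suc (T + 2 * length x)"
    have "tape_of u (int ?i) = 0" using init_cell[OF sizes(1) u, of p] that by
        (simp add: truth_def case_prod_beta)
    then have "length u \<le> ?i" by (auto simp: tape_of_def split: if_splits)
    then have 1: "tape_of u (int (Suc ?i)) = 0" by (simp add: tape_of_def)
    have "T + 2 * length x < p" using that(1) by (simp add: cert_def)
    then have "Suc ?i = Suc p - Suc (T + 2 * length x)" by simp
    then show ?thesis using init_cell[OF sizes(1) u, of "p + 1"] 1 \<open>T + 2 * length x < p\<close>
      by (auto simp: truth_def case_prod_beta init_symbol_def fixed_symbol_def)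
  qed
  have S: "truth u 0 (t + 1) 0 0 (next_of v)" if "truth u 4 t 0 0 v" for t v
    using that step_code(1)[OF wf_conf, of u t v] by (simp add: truth_def case_prod_beta conf_Suc)
  \<comment> \<open>The head is at distance at most \<open>t < T\<close> from the origin, so
    \<open>p\<close> is positive and the subtraction does not truncate.\<close>
  have H: "truth u 1 (t + 1) j (p + shift_of v j - 1) 0" if "truth u 4 t 0 0 v" "truth u 1 t j p 0"
      "j < k" "t < T" for t v j p
    using that step_code(3)[OF wf_conf, of u t v j] head_bound[OF that(3), of u t]
    by (auto simp: truth_def case_prod_beta conf_Suc of_nat_diff)
  have Wr: "truth u 2 (t + 1) j p (write_of v j)" if "truth u 4 t 0 0 v" "truth u 1 t j p 0" "j < k"
      for t v j p
    using that step_code(2)[OF wf_conf, of u t v j] by (auto simp: truth_def case_prod_beta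
        conf_Suc)
  have In: "truth u 2 (t + 1) j p a" if "p \<noteq> q" "truth u 1 t j q 0" "truth u 2 t j p a" "j < k" for
      t j p q a
  proof -
    obtain v where v: "fst (conf u t) = state_of v" "\<forall>j<k. reading (snd (conf u t) ! j) = read_of v
        j"
      using ex_code[OF wf_conf] by blast
    then show ?thesis using that step_code(2)[OF wf_conf v that(4)]
      by (auto simp: truth_def case_prod_beta conf_Suc)
  qed
  have start: "truth u 0 0 0 0 (start M)" by (simp add: truth_def conf_def init_def)
  have head: "truth u 1 0 j T 0" if "j < k" for j
    using that by (simp add: truth_def conf_def init_def nth_Cons')
  have rd: "truth u 3 t j 0 v" if "truth u 1 t j p 0" "truth u 2 t j p v" for t j p v
    using that by (auto simp: truth_def case_prod_beta reading_def)
  have code: "truth u 4 t 0 0 v" if "truth u 0 t 0 0 (state_of v)" "\<forall>j<k. truth u 3 t j 0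
      (read_of v j)" for t v
    using that by (auto simp: truth_def case_prod_beta)
  have final: "\<not> truth u 2 T (k - 1) T 1" using acc by (simp add: truth_def case_prod_beta)
  show ?thesis
    unfolding rules_def
    by (intro conjI allI impI) ((rule I, assumption) | blast intro: start head I C rd code S H Wr In
        dest: final[THEN notE])+
qed

text \<open>\<open>\<tau>\<close> may assert several symbols for one cell, so a certificate is
  extracted by choice, and the induction over time shows only that everything true of its run holds
  in \<open>\<tau>\<close>. That suffices: the rejecting symbol is absent from
  \<open>\<tau>\<close>, hence from the run.\<close>

lemma truth_of_rules:
  assumes "rules \<tau>" and T: "2 * length x + P < T"
  shows "\<exists>u. length u \<le> P \<and> fst (snd (conf u T) ! (k - 1)) 0 \<noteq> 1"
proof -
  note R = assms(1)[unfolded rules_def]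
  have start: "\<tau> 0 0 0 0 (start M)"
    using R[THEN conjunct1] by blast
  have head: "\<And>j. j < k \<Longrightarrow> \<tau> 1 0 j T 0"
    using R[THEN conjunct2, THEN conjunct1] by blast
  have I: "\<And>j p. j < k \<Longrightarrow> p \<le> 2 * T \<Longrightarrow> \<tau> 2 0 j p (init_symbol j p 0) \<or> \<tau> 2 0 j p (init_symbol j p 1) \<or>
      \<tau> 2 0 j p (init_symbol j p 2)"
    using R[THEN conjunct2, THEN conjunct2, THEN conjunct1] by blast
  have C: "\<And>p. p < 2 * T \<Longrightarrow> cert 0 p \<Longrightarrow> \<tau> 2 0 0 p 0 \<Longrightarrow> \<tau> 2 0 0 (p + 1) 0"
    using R[THEN conjunct2, THEN conjunct2, THEN conjunct2, THEN conjunct1] by blast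
  have rd: "\<And>t j p v. t < T \<Longrightarrow> j < k \<Longrightarrow> p \<le> 2 * T \<Longrightarrow> v < W \<Longrightarrow> \<tau> 1 t j p 0 \<Longrightarrow> \<tau> 2 t j p v \<Longrightarrow> \<tau> 3 t j 0 v"
    using R[THEN conjunct2, THEN conjunct2, THEN conjunct2, THEN conjunct2, THEN conjunct1] by blast
  have code: "\<And>t v. t < T \<Longrightarrow> v < W \<Longrightarrow> \<tau> 0 t 0 0 (state_of v) \<Longrightarrow> (\<forall>j<k. \<tau> 3 t j 0 (read_of v j)) \<Longrightarrow> \<tau> 4 t
      0 0 v"
    using R[THEN conjunct2, THEN conjunct2, THEN conjunct2, THEN conjunct2, THEN conjunct2, THEN
        conjunct1] by blast
  have S: "\<And>t v. t < T \<Longrightarrow> v < W \<Longrightarrow> \<tau> 4 t 0 0 v \<Longrightarrow> \<tau> 0 (t + 1) 0 0 (next_of v)"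
    using R[THEN conjunct2, THEN conjunct2, THEN conjunct2, THEN conjunct2, THEN conjunct2, THEN
        conjunct2, THEN conjunct1] by blast
  have H: "\<And>t j p v. t < T \<Longrightarrow> j < k \<Longrightarrow> p \<le> 2 * T \<Longrightarrow> v < W \<Longrightarrow> \<tau> 4 t 0 0 v \<Longrightarrow> \<tau> 1 t j p 0 \<Longrightarrow> \<tau> 1 (t + 1) j
      (p + shift_of v j - 1) 0"
    using R[THEN conjunct2, THEN conjunct2, THEN conjunct2, THEN conjunct2, THEN conjunct2, THEN
        conjunct2, THEN conjunct2, THEN conjunct1] by blast
  have Wr: "\<And>t j p v. t < T \<Longrightarrow> j < k \<Longrightarrow> p \<le> 2 * T \<Longrightarrow> v < W \<Longrightarrow> \<tau> 4 t 0 0 v \<Longrightarrow> \<tau> 1 t j p 0 \<Longrightarrow> \<tau> 2 (t + 1) j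
      p (write_of v j)"
    using R[THEN conjunct2, THEN conjunct2, THEN conjunct2, THEN conjunct2, THEN conjunct2, THEN
        conjunct2, THEN conjunct2, THEN conjunct2, THEN conjunct1] by blast
  have In: "\<And>t j p q v. t < T \<Longrightarrow> j < k \<Longrightarrow> p \<le> 2 * T \<Longrightarrow> q \<le> 2 * T \<Longrightarrow> v < W \<Longrightarrow> p \<noteq> q \<Longrightarrow> \<tau> 1 t j q 0 \<Longrightarrow> \<tau> 2 t
      j p v \<Longrightarrow> \<tau> 2 (t + 1) j p v"
    using R[THEN conjunct2, THEN conjunct2, THEN conjunct2, THEN conjunct2, THEN conjunct2, THEN
        conjunct2, THEN conjunct2, THEN conjunct2, THEN conjunct2, THEN conjunct1] by blast
  have final: "\<not> \<tau> 2 T (k - 1) T 1"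
    using R[THEN conjunct2, THEN conjunct2, THEN conjunct2, THEN conjunct2, THEN conjunct2, THEN
        conjunct2, THEN conjunct2, THEN conjunct2, THEN conjunct2, THEN conjunct2] by blast
  let ?c = "\<lambda>i. Suc (T + 2 * length x + i)"
  \<comment> \<open>The first certificate cell marked blank, or \<open>P\<close> if there is none;
    from there on the blank rule marks all certificate cells.\<close>
  define l where "l = (LEAST l. l = P \<or> \<tau> 2 0 0 (?c l) 0)"
  have l: "l = P \<or> \<tau> 2 0 0 (?c l) 0" "l \<le> P"
    unfolding l_def by (rule LeastI[of _ P], simp) (rule Least_le, simp)
  have below: "\<not> \<tau> 2 0 0 (?c i) 0" if "i < l" for i using that not_less_Least unfolding l_def by
      blast
  have above: "\<tau> 2 0 0 (?c i) 0" if "l \<le> i" "i < P" for i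
    using that
  proof (induction i rule: dec_induct)
    case base
    then show ?case using l by auto
  next
    case (step i)
    then show ?case using C[of "?c i"] T by (simp add: cert_def)
  qed
  \<comment> \<open>A cell below \<open>l\<close> is not marked blank, so it carries 1 or 2; where
    both are asserted, 2 is taken.\<close>
  define u where "u = map (\<lambda>i. \<tau> 2 0 0 (?c i) 2) [0..<l]"
  have u: "length u \<le> P" using l(2) by (simp add: u_def)
  have cells0: "\<tau> 2 0 j p (fst (snd (conf u 0) ! j) (int p - int T))" if j: "j < k" and p: "p \<le> 2 *
      T" for j p
  proof (cases "cert j p")
    case True
    define i where "i = p - Suc (T + 2 * length x)"
    have pi: "p = ?c i" "i < P" "j = 0" using True by (auto simp: cert_def i_def)
    have *: "\<tau> 2 0 0 p 0 \<or> \<tau> 2 0 0 p 1 \<or> \<tau> 2 0 0 p 2" using I[OF j p] True pi(3) by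
        (simp add: init_symbol_def)
    have "\<tau> 2 0 0 p (tape_of u (int i))"
    proof (cases "i < l")
      case True
      then have "tape_of u (int i) = (if \<tau> 2 0 0 p 2 then 2 else 1)" by
          (simp add: tape_of_def u_def pi(1))
      then show ?thesis using * below[OF True] pi(1) by auto
    next
      case False
      then have "tape_of u (int i) = 0" by (simp add: tape_of_def u_def)
      then show ?thesis using above[of i] False pi by simp
    qed
    then show ?thesis using init_cell[OF j u, of p] True pi(3) by (simp add: i_def)
  next
    case False
    then show ?thesis using init_cell[OF j u, of p] I[OF j p] by (auto simp: init_symbol_def)
  qed
  have "\<tau> 0 t 0 0 (fst (conf u t)) \<and> (\<forall>j<k. \<tau> 1 t j (nat (int T + snd (snd (conf u t) ! j))) 0) \<and>
     (\<forall>j<k. \<forall>p\<le>2 * T. \<tau> 2 t j p (fst (snd (conf u t) ! j) (int p - int T)))" if "t \<le> T" for t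
    using that
  proof (induction t)
    case 0
    have "fst (conf u 0) = start M" by (simp add: conf_def init_def)
    moreover have "snd (snd (conf u 0) ! j) = 0" if "j < k" for j
      using that by (simp add: conf_def init_def nth_Cons')
    ultimately show ?case using start head cells0 by simp
  next
    case (Suc t)
    have t: "t < T" using Suc.prems by simp
    define h where "h j = nat (int T + snd (snd (conf u t) ! j))" for j
    have h: "int (h j) = int T + snd (snd (conf u t) ! j)" "h j \<le> 2 * T" "0 < h j" if "j < k" for j
      using head_bound[OF that, of u t] t by (auto simp: h_def)
    have IH: "\<tau> 0 t 0 0 (fst (conf u t))" "\<And>j. j < k \<Longrightarrow> \<tau> 1 t j (h j) 0"
      "\<And>j p. j < k \<Longrightarrow> p \<le> 2 * T \<Longrightarrow> \<tau> 2 t j p (fst (snd (conf u t) ! j) (int p - int T))"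
      using Suc by (auto simp: h_def)
    have sym: "fst (snd (conf u t) ! j) z < W" if "j < k" for j z
      using wf_conf[of u t] that sizes(5) by (auto simp: wf_config_def intro: less_le_trans)
    obtain v where v: "v < W" "fst (conf u t) = state_of v" "\<forall>j<k. reading (snd (conf u t) ! j) =
        read_of v j"
      using ex_code[OF wf_conf] by blast
    have "\<tau> 3 t j 0 (read_of v j)" if "j < k" for j
    proof -
      have "reading (snd (conf u t) ! j) = fst (snd (conf u t) ! j) (int (h j) - int T)"
        using h(1)[OF that] by (simp add: reading_def)
      then show ?thesis using rd[OF t that h(2)[OF that] _ IH(2)[OF that]
          IH(3)[OF that h(2)[OF that]]] sym[OF that] v(3) that
        by simp
    qed
    then have Q: "\<tau> 4 t 0 0 v" using code[OF t v(1)] IH(1) v(2) by simp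
    note sc = step_code[OF wf_conf v(2,3)]
    have 1: "\<tau> 0 (Suc t) 0 0 (fst (conf u (Suc t)))" using S[OF t v(1) Q] sc(1) by
        (simp add: conf_Suc)
    have 2: "\<tau> 1 (Suc t) j (nat (int T + snd (snd (conf u (Suc t)) ! j))) 0" if "j < k" for j
    proof -
      have "nat (int T + snd (snd (conf u (Suc t)) ! j)) = h j + shift_of v j - 1"
        using sc(3)[OF that] h[OF that] by (simp add: conf_Suc)
      then show ?thesis using H[OF t that h(2)[OF that] v(1) Q IH(2)[OF that]] by simp
    qed
    have 3: "\<tau> 2 (Suc t) j p (fst (snd (conf u (Suc t)) ! j) (int p - int T))" if "j < k" "p \<le> 2 *
        T" for j p
    proof (cases "p = h j")
      case True
      then show ?thesis using Wr[OF t that v(1) Q] IH(2)[OF that(1)] sc(2)[OF that(1)]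
          h(1)[OF that(1)]
        by (simp add: conf_Suc)
    next
      case False
      then have "int p - int T \<noteq> snd (snd (conf u t) ! j)" using h(1)[OF that(1)] by auto
      then show ?thesis
        using In[OF t that h(2)[OF that(1)] sym[OF that(1)] False IH(2)[OF that(1)] IH(3)[OF that]]
            sc(2)[OF that(1)]
        by (simp add: conf_Suc)
    qed
    show ?case using 1 2 3 by blast
  qed
  then have "\<forall>j<k. \<forall>p\<le>2 * T. \<tau> 2 T j p (fst (snd (conf u T) ! j) (int p - int T))" by blast
  moreover have "k - 1 < k" "T \<le> 2 * T" using sizes(1) by simp_all
  ultimately have "\<tau> 2 T (k - 1) T (fst (snd (conf u T) ! (k - 1)) (int T - int T))" by blast
  then have "fst (snd (conf u T) ! (k - 1)) 0 \<noteq> 1" using final by auto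
  then show ?thesis using u by blast
qed

end

section \<open>Numbering of propositions and rule instances\<close>

context tableau
begin

primrec num :: "nat list \<Rightarrow> nat" where
  "num [] = 0" | "num (a # as) = a + B * num as"

definition dig :: "nat \<Rightarrow> nat \<Rightarrow> nat" where "dig i c = c div B ^ i mod B"

lemma num_less: "\<forall>a \<in> set as. a < B \<Longrightarrow> num as < B ^ length as"
proof (induction as)
  case (Cons a as)
  have "a + B * num as < B * Suc (num as)" using Cons.prems by simp
  also have "\<dots> \<le> B * B ^ length as" using Cons by (intro mult_le_mono2) (simp add: Suc_le_eq)
  finally show ?case by simp
qed simp

lemma dig_num: "\<forall>a \<in> set as. a < B \<Longrightarrow> i < length as \<Longrightarrow> dig i (num as) = as ! i"
proof (induction as arbitrary: i)
  case (Cons a as)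
  then show ?case by (cases i) (auto simp: dig_def div_mult2_eq)
qed simp

abbreviation "var \<kappa> t j p a \<equiv> num [\<kappa>, t, j, p, a]"
definition vars :: nat where "vars = B ^ 5"
text \<open>All numerals of six digits count as clauses; those that code no rule instance have no
  literals, and \<open>satisfiable\<close> ignores them.\<close>

definition clauses :: nat where "clauses = B ^ 6"

text \<open>Clause \<open>\<kappa> t j p q v\<close> is conjunct number \<open>\<kappa>\<close> of \<^const>\<open>rules\<close>, counted from 0 and instantiated with
    \<open>t j p q v\<close>.\<close>

definition guard :: "nat \<Rightarrow> nat \<Rightarrow> nat \<Rightarrow> nat \<Rightarrow> nat \<Rightarrow> bool" where
  "guard t j p q v \<longleftrightarrow> t < T \<and> j < k \<and> p \<le> 2 * T \<and> q \<le> 2 * T \<and> v < W"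

text \<open>The side conditions of rules 3 and 9 sit inside the literal tests of both signs: an
  instance violating them has no literals and thereby imposes no condition.\<close>

definition is_pos :: "nat \<Rightarrow> nat \<Rightarrow> nat \<Rightarrow> nat \<Rightarrow> nat \<Rightarrow> nat \<Rightarrow> nat \<Rightarrow> bool" where
  "is_pos \<kappa> t j p q v i \<longleftrightarrow>
     \<kappa> = 0 \<and> i = var 0 0 0 0 (start M) \<or>
     \<kappa> = 1 \<and> i = var 1 0 j T 0 \<or>
     \<kappa> = 2 \<and> (i = var 2 0 j p (init_symbol j p 0) \<or> i = var 2 0 j p (init_symbol j p 1) \<or> i = var 2
         0 j p (init_symbol j p 2)) \<or>
     \<kappa> = 3 \<and> cert 0 p \<and> i = var 2 0 0 (p + 1) 0 \<or>
     \<kappa> = 4 \<and> i = var 3 t j 0 v \<or>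
     \<kappa> = 5 \<and> i = var 4 t 0 0 v \<or>
     \<kappa> = 6 \<and> i = var 0 (t + 1) 0 0 (next_of v) \<or>
     \<kappa> = 7 \<and> i = var 1 (t + 1) j (p + shift_of v j - 1) 0 \<or>
     \<kappa> = 8 \<and> i = var 2 (t + 1) j p (write_of v j) \<or>
     \<kappa> = 9 \<and> p \<noteq> q \<and> i = var 2 (t + 1) j p v"

definition is_neg :: "nat \<Rightarrow> nat \<Rightarrow> nat \<Rightarrow> nat \<Rightarrow> nat \<Rightarrow> nat \<Rightarrow> nat \<Rightarrow> bool" where
  "is_neg \<kappa> t j p q v i \<longleftrightarrow>
     \<kappa> = 3 \<and> cert 0 p \<and> i = var 2 0 0 p 0 \<or>
     \<kappa> = 4 \<and> (i = var 1 t j p 0 \<or> i = var 2 t j p v) \<or>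
     \<kappa> = 5 \<and> (i = var 0 t 0 0 (state_of v) \<or> (\<exists>j<k. i = var 3 t j 0 (read_of v j))) \<or>
     \<kappa> = 6 \<and> i = var 4 t 0 0 v \<or>
     \<kappa> = 7 \<and> (i = var 4 t 0 0 v \<or> i = var 1 t j p 0) \<or>
     \<kappa> = 8 \<and> (i = var 4 t 0 0 v \<or> i = var 1 t j p 0) \<or>
     \<kappa> = 9 \<and> p \<noteq> q \<and> (i = var 1 t j q 0 \<or> i = var 2 t j p v) \<or>
     \<kappa> = 10 \<and> i = var 2 T (k - 1) T 1"

definition pos :: "nat \<Rightarrow> nat \<Rightarrow> bool" where
  "pos c i \<longleftrightarrow> guard (dig 1 c) (dig 2 c) (dig 3 c) (dig 4 c) (dig 5 c) \<and>
     is_pos (dig 0 c) (dig 1 c) (dig 2 c) (dig 3 c) (dig 4 c) (dig 5 c) i"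

definition neg :: "nat \<Rightarrow> nat \<Rightarrow> bool" where
  "neg c i \<longleftrightarrow> guard (dig 1 c) (dig 2 c) (dig 3 c) (dig 4 c) (dig 5 c) \<and>
     is_neg (dig 0 c) (dig 1 c) (dig 2 c) (dig 3 c) (dig 4 c) (dig 5 c) i"

text \<open>Cells reach \<open>2 * T + 1\<close>, one further than in \<open>guard\<close>, because
  a head on cell \<open>2 * T\<close> may move right.\<close>

definition in_range :: "nat \<Rightarrow> nat \<Rightarrow> nat \<Rightarrow> nat \<Rightarrow> nat \<Rightarrow> bool" where
  "in_range \<kappa> t j p a \<longleftrightarrow> \<kappa> < 5 \<and> t \<le> T \<and> j < k \<and> p \<le> 2 * T + 1 \<and> a < W"

lemma in_range_less: "in_range \<kappa> t j p a \<Longrightarrow> \<forall>d \<in> set [\<kappa>, t, j, p, a]. d < B"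
  by (auto simp: in_range_def B_def)

lemma var_less: "in_range \<kappa> t j p a \<Longrightarrow> var \<kappa> t j p a < vars"
  using num_less[OF in_range_less, of \<kappa> t j p a] unfolding vars_def numeral_nat by
      (simp only: list.size add_0 add_0_right add_Suc_right One_nat_def)

lemma symbol_less: "init_symbol j p 0 < W" "init_symbol j p 1 < W" "init_symbol j p 2 < W"
  using sizes(3,5) by (auto simp: init_symbol_def fixed_symbol_def intro:
      le_less_trans[OF tape_of_le])

lemma code_less: "next_of v < W" "state_of v < W" "read_of v j < W" "j < k \<Longrightarrow> write_of v j < W"
    "start M < W"
  using of_bounds[of v] of_bounds(4)[of j v] sizes wf by (auto simp: wf_tm_def intro: less_le_trans)

lemma shift_le: "shift_of v j \<le> 2"
  by (simp add: shift_of_def split: move.split)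

text \<open>A rule instance is the clause whose digits are its parameters. The index
  \<open>i\<close> supplied to \<open>sat\<close> witnesses that this clause has a literal, which
  \<open>satisfiable\<close> requires before it promises a true one.\<close>

lemma rules_of_satisfiable:
  assumes "satisfiable vars clauses pos neg" "0 < T"
  shows "\<exists>\<tau>. rules \<tau>"
proof -
  obtain \<alpha> where \<alpha>: "\<And>c. c < clauses \<Longrightarrow> (\<exists>i<vars. pos c i \<or> neg c i) \<Longrightarrow>
      (\<exists>i<vars. pos c i \<and> \<alpha> i \<or> neg c i \<and> \<not> \<alpha> i)"
    using assms(1) unfolding satisfiable_def by blast
  have sat: "\<exists>i<vars. is_pos \<kappa> t j p q v i \<and> \<alpha> i \<or> is_neg \<kappa> t j p q v i \<and> \<not> \<alpha> i"
    if "\<kappa> < 11" "guard t j p q v" "i < vars" "is_pos \<kappa> t j p q v i \<or> is_neg \<kappa> t j p q v i" for \<kappa> t j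
        p q v i
  proof -
    have b: "\<forall>d \<in> set [\<kappa>, t, j, p, q, v]. d < B" using that(1,2) by (auto simp: guard_def B_def)
    let ?c = "num [\<kappa>, t, j, p, q, v]"
    have c: "?c < clauses" using num_less[OF b] unfolding clauses_def numeral_nat by
        (simp only: list.size add_0 add_0_right add_Suc_right One_nat_def)
    have "dig 0 ?c = \<kappa>" "dig 1 ?c = t" "dig 2 ?c = j" "dig 3 ?c = p" "dig 4 ?c = q" "dig 5 ?c = v"
      by (subst dig_num[OF b], simp, simp)+
    then have "pos ?c = is_pos \<kappa> t j p q v" "neg ?c = is_neg \<kappa> t j p q v"
      using that(2) by (simp_all add: fun_eq_iff pos_def neg_def)
    then show ?thesis using \<alpha>[OF c] that(3,4) by auto
  qed
  define \<tau> where "\<tau> \<kappa> t j p a = \<alpha> (var \<kappa> t j p a)" for \<kappa> t j p a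
  note [simp] = guard_def in_range_def sizes(1) symbol_less symbol_less[unfolded One_nat_def]
      code_less assms(2)
  have W: "0 < W" "1 < W" using sizes by auto
  have "\<tau> 0 0 0 0 (start M)"
    using sat[of 0 0 0 0 0 0 "var 0 0 0 0 (start M)"] W var_less[of 0 0 0 0 "start M"] by
        (auto simp: is_pos_def is_neg_def \<tau>_def simp del: num.simps)
  moreover have "\<tau> 1 0 j T 0" if "j < k" for j
    using sat[of 1 0 j 0 0 0 "var 1 0 j T 0"] that W var_less[of 1 0 j T 0] by
        (auto simp: is_pos_def is_neg_def \<tau>_def simp del: num.simps)
  moreover have "\<tau> 2 0 j p (init_symbol j p 0) \<or> \<tau> 2 0 j p (init_symbol j p 1) \<or> \<tau> 2 0 j p
      (init_symbol j p 2)"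
    if "j < k" "p \<le> 2 * T" for j p
    using sat[of 2 0 j p 0 0 "var 2 0 j p (init_symbol j p 0)"] that W
        var_less[of 2 0 j p "init_symbol j p 0"]
    by (auto simp: is_pos_def is_neg_def \<tau>_def simp del: num.simps)
  moreover have "\<tau> 2 0 0 (p + 1) 0" if "p < 2 * T" "cert 0 p" "\<tau> 2 0 0 p 0" for p
    using sat[of 3 0 0 p 0 0 "var 2 0 0 p 0"] that W var_less[of 2 0 0 p 0]
    by (auto simp: is_pos_def is_neg_def \<tau>_def simp del: num.simps)
  moreover have "\<tau> 3 t j 0 v" if "t < T" "j < k" "p \<le> 2 * T" "v < W" "\<tau> 1 t j p 0" "\<tau> 2 t j p v" for
      t j p v
    using sat[of 4 t j p 0 v "var 3 t j 0 v"] that W var_less[of 3 t j 0 v]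
    by (auto simp: is_pos_def is_neg_def \<tau>_def simp del: num.simps)
  moreover have "\<tau> 4 t 0 0 v" if "t < T" "v < W" "\<tau> 0 t 0 0 (state_of v)" "\<forall>j<k. \<tau> 3 t j 0
      (read_of v j)" for t v
    using sat[of 5 t 0 0 0 v "var 4 t 0 0 v"] that W var_less[of 4 t 0 0 v]
    by (auto simp: is_pos_def is_neg_def \<tau>_def simp del: num.simps)
  moreover have "\<tau> 0 (t + 1) 0 0 (next_of v)" if "t < T" "v < W" "\<tau> 4 t 0 0 v" for t v
    using sat[of 6 t 0 0 0 v "var 4 t 0 0 v"] that W var_less[of 4 t 0 0 v]
    by (auto simp: is_pos_def is_neg_def \<tau>_def simp del: num.simps)
  moreover have "\<tau> 1 (t + 1) j (p + shift_of v j - 1) 0" if "t < T" "j < k" "p \<le> 2 * T" "v < W" "\<tau> 4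
      t 0 0 v" "\<tau> 1 t j p 0" for t j p v
    using sat[of 7 t j p 0 v "var 4 t 0 0 v"] that W var_less[of 4 t 0 0 v]
    by (auto simp: is_pos_def is_neg_def \<tau>_def simp del: num.simps)
  moreover have "\<tau> 2 (t + 1) j p (write_of v j)" if "t < T" "j < k" "p \<le> 2 * T" "v < W" "\<tau> 4 t 0 0
      v" "\<tau> 1 t j p 0" for t j p v
    using sat[of 8 t j p 0 v "var 4 t 0 0 v"] that W var_less[of 4 t 0 0 v]
    by (auto simp: is_pos_def is_neg_def \<tau>_def simp del: num.simps)
  moreover have "\<tau> 2 (t + 1) j p v" if "t < T" "j < k" "p \<le> 2 * T" "q \<le> 2 * T" "v < W" "p \<noteq> q" "\<tau> 1
      t j q 0" "\<tau> 2 t j p v" for t j p q v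
    using sat[of 9 t j p q v "var 2 t j p v"] that W var_less[of 2 t j p v]
    by (auto simp: is_pos_def is_neg_def \<tau>_def simp del: num.simps)
  moreover have "\<not> \<tau> 2 T (k - 1) T 1"
    using sat[of 10 0 0 0 0 0 "var 2 T (k - 1) T 1"] W var_less[of 2 T "k - 1" T 1]
    by (auto simp: is_pos_def is_neg_def \<tau>_def simp del: num.simps)
  ultimately show ?thesis unfolding rules_def
    by (intro exI[of _ \<tau>] conjI allI impI) simp_all
qed

text \<open>Decoding digits turns \<open>\<tau>\<close> into an assignment. A violated clause would
  have all its positive atoms false and all its negated atoms true in \<open>\<tau>\<close>, against
  the rule that it instantiates.\<close>

lemma satisfiable_of_rules:
  assumes "rules \<tau>" and T: "2 * length x + P < T"
  shows "satisfiable vars clauses pos neg"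
proof -
  define \<alpha> where "\<alpha> i = \<tau> (dig 0 i) (dig 1 i) (dig 2 i) (dig 3 i) (dig 4 i)" for i
  have \<alpha>: "\<alpha> (var \<kappa> t j p a) = \<tau> \<kappa> t j p a" if "in_range \<kappa> t j p a" for \<kappa> t j p a
    unfolding \<alpha>_def using in_range_less[OF that] by (simp only: dig_num length_Cons list.size) simp
  show ?thesis
    unfolding satisfiable_def
  proof (intro exI[of _ \<alpha>] allI impI)
    fix c assume "\<exists>i<vars. pos c i \<or> neg c i"
    define \<kappa> t j p q v where d: "\<kappa> = dig 0 c" "t = dig 1 c" "j = dig 2 c" "p = dig 3 c" "q = dig 4
        c" "v = dig 5 c"
    have g: "guard t j p q v" and ex: "\<exists>i. is_pos \<kappa> t j p q v i \<or> is_neg \<kappa> t j p q v i"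
      using \<open>\<exists>i<vars. pos c i \<or> neg c i\<close> by (auto simp: pos_def neg_def d)
    then have pn: "pos c = is_pos \<kappa> t j p q v" "neg c = is_neg \<kappa> t j p q v"
      by (simp_all add: fun_eq_iff pos_def neg_def d)
    show "\<exists>i<vars. pos c i \<and> \<alpha> i \<or> neg c i \<and> \<not> \<alpha> i"
    proof (rule ccontr)
      assume no: "\<not> ?thesis"
      then have P: "\<not> \<tau> \<kappa>' t' j' p' a" if "is_pos \<kappa> t j p q v (var \<kappa>' t' j' p' a)" "in_range \<kappa>' t'
          j' p' a" for \<kappa>' t' j' p' a
        using \<alpha>[OF that(2)] var_less[OF that(2)] that(1) unfolding pn by blast
      have N: "\<tau> \<kappa>' t' j' p' a" if "is_neg \<kappa> t j p q v (var \<kappa>' t' j' p' a)" "in_range \<kappa>' t' j' p' a"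
          for \<kappa>' t' j' p' a
        using \<alpha>[OF that(2)] var_less[OF that(2)] that(1) no unfolding pn by blast
      note [simp] = in_range_def sizes(1) symbol_less symbol_less[unfolded One_nat_def] code_less
      note R = assms(1)[unfolded rules_def]
      have W: "0 < W" "Suc 0 < W" using sizes by auto
      have g': "t < T" "j < k" "p \<le> 2 * T" "q \<le> 2 * T" "v < W" using g by (auto simp: guard_def)
      have sh: "p + shift_of v j - 1 \<le> 2 * T + 1" using shift_le[of v j] g' by simp
      from ex have "\<kappa> \<in> {0, 1, 2, 3, 4, 5, 6, 7, 8, 9, 10}" by (auto simp: is_pos_def is_neg_def)
      then consider "\<kappa> = 0" | "\<kappa> = 1" | "\<kappa> = 2" | "\<kappa> = 3" | "\<kappa> = 4" | "\<kappa> = 5" | "\<kappa> = 6" | "\<kappa> = 7" |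
          "\<kappa> = 8" | "\<kappa> = 9" | "\<kappa> = 10"
        by auto
      then show False
      proof cases
        case 1
        then show ?thesis using R P[of 0 0 0 0 "start M"] by (simp add: is_pos_def del: num.simps)
      next
        case 2
        then show ?thesis using R P[of 1 0 j T 0] g' W by (simp add: is_pos_def del: num.simps)
      next
        case 3
        have "\<tau> 2 0 j p (init_symbol j p 0) \<or> \<tau> 2 0 j p (init_symbol j p 1) \<or> \<tau> 2 0 j p
            (init_symbol j p 2)"
          using R[THEN conjunct2, THEN conjunct2, THEN conjunct1] g'(2,3) by blast
        then show ?thesis
          using 3 P[of 2 0 j p "init_symbol j p 0"] P[of 2 0 j p "init_symbol j p 1"]
              P[of 2 0 j p "init_symbol j p 2"] g' W
          by (auto simp: is_pos_def simp del: num.simps)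
      next
        case 4
        then have c: "cert 0 p" using ex by (auto simp: is_pos_def is_neg_def)
        \<comment> \<open>The guard admits \<open>p = 2 * T\<close>, which rule 3 excludes; but the
          certificate ends at \<open>T + 2 * length x + P\<close>, which is smaller.\<close>
        then have "p < 2 * T" using T by (simp add: cert_def)
        with c show ?thesis using 4 R P[of 2 0 0 "p + 1" 0] N[of 2 0 0 p 0] g' W
          by (auto simp: is_pos_def is_neg_def simp del: num.simps)
      next
        case 5
        then show ?thesis using R P[of 3 t j 0 v] N[of 1 t j p 0] N[of 2 t j p v] g' W
          by (auto simp: is_pos_def is_neg_def simp del: num.simps)
      next
        case 6
        have "\<tau> 3 t j' 0 (read_of v j')" if "j' < k" for j'
          using 6 N[of 3 t j' 0 "read_of v j'"] that g' by
              (auto simp: is_neg_def simp del: num.simps)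
        then show ?thesis using 6 R P[of 4 t 0 0 v] N[of 0 t 0 0 "state_of v"] g' W
          by (auto simp: is_pos_def is_neg_def simp del: num.simps)
      next
        case 7
        then show ?thesis using R P[of 0 "t + 1" 0 0 "next_of v"] N[of 4 t 0 0 v] g' W
          by (auto simp: is_pos_def is_neg_def simp del: num.simps)
      next
        case 8
        then show ?thesis using R P[of 1 "t + 1" j "p + shift_of v j - 1" 0] N[of 4 t 0 0 v]
            N[of 1 t j p 0] g' W sh
          by (auto simp: is_pos_def is_neg_def simp del: num.simps)
      next
        case 9
        then show ?thesis using R P[of 2 "t + 1" j p "write_of v j"] N[of 4 t 0 0 v] N[of 1 t j p 0]
            g' W
          by (auto simp: is_pos_def is_neg_def simp del: num.simps)
      next
        case 10
        then have "p \<noteq> q" using ex by (auto simp: is_pos_def is_neg_def)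
        then show ?thesis using 10 R P[of 2 "t + 1" j p v] N[of 1 t j q 0] N[of 2 t j p v] g' W
          by (auto simp: is_pos_def is_neg_def simp del: num.simps)
      next
        case 11
        then show ?thesis using R N[of 2 T "k - 1" T 1] g' W
          by (auto simp: is_pos_def is_neg_def simp del: num.simps)
      qed
    qed
  qed
qed

theorem satisfiable_iff:
  assumes "2 * length x + P < T"
  shows "satisfiable vars clauses pos neg \<longleftrightarrow> (\<exists>u. length u \<le> P \<and> fst (snd (conf u T) ! (k - 1)) 0 \<noteq>
      1)"
  using rules_of_satisfiable satisfiable_of_rules[OF _ assms] rules_truth truth_of_rules[OF _ assms]
      assms
  by (metis gr_zeroI not_less0)

end

section \<open>The reduction\<close>

primrec Power :: "expr \<Rightarrow> nat \<Rightarrow> expr" where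
  "Power a 0 = Num 1" | "Power a (Suc i) = Mul a (Power a i)"

lemma eval_Power [simp]: "eval x e (Power a i) = eval x e a ^ i"
  by (induction i) auto

text \<open>One generator has to serve all inputs: the expressions reach \<open>x\<close> through
  \<open>Len\<close> and \<open>Symbol\<close>, and \<open>P\<close> and \<open>T\<close> through
  \<open>PE\<close> and \<open>TE\<close>, while data of \<open>M\<close> enter as numerals.\<close>

locale reduction = tableau +
  fixes PE TE :: expr
  assumes PE [simp]: "\<And>e. eval x e PE = P" and TE [simp]: "\<And>e. eval x e TE = T"
begin

sublocale gadget vars clauses pos neg .

definition "B_expr = Add (Mul (Num 2) TE) (Num (W + k + 12))"
definition "num_expr as = foldr (\<lambda>a y. Add a (Mul B_expr y)) as (Num 0)"
definition "dig_expr i c = Mod (Div c (Power B_expr i)) B_expr"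
definition "cert_expr p = Conj [Less (Add TE (Mul (Num 2) Len)) p, Le p
    (Add (Add TE (Mul (Num 2) Len)) PE)]"
definition "fixed_expr z = Cond (Less z (Mul (Num 2) Len))
  (Cond (Mod z (Num 2)) (Symbol (Div z (Num 2))) (Num 2)) (Eq z (Mul (Num 2) Len))"
definition "symbol_expr j p a = Cond (Eq j (Num 0))
  (Cond (cert_expr p) (Num a) (Cond (Le TE p) (fixed_expr (Sub p TE)) (Num 0))) (Num 0)"
definition "guard_expr t j p q v = Conj [Less t TE, Less j (Num k), Le p (Mul (Num 2) TE), Le q
    (Mul (Num 2) TE), Less v (Num W)]"
definition "is_var i \<kappa> t j p a = Eq i (num_expr [Num \<kappa>, t, j, p, a])"
definition "some_tape f = Disj (map f [0..<k])"
text \<open>A \<open>Table\<close> has one argument; the dependence of shifts and written symbols on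
  the tape becomes a case distinction over the \<open>k\<close> tapes, a number fixed with the
  machine.\<close>

definition "pos_expr \<kappa> t j p q v i = Disj [
  And (Eq \<kappa> (Num 0)) (is_var i 0 (Num 0) (Num 0) (Num 0) (Num (start M))),
  And (Eq \<kappa> (Num 1)) (is_var i 1 (Num 0) j TE (Num 0)),
  And (Eq \<kappa> (Num 2)) (Disj (map (\<lambda>a. is_var i 2 (Num 0) j p (symbol_expr j p a)) [0, 1, 2])),
  Conj [Eq \<kappa> (Num 3), cert_expr p, is_var i 2 (Num 0) (Num 0) (Add p (Num 1)) (Num 0)],
  And (Eq \<kappa> (Num 4)) (is_var i 3 t j (Num 0) v),
  And (Eq \<kappa> (Num 5)) (is_var i 4 t (Num 0) (Num 0) v),
  And (Eq \<kappa> (Num 6)) (is_var i 0 (Add t (Num 1)) (Num 0) (Num 0) (Table next_of W v)),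
  And (Eq \<kappa> (Num 7)) (some_tape (\<lambda>l. And (Eq j (Num l))
    (is_var i 1 (Add t (Num 1)) j (Sub (Add p (Table (\<lambda>v. shift_of v l) W v)) (Num 1)) (Num 0)))),
  And (Eq \<kappa> (Num 8)) (some_tape (\<lambda>l. And (Eq j (Num l))
    (is_var i 2 (Add t (Num 1)) j p (Table (\<lambda>v. write_of v l) W v)))),
  Conj [Eq \<kappa> (Num 9), Neg (Eq p q), is_var i 2 (Add t (Num 1)) j p v]]"
definition "neg_expr \<kappa> t j p q v i = Disj [
  Conj [Eq \<kappa> (Num 3), cert_expr p, is_var i 2 (Num 0) (Num 0) p (Num 0)],
  And (Eq \<kappa> (Num 4)) (Or (is_var i 1 t j p (Num 0)) (is_var i 2 t j p v)),
  And (Eq \<kappa> (Num 5)) (Or (is_var i 0 t (Num 0) (Num 0) (Table state_of W v))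
    (some_tape (\<lambda>l. is_var i 3 t (Num l) (Num 0) (Table (\<lambda>v. read_of v l) W v)))),
  And (Eq \<kappa> (Num 6)) (is_var i 4 t (Num 0) (Num 0) v),
  And (Eq \<kappa> (Num 7)) (Or (is_var i 4 t (Num 0) (Num 0) v) (is_var i 1 t j p (Num 0))),
  And (Eq \<kappa> (Num 8)) (Or (is_var i 4 t (Num 0) (Num 0) v) (is_var i 1 t j p (Num 0))),
  Conj [Eq \<kappa> (Num 9), Neg (Eq p q), Or (is_var i 1 t j q (Num 0)) (is_var i 2 t j p v)],
  And (Eq \<kappa> (Num 10)) (is_var i 2 TE (Num (k - 1)) TE (Num 1))]"

definition "on_clause f c i = And (guard_expr (dig_expr 1 c) (dig_expr 2 c) (dig_expr 3 c)
    (dig_expr 4 c) (dig_expr 5 c))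
  (f (dig_expr 0 c) (dig_expr 1 c) (dig_expr 2 c) (dig_expr 3 c) (dig_expr 4 c) (dig_expr 5 c) i)"

definition "vars_expr a = Mul (Num a) (Power B_expr 5)"
definition "core_expr = Add (vars_expr 4) (Power B_expr 6)"
definition "pendants_expr = Add (Mul core_expr core_expr) (Num 1)"
definition "order_expr = Add core_expr (Mul (vars_expr 2) pendants_expr)"
definition "cap_expr = Add pendants_expr (Mul core_expr core_expr)"
definition "occurs_expr c u = Disj [
  And (Less u (vars_expr 1)) (on_clause pos_expr c u),
  Conj [Le (vars_expr 1) u, Less u (vars_expr 2), on_clause neg_expr c (Sub u (vars_expr 1))],
  Conj [Le (vars_expr 2) u, Less u (vars_expr 3),
    Or (on_clause pos_expr c (Sub u (vars_expr 2))) (on_clause neg_expr c (Sub u (vars_expr 2)))]]"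
definition "adj_expr u v = Disj [
  Conj [Le (vars_expr 3) v, Less v (vars_expr 4),
    Disj [Eq v (Add u (vars_expr 3)), Eq v (Add u (vars_expr 2)), Eq v (Add u (vars_expr 1))]],
  Conj [Le (vars_expr 4) v, Less v core_expr, occurs_expr (Sub v (vars_expr 4)) u],
  Conj [Le core_expr v, Less v order_expr, Eq u (Div (Sub v core_expr) pendants_expr)]]"
definition "degree_expr = Sum (vars_expr 3) (occurs_expr (Sub (Var 0) (vars_expr 4)) (Var 1))"
text \<open>The third conjunct is nonzero exactly for degree at least 2, which accounts for the
  maximum with 1 in \<open>quota\<close>.\<close>

definition "quota_expr = Cond (And (Le (vars_expr 3) (Var 0)) (Less (Var 0) (vars_expr 4))) (Num 2)
  (Cond (Conj [Le (vars_expr 4) (Var 0), Less (Var 0) core_expr, Sub degree_expr (Num 1)])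
     (Sub degree_expr (Num 1)) (Num 1))"
definition "output_gen = Both (Out cap_expr) (Both (Out order_expr)
    (Both (For order_expr (Out quota_expr))
  (For order_expr (For order_expr (For (adj_expr (Var 0) (Var 1))
      (Both (Out (Var 0)) (Out (Var 1))))))))"

section \<open>Values of the expressions\<close>

lemma eval_B [simp]: "eval x e B_expr = B"
  by (simp add: B_expr_def B_def)

lemma eval_num [simp]: "eval x e (num_expr as) = num (map (eval x e) as)"
  unfolding num_expr_def by (induction as) auto

lemma eval_dig [simp]: "eval x e (dig_expr i c) = dig i (eval x e c)"
  by (simp add: dig_expr_def dig_def)

lemma eval_cert [simp]: "eval x e (cert_expr p) = of_bool (cert 0 (eval x e p))"
  by (simp add: cert_expr_def cert_def)

lemma eval_fixed [simp]: "eval x e (fixed_expr z) = fixed_symbol x (eval x e z)"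
  by (simp add: fixed_expr_def fixed_symbol_def even_iff_mod_2_eq_zero)

lemma eval_symbol [simp]: "eval x e (symbol_expr j p a) = init_symbol (eval x e j) (eval x e p) a"
  by (auto simp: symbol_expr_def init_symbol_def cert_def)

lemma eval_guard [simp]: "eval x e (guard_expr t j p q v) =
    of_bool (guard (eval x e t) (eval x e j) (eval x e p) (eval x e q) (eval x e v))"
  by (simp add: guard_expr_def guard_def)

lemma eval_is_var [simp]: "eval x e (is_var i \<kappa> t j p a) =
    of_bool (eval x e i = var \<kappa> (eval x e t) (eval x e j) (eval x e p) (eval x e a))"
  by (simp add: is_var_def del: num.simps)

lemma eval_some_tape [simp]: "eval x e (some_tape f) = of_bool (\<exists>l<k. eval x e (f l) \<noteq> 0)"
  by (auto simp: some_tape_def eval_Disj)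

lemmas clause_evals = eval_Disj_Cons eval_Conj_Cons eval_And eval_Or eval_Eq eval_is_var
    eval_some_tape eval_cert
  eval_symbol eval_Neg eval_Table eval.simps(2,5,6) TE of_bool_eq_0_iff one_neq_zero not_not
      simp_thms list.map

text \<open>The guard puts \<open>v\<close> into the range of the tables and \<open>j\<close> among
  the tapes, so the disjunction over tapes collapses to the case of \<open>j\<close>.\<close>

lemma eval_pos:
  assumes "guard (eval x e t) (eval x e j) (eval x e p) (eval x e q) (eval x e v)"
  shows "eval x e (pos_expr \<kappa> t j p q v i) =
    of_bool (is_pos (eval x e \<kappa>) (eval x e t) (eval x e j) (eval x e p) (eval x e q) (eval x e v)
        (eval x e i))"
proof -
  have "eval x e v < W" and "(\<exists>l<k. eval x e j = l \<and> Q l) \<longleftrightarrow> Q (eval x e j)" for Q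
    using assms by (auto simp: guard_def)
  then show ?thesis
    unfolding pos_expr_def is_pos_def by (simp only: clause_evals)
qed

lemma eval_neg:
  assumes "guard (eval x e t) (eval x e j) (eval x e p) (eval x e q) (eval x e v)"
  shows "eval x e (neg_expr \<kappa> t j p q v i) =
    of_bool (is_neg (eval x e \<kappa>) (eval x e t) (eval x e j) (eval x e p) (eval x e q) (eval x e v)
        (eval x e i))"
proof -
  have "eval x e v < W" and "(\<exists>l<k. eval x e j = l \<and> Q l) \<longleftrightarrow> Q (eval x e j)" for Q
    using assms by (auto simp: guard_def)
  then show ?thesis
    unfolding neg_expr_def is_neg_def by (simp only: clause_evals)
qed

lemma eval_on_clause [simp]:
  "eval x e (on_clause pos_expr c i) = of_bool (pos (eval x e c) (eval x e i))"
  "eval x e (on_clause neg_expr c i) = of_bool (neg (eval x e c) (eval x e i))"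
  using eval_pos[of e "dig_expr 1 c" "dig_expr 2 c" "dig_expr 3 c" "dig_expr 4 c" "dig_expr 5 c"]
    eval_neg[of e "dig_expr 1 c" "dig_expr 2 c" "dig_expr 3 c" "dig_expr 4 c" "dig_expr 5 c"]
  by (auto simp: on_clause_def pos_def neg_def)

lemma eval_vars [simp]: "eval x e (vars_expr a) = a * vars"
  by (simp add: vars_expr_def vars_def)

lemma eval_core [simp]: "eval x e core_expr = core"
  by (simp add: core_expr_def core_def flip: clauses_def)

lemma eval_pendants [simp]: "eval x e pendants_expr = pendants"
  by (simp add: pendants_expr_def pendants_def)

lemma eval_order [simp]: "eval x e order_expr = order"
  by (simp add: order_expr_def order_def)

lemma eval_cap [simp]: "eval x e cap_expr = cap"
  by (simp add: cap_expr_def cap_def)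

lemma eval_occurs [simp]: "eval x e (occurs_expr c u) = of_bool (occurs (eval x e c) (eval x e u))"
  by (simp add: occurs_expr_def occurs_def)

lemma eval_adj [simp]: "eval x e (adj_expr u v) = of_bool (adj (eval x e u) (eval x e v))"
  by (simp add: adj_expr_def adj_def)

lemma eval_degree [simp]: "eval x [v] degree_expr =
    (\<Sum>u<3 * vars. of_bool (occurs (v - 4 * vars) u))"
  by (simp add: degree_expr_def)

lemma eval_quota [simp]: "eval x [v] quota_expr = quota v"
  unfolding quota_expr_def quota_def by (auto simp: max_def)

lemma outputs_output_gen: "outputs x [] output_gen =
    cap # order # map quota [0..<order] @ concat (map (\<lambda>(u, v). [u, v]) edge_list)"
proof -
  have row: "concat (map (\<lambda>v. if adj u v then [u, v] else []) vs) =
      concat (map (\<lambda>(u, v). [u, v]) (concat (map (\<lambda>v. if adj u v then [(u, v)] else []) vs)))" for u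
          vs
    by (induction vs) auto
  have all: "concat (map (\<lambda>u. concat (map (\<lambda>v. if adj u v then [u, v] else []) vs)) us) =
      concat (map (\<lambda>(u, v). [u, v]) (concat (map
          (\<lambda>u. concat (map (\<lambda>v. if adj u v then [(u, v)] else []) vs)) us)))" for us vs
    by (induction us) (simp_all add: row)
  have body: "outputs x [u, v] (For (adj_expr (Var 0) (Var 1)) (Both (Out (Var 0)) (Out (Var 1)))) =
      (if adj u v then [u, v] else [])" for u v by simp
  show ?thesis
    unfolding output_gen_def edge_list_def all[symmetric]
    using body by (simp add: concat_map_singleton del: eval_adj)
qed

lemma reduction_correct:
  assumes "2 * length x + P < T"
  shows "enc_nats (outputs x [] output_gen) \<in> min_max_edge_q_coloring \<longleftrightarrow>
    (\<exists>u. length u \<le> P \<and> fst (snd (conf u T) ! (k - 1)) 0 \<noteq> 1)"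
  using enc_instance_in_iff satisfiable_iff[OF assms] unfolding outputs_output_gen enc_instance_def
      by simp

end

section \<open>From a verifier to the reduction\<close>

lemma step_halted: "fst c = halt M \<Longrightarrow> (step M ^^ n) c = c"
  by (induction n) (auto simp: step_def split: prod.splits)

theorem theorem1: "NP_hard min_max_edge_q_coloring"
  unfolding NP_hard_def
proof
  fix A assume "A \<in> NP"
  then obtain R p where R: "polytime_decidable R"
    and A: "\<And>x. x \<in> A \<longleftrightarrow> (\<exists>u. length u \<le> poly p (length x) \<and> pair_enc x u \<in> R)"
    unfolding NP_def by blast
  obtain M q where M: "wf_tm M" "computes_in_time M (\<lambda>x. [x \<in> R]) (poly q)"
    using R unfolding polytime_decidable_def polytime_computable_def by blast
  \<comment> \<open>The argument \<open>1 + 2n + p\<close> bounds the length of the paired input, so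
    the first summand covers the running time; the remaining \<open>2 + 2n + p\<close> makes
    \<open>T\<close> exceed \<open>2n + P\<close>, so the certificate lies within the
    window.\<close>
  define q' where "q' = pcompose q ([:1, 2:] + p) + [:2, 2:] + p"
  let ?g = "reduction.output_gen M (Poly p) (Poly q')"
  have "x \<in> A \<longleftrightarrow> enc_nats (outputs x [] ?g) \<in> min_max_edge_q_coloring" for x
  proof -
    interpret reduction M x "poly p (length x)" "poly q' (length x)" "Poly p" "Poly q'"
      by unfold_locales (simp_all add: M)
    let ?T = "poly q' (length x)"
    have "fst (snd (conf u ?T) ! (ntapes M - 1)) 0 \<noteq> 1 \<longleftrightarrow> pair_enc x u \<in> R" if u: "length u \<le> poly p
        (length x)" for u
    proof -
      obtain t where t: "t \<le> poly q (length (pair_enc x u))" and h: "fst (conf u t) = halt M"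
        and out: "fst (last (snd (conf u t))) = tape_of [pair_enc x u \<in> R]"
        using M(2) unfolding computes_in_time_def conf_def by blast
      have "poly q (length (pair_enc x u)) \<le> poly q (1 + 2 * length x + poly p (length x))"
        using u by (intro poly_nat_mono) (simp add: pair_enc_length)
      then have "t \<le> ?T" using t by (simp add: q'_def poly_pcompose mult.commute)
      \<comment> \<open>A halted configuration repeats itself, so the output at the fixed time
        \<open>?T\<close> is the one at the halting time \<open>t\<close>.\<close>
      then have "conf u ?T = (step M ^^ (?T - t)) (conf u t)"
        unfolding conf_def by (metis comp_apply funpow_add le_add_diff_inverse2)
      then have "conf u ?T = conf u t" using step_halted[OF h] by simp
      moreover have "last (snd (conf u t)) = snd (conf u t) ! (ntapes M - 1)"
        using wf_conf[of u t] sizes(1) by (subst last_conv_nth) (auto simp: wf_config_def)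
      ultimately show ?thesis using out by (simp add: tape_of_def)
    qed
    moreover have "2 * length x + poly p (length x) < ?T" by (simp add: q'_def)
    ultimately show ?thesis using A reduction_correct by blast
  qed
  then show "polytime_reducible A min_max_edge_q_coloring"
    unfolding polytime_reducible_def using outputs_polytime_computable by blast
qed

end
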